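(* Let $\mathcal{C}^\infty$ denote either the category of Chen spaces and smooth maps, or the category of diffeological spaces and smooth maps. In each of these two cases, $\mathcal{C}^\infty$ is a quasitopos with all (small) limits and colimits.
   Context: Diffeological spaces. An open set is an open subset of $\mathbb{R}^n$ (any $n\ge 0$); a function between open sets is smooth if it has continuous derivatives of all orders. A diffeological space is a set $X$ equipped with, for each open set $U$, a set of functions $\varphi\colon U\to X$ called plots in $X$, such that: (1) if $\varphi\colon U\to X$ is a plot and $f\colon U'\to U$ is a smooth function between open sets, then $\varphi f$ is a plot; (2) if open sets $U_j\subseteq U$ form an open cover of the open set $U$, with inclusions $i_j\colon U_j\to U$, and $\varphi\colon U\to X$ is a function such that $\varphi i_j$ is a plot for every $j$, then $\varphi$ is a plot; (3) every map from the one point of $\mathbb{R}^0$ to $X$ is a plot. Chen spaces. A convex set is a convex subset of $\mathbb{R}^n$ (any $n\ge 0$) with nonempty interior. A function $f\colon C\to C'$ between convex sets is smooth if it has continuous derivatives of all orders; here a function $F\colon C\to V$ to a finite-dimensional normed vector space has derivative at $x\in C$ the linear map $dF_x\colon\mathbb{R}^n\to V$ with $\|F(y)-F(x)-dF_x(y-x)\|/\|y-x\|\to 0$ as $y\to x$, $y\in C\setminus\{x\}$ (unique if it exists), and higher derivatives are defined by iteration. A Chen space is a set $X$ equipped with, for each convex set $C$, a set of functions $\varphi\colon C\to X$ called plots in $X$, such that: (1) if $\varphi\colon C\to X$ is a plot and $f\colon C'\to C$ is a smooth function between convex sets, then $\varphi f$ is a plot; (2) if convex sets $C_j\subseteq C$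 form an open cover of the convex set $C$ with its topology as a subspace of $\mathbb{R}^n$, with inclusions $i_j\colon C_j\to C$, and $\varphi\colon C\to X$ is a function such that $\varphi i_j$ is a plot for every $j$, then $\varphi$ is a plot; (3) every map from the one point of $\mathbb{R}^0$ to $X$ is a plot. In both cases a function $f\colon X\to Y$ is a smooth map if for every plot $\varphi$ in $X$ the composite $f\varphi$ is a plot in $Y$. A quasitopos is a locally cartesian closed category with finite colimits and a weak subobject classifier. A category $\mathcal{C}$ is cartesian closed if it has finite products and each functor $-\times Y\colon\mathcal{C}\to\mathcal{C}$ has a right adjoint; it is locally cartesian closed if for every object $B$ the category $\mathcal{C}_B$ of objects over $B$ (slice category) is cartesian closed. A monomorphism $i\colon A\to X$ is strong if for every epimorphism $p\colon E\to B$ and morphisms $f\colon E\to A$, $g\colon B\to X$ with $if=gp$ there is a unique $t\colon B\to A$ with $tp=f$ and $it=g$. In a category $\mathcal{C}$ with finite limits, a weak subobject classifier is an object $\Omega$ with a morphism $\top\colon 1\to\Omega$ such that for every strong monomorphism $i\colon C'\to C$ there is a unique morphism $\chi_i\colon C\to\Omega$ such that the square with sides $i\colon C'\to C$, $\chi_i\colon C\to\Omega$, $!\colon C'\to 1$, $\top\colon 1\to\Omega$ is a pullback. *)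

theory Defs
  imports "HOL-Analysis.Analysis" "HOL-Analysis.Finite_Function_Topology"
begin

unbundle cardinal_syntax

section \<open>Categories\<close>

record ('o, 'm) category =
  Ob :: "'o set"
  Ar :: "'m set"
  Dom :: "'m \<Rightarrow> 'o"
  Cod :: "'m \<Rightarrow> 'o"
  Ident :: "'o \<Rightarrow> 'm"
  Comp :: "'m \<Rightarrow> 'm \<Rightarrow> 'm"  (infixl "\<odot>\<index>" 70)

definition Hom :: "('o, 'm, 'z) category_scheme \<Rightarrow> 'o \<Rightarrow> 'o \<Rightarrow> 'm set" where
  "Hom C a b = {f \<in> Ar C. Dom C f = a \<and> Cod C f = b}"

locale category =
  fixes C :: "('o, 'm, 'z) category_scheme" (structure)
  assumes Dom_in: "f \<in> Ar C \<Longrightarrow> Dom C f \<in> Ob C"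
    and Cod_in: "f \<in> Ar C \<Longrightarrow> Cod C f \<in> Ob C"
    and Ident_in: "a \<in> Ob C \<Longrightarrow> Ident C a \<in> Hom C a a"
    and Comp_in: "f \<in> Hom C a b \<Longrightarrow> g \<in> Hom C b c \<Longrightarrow> g \<odot> f \<in> Hom C a c"
    and Ident_left: "f \<in> Hom C a b \<Longrightarrow> Ident C b \<odot> f = f"
    and Ident_right: "f \<in> Hom C a b \<Longrightarrow> f \<odot> Ident C a = f"
    and Comp_assoc: "f \<in> Hom C a b \<Longrightarrow> g \<in> Hom C b c \<Longrightarrow> h \<in> Hom C c d
                      \<Longrightarrow> (h \<odot> g) \<odot> f = h \<odot> (g \<odot> f)"

text \<open>A functor is given by its object map and its arrow map.\<close>

definition is_functor :: "('a, 'b) category \<Rightarrow> ('c, 'd) category \<Rightarrow> ('a \<Rightarrow> 'c) \<Rightarrow> ('b \<Rightarrow> 'd) \<Rightarrow> bool"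
  where
  "is_functor C D Fo Fa \<longleftrightarrow>
     (\<forall>a\<in>Ob C. Fo a \<in> Ob D) \<and>
     (\<forall>a b. \<forall>f\<in>Hom C a b. Fa f \<in> Hom D (Fo a) (Fo b)) \<and>
     (\<forall>a\<in>Ob C. Fa (Ident C a) = Ident D (Fo a)) \<and>
     (\<forall>a b c. \<forall>f\<in>Hom C a b. \<forall>g\<in>Hom C b c. Fa (g \<odot>\<^bsub>C\<^esub> f) = Fa g \<odot>\<^bsub>D\<^esub> Fa f)"

definition has_right_adjoint ::
    "('a, 'b) category \<Rightarrow> ('c, 'd) category \<Rightarrow> ('a \<Rightarrow> 'c) \<Rightarrow> ('b \<Rightarrow> 'd) \<Rightarrow> bool" where
  "has_right_adjoint C D Fo Fa \<longleftrightarrow>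
     (\<exists>Go Ga \<Phi>. is_functor D C Go Ga \<and>
        (\<forall>a\<in>Ob C. \<forall>b\<in>Ob D. bij_betw (\<Phi> a b) (Hom D (Fo a) b) (Hom C a (Go b))) \<and>
        (\<forall>a a' b b'. \<forall>f\<in>Hom C a' a. \<forall>g\<in>Hom D b b'. \<forall>h\<in>Hom D (Fo a) b.
           \<Phi> a' b' (g \<odot>\<^bsub>D\<^esub> h \<odot>\<^bsub>D\<^esub> Fa f) = Ga g \<odot>\<^bsub>C\<^esub> \<Phi> a b h \<odot>\<^bsub>C\<^esub> f))"


subsection \<open>Limits and colimits\<close>

definition is_cone where
  "is_cone J C Fo Fa L \<pi> \<longleftrightarrow>
     L \<in> Ob C \<and> (\<forall>j\<in>Ob J. \<pi> j \<in> Hom C L (Fo j)) \<and>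
     (\<forall>j k. \<forall>u\<in>Hom J j k. Fa u \<odot>\<^bsub>C\<^esub> \<pi> j = \<pi> k)"

definition is_limit where
  "is_limit J C Fo Fa L \<pi> \<longleftrightarrow>
     is_cone J C Fo Fa L \<pi> \<and>
     (\<forall>A \<alpha>. is_cone J C Fo Fa A \<alpha> \<longrightarrow>
        (\<exists>!h. h \<in> Hom C A L \<and> (\<forall>j\<in>Ob J. \<pi> j \<odot>\<^bsub>C\<^esub> h = \<alpha> j)))"

definition is_cocone where
  "is_cocone J C Fo Fa L \<iota> \<longleftrightarrow>
     L \<in> Ob C \<and> (\<forall>j\<in>Ob J. \<iota> j \<in> Hom C (Fo j) L) \<and>
     (\<forall>j k. \<forall>u\<in>Hom J j k. \<iota> k \<odot>\<^bsub>C\<^esub> Fa u = \<iota> j)"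

definition is_colimit where
  "is_colimit J C Fo Fa L \<iota> \<longleftrightarrow>
     is_cocone J C Fo Fa L \<iota> \<and>
     (\<forall>A \<alpha>. is_cocone J C Fo Fa A \<alpha> \<longrightarrow>
        (\<exists>!h. h \<in> Hom C L A \<and> (\<forall>j\<in>Ob J. h \<odot>\<^bsub>C\<^esub> \<iota> j = \<alpha> j)))"

definition has_limits_of_shape :: "('i, 'j) category \<Rightarrow> ('o, 'm) category \<Rightarrow> bool" where
  "has_limits_of_shape J C \<longleftrightarrow>
     (\<forall>Fo Fa. is_functor J C Fo Fa \<longrightarrow> (\<exists>L \<pi>. is_limit J C Fo Fa L \<pi>))"

definition has_colimits_of_shape :: "('i, 'j) category \<Rightarrow> ('o, 'm) category \<Rightarrow> bool" where
  "has_colimits_of_shape J C \<longleftrightarrow>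
     (\<forall>Fo Fa. is_functor J C Fo Fa \<longrightarrow> (\<exists>L \<iota>. is_colimit J C Fo Fa L \<iota>))"

text \<open>Every finite category is isomorphic to one whose objects and arrows are natural numbers.\<close>

definition has_finite_limits :: "('o, 'm) category \<Rightarrow> bool" where
  "has_finite_limits C \<longleftrightarrow>
     (\<forall>J :: (nat, nat) category. category J \<and> finite (Ob J) \<and> finite (Ar J)
        \<longrightarrow> has_limits_of_shape J C)"

definition has_finite_colimits :: "('o, 'm) category \<Rightarrow> bool" where
  "has_finite_colimits C \<longleftrightarrow>
     (\<forall>J :: (nat, nat) category. category J \<and> finite (Ob J) \<and> finite (Ar J)
        \<longrightarrow> has_colimits_of_shape J C)"

text \<open>
  Smallness is relative to a universe type \<open>'u\<close>: a set, of whatever type, is small if it has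
  fewer elements than \<open>'u\<close>.  If \<open>\<kappa>\<close> is the cardinality of \<open>'u\<close>, the conditions of
  \<open>grothendieck_universe\<close> say that \<open>\<kappa>\<close> is a regular strong limit cardinal, so that the small
  subsets of \<open>'u\<close> and the maps between them form a category equivalent to that of the sets in
  the Grothendieck universe \<open>V\<^sub>\<kappa>\<close>.  Uncountability is not required: \<open>V\<^sub>\<omega>\<close> is included.
\<close>

definition small :: "'u itself \<Rightarrow> 'a set \<Rightarrow> bool" where
  "small (_ :: 'u itself) A \<longleftrightarrow> |A| <o |UNIV :: 'u set|"

definition grothendieck_universe :: "'u itself \<Rightarrow> bool" where
  "grothendieck_universe (_ :: 'u itself) \<longleftrightarrow>
     infinite (UNIV :: 'u set) \<and>
     (\<forall>A :: 'u set. small TYPE('u) A \<longrightarrow> small TYPE('u) (Pow A)) \<and>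
     (\<forall>\<A> :: 'u set set. small TYPE('u) \<A> \<and> (\<forall>A\<in>\<A>. small TYPE('u) A) \<longrightarrow> small TYPE('u) (\<Union>\<A>))"

lemma grothendieck_universe_nat: "grothendieck_universe TYPE(nat)"
proof -
  have *: "small TYPE(nat) A \<longleftrightarrow> finite A" for A :: "'b set"
    unfolding small_def
    by (meson finite_iff_ordLess_natLeq infinite_UNIV_nat infinite_iff_card_of_nat
        infinite_iff_natLeq_ordLeq not_ordLeq_ordLess ordLess_ordLeq_trans)
  show ?thesis
    by (simp add: grothendieck_universe_def *)
qed

text \<open>A small category is isomorphic to one whose objects and arrows are elements of \<open>'u\<close>.\<close>

definition has_small_limits :: "'u itself \<Rightarrow> ('o, 'm) category \<Rightarrow> bool" where
  "has_small_limits (_ :: 'u itself) C \<longleftrightarrow>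
     (\<forall>J :: ('u, 'u) category. category J \<and> small TYPE('u) (Ob J) \<and> small TYPE('u) (Ar J)
        \<longrightarrow> has_limits_of_shape J C)"

definition has_small_colimits :: "'u itself \<Rightarrow> ('o, 'm) category \<Rightarrow> bool" where
  "has_small_colimits (_ :: 'u itself) C \<longleftrightarrow>
     (\<forall>J :: ('u, 'u) category. category J \<and> small TYPE('u) (Ob J) \<and> small TYPE('u) (Ar J)
        \<longrightarrow> has_colimits_of_shape J C)"


subsection \<open>Locally cartesian closed categories\<close>

definition is_product where
  "is_product C I X P \<pi> \<longleftrightarrow>
     P \<in> Ob C \<and> (\<forall>i\<in>I. \<pi> i \<in> Hom C P (X i)) \<and>
     (\<forall>A\<in>Ob C. \<forall>\<alpha>. (\<forall>i\<in>I. \<alpha> i \<in> Hom C A (X i)) \<longrightarrow>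
        (\<exists>!h. h \<in> Hom C A P \<and> (\<forall>i\<in>I. \<pi> i \<odot>\<^bsub>C\<^esub> h = \<alpha> i)))"

definition has_finite_products :: "('o, 'm) category \<Rightarrow> bool" where
  "has_finite_products C \<longleftrightarrow>
     (\<forall>I :: nat set. \<forall>X. finite I \<and> X ` I \<subseteq> Ob C \<longrightarrow> (\<exists>P \<pi>. is_product C I X P \<pi>))"

definition is_binary_product where
  "is_binary_product C x y P p q \<longleftrightarrow>
     P \<in> Ob C \<and> p \<in> Hom C P x \<and> q \<in> Hom C P y \<and>
     (\<forall>A\<in>Ob C. \<forall>f\<in>Hom C A x. \<forall>g\<in>Hom C A y.
        (\<exists>!h. h \<in> Hom C A P \<and> p \<odot>\<^bsub>C\<^esub> h = f \<and> q \<odot>\<^bsub>C\<^esub> h = g))"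

text \<open>The functor \<open>- \<times> y\<close> depends on a choice of products; the following recognizes the functors
  arising from all possible choices.\<close>

definition is_product_functor :: "('o, 'm) category \<Rightarrow> 'o \<Rightarrow> ('o \<Rightarrow> 'o) \<Rightarrow> ('m \<Rightarrow> 'm) \<Rightarrow> bool" where
  "is_product_functor C y Fo Fa \<longleftrightarrow>
     (\<exists>p q. (\<forall>x\<in>Ob C. is_binary_product C x y (Fo x) (p x) (q x)) \<and>
        (\<forall>x x'. \<forall>f\<in>Hom C x x'. Fa f \<in> Hom C (Fo x) (Fo x') \<and>
           p x' \<odot>\<^bsub>C\<^esub> Fa f = f \<odot>\<^bsub>C\<^esub> p x \<and> q x' \<odot>\<^bsub>C\<^esub> Fa f = q x))"

definition cartesian_closed :: "('o, 'm) category \<Rightarrow> bool" where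
  "cartesian_closed C \<longleftrightarrow>
     has_finite_products C \<and>
     (\<forall>y\<in>Ob C. \<forall>Fo Fa. is_product_functor C y Fo Fa \<longrightarrow> has_right_adjoint C C Fo Fa)"

text \<open>An arrow \<open>(p, q, f)\<close> of the slice over \<open>B\<close> is \<open>f\<close> regarded as a morphism from \<open>p\<close> to \<open>q\<close>.\<close>

definition slice :: "('o, 'm) category \<Rightarrow> 'o \<Rightarrow> ('m, 'm \<times> 'm \<times> 'm) category" where
  "slice C B =
     \<lparr> Ob = {p \<in> Ar C. Cod C p = B},
       Ar = {(p, q, f). p \<in> Ar C \<and> Cod C p = B \<and> q \<in> Ar C \<and> Cod C q = B \<and>
                        f \<in> Hom C (Dom C p) (Dom C q) \<and> q \<odot>\<^bsub>C\<^esub> f = p},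
       Dom = (\<lambda>(p, q, f). p),
       Cod = (\<lambda>(p, q, f). q),
       Ident = (\<lambda>p. (p, p, Ident C (Dom C p))),
       Comp = (\<lambda>(q', r, g) (p, q, f). (p, r, g \<odot>\<^bsub>C\<^esub> f)) \<rparr>"

definition locally_cartesian_closed :: "('o, 'm) category \<Rightarrow> bool" where
  "locally_cartesian_closed C \<longleftrightarrow> (\<forall>B\<in>Ob C. cartesian_closed (slice C B))"


subsection \<open>Quasitoposes\<close>

definition is_mono where
  "is_mono C i \<longleftrightarrow> i \<in> Ar C \<and>
     (\<forall>z. \<forall>f\<in>Hom C z (Dom C i). \<forall>g\<in>Hom C z (Dom C i). i \<odot>\<^bsub>C\<^esub> f = i \<odot>\<^bsub>C\<^esub> g \<longrightarrow> f = g)"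

definition is_epi where
  "is_epi C p \<longleftrightarrow> p \<in> Ar C \<and>
     (\<forall>z. \<forall>f\<in>Hom C (Cod C p) z. \<forall>g\<in>Hom C (Cod C p) z. f \<odot>\<^bsub>C\<^esub> p = g \<odot>\<^bsub>C\<^esub> p \<longrightarrow> f = g)"

definition is_strong_mono where
  "is_strong_mono C i \<longleftrightarrow> is_mono C i \<and>
     (\<forall>p f g. is_epi C p \<and> f \<in> Hom C (Dom C p) (Dom C i) \<and> g \<in> Hom C (Cod C p) (Cod C i) \<and>
        i \<odot>\<^bsub>C\<^esub> f = g \<odot>\<^bsub>C\<^esub> p \<longrightarrow>
        (\<exists>!t. t \<in> Hom C (Cod C p) (Dom C i) \<and> t \<odot>\<^bsub>C\<^esub> p = f \<and> i \<odot>\<^bsub>C\<^esub> t = g))"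

definition is_terminal where
  "is_terminal C t \<longleftrightarrow> t \<in> Ob C \<and> (\<forall>a\<in>Ob C. \<exists>!f. f \<in> Hom C a t)"

text \<open>The square with \<open>f \<odot> p = g \<odot> q\<close> is a pullback of \<open>f\<close> and \<open>g\<close>.\<close>

definition is_pullback where
  "is_pullback C f g p q \<longleftrightarrow>
     f \<in> Ar C \<and> g \<in> Ar C \<and> p \<in> Ar C \<and> q \<in> Ar C \<and>
     Cod C f = Cod C g \<and> Dom C p = Dom C q \<and> Cod C p = Dom C f \<and> Cod C q = Dom C g \<and>
     f \<odot>\<^bsub>C\<^esub> p = g \<odot>\<^bsub>C\<^esub> q \<and>
     (\<forall>A. \<forall>a\<in>Hom C A (Dom C f). \<forall>b\<in>Hom C A (Dom C g). f \<odot>\<^bsub>C\<^esub> a = g \<odot>\<^bsub>C\<^esub> b \<longrightarrow>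
        (\<exists>!h. h \<in> Hom C A (Dom C p) \<and> p \<odot>\<^bsub>C\<^esub> h = a \<and> q \<odot>\<^bsub>C\<^esub> h = b))"

definition is_weak_subobject_classifier where
  "is_weak_subobject_classifier C \<Omega> tr \<longleftrightarrow>
     \<Omega> \<in> Ob C \<and> tr \<in> Ar C \<and> is_terminal C (Dom C tr) \<and> Cod C tr = \<Omega> \<and>
     (\<forall>i. is_strong_mono C i \<longrightarrow>
        (\<exists>!ch. ch \<in> Hom C (Cod C i) \<Omega> \<and>
              is_pullback C ch tr i (THE u. u \<in> Hom C (Dom C i) (Dom C tr))))"

definition quasitopos :: "('o, 'm) category \<Rightarrow> bool" where
  "quasitopos C \<longleftrightarrow>
     category C \<and> locally_cartesian_closed C \<and> has_finite_limits C \<and> has_finite_colimits C \<and>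
     (\<exists>\<Omega> tr. is_weak_subobject_classifier C \<Omega> tr)"


section \<open>Smooth functions\<close>

text \<open>
  The spaces \<open>\<real>\<^sup>n\<close> of all dimensions are realized as an increasing chain of subspaces of the
  normed space of finitely supported sequences.  On each of them its norm, which is the sum of the
  absolute values of the coordinates, induces the usual topology.
\<close>

type_synonym fvec = "(nat, real) poly_mapping"

definition Rn :: "nat \<Rightarrow> fvec set" where
  "Rn n = {x. Poly_Mapping.keys x \<subseteq> {..<n}}"

text \<open>
  \<open>Ck k n C F\<close> says that \<open>F\<close> has continuous derivatives of orders \<open>0, \<dots>, k\<close> on \<open>C \<subseteq> \<real>\<^sup>n\<close>.
  A map into the finite-dimensional space of linear maps \<open>\<real>\<^sup>n \<rightarrow> V\<close>, such as \<open>x \<mapsto> dF\<^sub>x\<close>, is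
  continuous or has a derivative if and only if its evaluations at all \<open>v \<in> \<real>\<^sup>n\<close> do; this is
  what makes the iteration possible without changing the type of the functions.  Only the
  restriction of \<open>F' x\<close> to \<open>\<real>\<^sup>n\<close> is relevant; it is unique when \<open>C\<close> is open in \<open>\<real>\<^sup>n\<close>, or convex
  with nonempty interior.
\<close>

primrec Ck :: "nat \<Rightarrow> nat \<Rightarrow> fvec set \<Rightarrow> (fvec \<Rightarrow> fvec) \<Rightarrow> bool" where
  "Ck 0 n C F \<longleftrightarrow> continuous_on C F"
| "Ck (Suc k) n C F \<longleftrightarrow>
     (\<exists>F'. (\<forall>x\<in>C. (F has_derivative F' x) (at x within C)) \<and> (\<forall>v\<in>Rn n. Ck k n C (\<lambda>x. F' x v)))"

definition smooth_between :: "nat \<Rightarrow> fvec set \<Rightarrow> fvec set \<Rightarrow> (fvec \<Rightarrow> fvec) \<Rightarrow> bool" where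
  "smooth_between n C C' f \<longleftrightarrow> f ` C \<subseteq> C' \<and> (\<forall>k. Ck k n C f)"


section \<open>Diffeological spaces and Chen spaces\<close>

text \<open>
  The two notions differ only in the admissible domains of plots.  The dimension \<open>n\<close> is part of a
  domain; it is determined by the set unless the set is empty.
\<close>

definition open_domain :: "nat \<Rightarrow> fvec set \<Rightarrow> bool" where
  "open_domain n U \<longleftrightarrow> openin (top_of_set (Rn n)) U"

definition convex_domain :: "nat \<Rightarrow> fvec set \<Rightarrow> bool" where
  "convex_domain n C \<longleftrightarrow> C \<subseteq> Rn n \<and> convex C \<and> top_of_set (Rn n) interior_of C \<noteq> {}"

record 'u plot_space =
  points :: "'u set"
  plots :: "nat \<Rightarrow> fvec set \<Rightarrow> (fvec \<Rightarrow> 'u) set"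

definition is_plot_space :: "(nat \<Rightarrow> fvec set \<Rightarrow> bool) \<Rightarrow> 'u plot_space \<Rightarrow> bool" where
  "is_plot_space domain X \<longleftrightarrow>
     (\<forall>n U. \<forall>\<phi>\<in>plots X n U. domain n U \<and> \<phi> \<in> U \<rightarrow>\<^sub>E points X) \<and>
     (\<forall>n U m U' \<phi> f. \<phi> \<in> plots X n U \<and> domain m U' \<and> smooth_between m U' U f
        \<longrightarrow> compose U' \<phi> f \<in> plots X m U') \<and>
     (\<forall>n U \<U> \<phi>. domain n U \<and> (\<forall>V\<in>\<U>. domain n V \<and> openin (top_of_set U) V) \<and> \<Union>\<U> = U \<and>
        \<phi> \<in> U \<rightarrow>\<^sub>E points X \<and> (\<forall>V\<in>\<U>. restrict \<phi> V \<in> plots X n V)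
        \<longrightarrow> \<phi> \<in> plots X n U) \<and>
     (\<forall>x\<in>points X. (\<lambda>_\<in>Rn 0. x) \<in> plots X 0 (Rn 0))"

definition diffeological_space :: "'u plot_space \<Rightarrow> bool" where
  "diffeological_space = is_plot_space open_domain"

definition chen_space :: "'u plot_space \<Rightarrow> bool" where
  "chen_space = is_plot_space convex_domain"

definition smooth_map :: "'u plot_space \<Rightarrow> 'u plot_space \<Rightarrow> ('u \<Rightarrow> 'u) \<Rightarrow> bool" where
  "smooth_map X Y f \<longleftrightarrow>
     f \<in> points X \<rightarrow>\<^sub>E points Y \<and> (\<forall>n U. \<forall>\<phi>\<in>plots X n U. compose U f \<phi> \<in> plots Y n U)"

type_synonym 'u smooth_arrow = "'u plot_space \<times> 'u plot_space \<times> ('u \<Rightarrow> 'u)"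

definition smooth_category :: "('u plot_space \<Rightarrow> bool) \<Rightarrow> ('u plot_space, 'u smooth_arrow) category"
  where
  "smooth_category is_space =
     (let Obs = {X. is_space X \<and> small TYPE('u) (points X)} in
      \<lparr> Ob = Obs,
        Ar = {(X, Y, f). X \<in> Obs \<and> Y \<in> Obs \<and> smooth_map X Y f},
        Dom = (\<lambda>(X, Y, f). X),
        Cod = (\<lambda>(X, Y, f). Y),
        Ident = (\<lambda>X. (X, X, \<lambda>x\<in>points X. x)),
        Comp = (\<lambda>(Y', Z, g) (X, Y, f). (X, Z, compose (points X) g f)) \<rparr>)"

definition Chen :: "('u plot_space, 'u smooth_arrow) category" where
  "Chen = smooth_category chen_space"

definition Diffeological :: "('u plot_space, 'u smooth_arrow) category" where
  "Diffeological = smooth_category diffeological_space"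

end

theory Submission
  imports Defs
begin

text \<open>
  Both categories consist of sets with plots on a class of domains of which only three properties
  matter: every point of a domain has small neighbourhoods that are again domains, \<open>\<real>\<^sup>0\<close> is a domain,
  and smooth functions are continuous and can be restricted.  Limits carry the initial structure
  with respect to their projections, colimits the final (locally lifting) structure with respect to
  their injections.  For the exponential of \<open>Y \<rightarrow> B\<close> and \<open>Z \<rightarrow> B\<close> in the slice over \<open>B\<close> the points
  are the smooth maps between fibres \<open>Y\<^sub>b \<rightarrow> Z\<^sub>b\<close>, and a family of them is a plot if it
  turns plots of \<open>Y\<close> over the same base points into plots of \<open>Z\<close>.  Strong monomorphisms are the embeddings of subspaces,
  and these are classified by the two-point space in which every function is a plot.  The universe
  hypotheses are used only to code the resulting point sets by elements of the universe type.
\<close>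

section \<open>Smooth functions and domains\<close>

text \<open>An arrow is determined by its function on points, so every universal property splits
  into a statement about sets and the check that one explicit function preserves plots. The plot
  axioms serve these checks in different ways: pullback along smooth functions handles
  reparametrization, gluing lets a function that lifts only locally still be tested, and constant
  plots make single points visible, for instance when a map out of a fibre product is restricted to
  one fibre. The obstacle is local cartesian closedness. Fibres may be empty, a plot of the
  exponential moves over the base, and the adjoint must exist for every choice of the functor
  \<open>- \<times> y\<close>. Hence a point of the exponential carries its base point explicitly,
  its plots are tested after reparametrization, and the adjunction comes from a universal arrow for
  one fixed choice of products, transported along comparison arrows to every other choice.\<close>

lemma Ck_subset: "Ck k n C F \<Longrightarrow> D \<subseteq> C \<Longrightarrow> Ck k n D F"
proof (induction k arbitrary: F)
  case 0
  then show ?case by (auto intro: continuous_on_subset)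
next
  case (Suc k)
  then obtain F' where F': "\<And>x. x \<in> C \<Longrightarrow> (F has_derivative F' x) (at x within C)"
      "\<And>v. v \<in> Rn n \<Longrightarrow> Ck k n C (\<lambda>x. F' x v)"
    by (metis Ck.simps(2))
  have "(F has_derivative F' x) (at x within D)" if "x \<in> D" for x
    using F'(1) has_derivative_subset that Suc.prems(2) by blast
  then show ?case
    using Suc.IH[OF F'(2) Suc.prems(2)] by auto
qed

text \<open>The derivative of a constant is the constant \<open>0\<close>, so the induction has to
  run over all constants at once.\<close>

lemma Ck_const: "Ck k n C (\<lambda>_. c)"
proof (induction k arbitrary: c)
  case (Suc k)
  show ?case
    by (simp, rule exI[of _ "\<lambda>_ _. 0"]) (use Suc in auto)
qed simp

text \<open>In a fixed direction \<open>v\<close> the derivative of the identity is constantly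
  \<open>v\<close>, so all higher orders are covered by \<open>Ck_const\<close>.\<close>

lemma Ck_ident: "Ck k n C (\<lambda>x. x)"
proof (cases k)
  case (Suc l)
  have "\<forall>x\<in>C. ((\<lambda>x. x) has_derivative (\<lambda>v. v)) (at x within C)"
    using has_derivative_ident by blast
  then show ?thesis
    unfolding Suc Ck.simps by (intro exI[of _ "\<lambda>_ v. v"]) (simp add: Ck_const)
qed simp

lemma smooth_between_subset:
  "smooth_between n C C' f \<Longrightarrow> D \<subseteq> C \<Longrightarrow> f ` D \<subseteq> D' \<Longrightarrow> smooth_between n D D' f"
  unfolding smooth_between_def by (auto intro: Ck_subset[of _ n C])

lemma smooth_between_const: "c \<in> C' \<Longrightarrow> smooth_between n C C' (\<lambda>_. c)"
  by (auto simp: smooth_between_def Ck_const)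

lemma smooth_between_inclusion: "C \<subseteq> C' \<Longrightarrow> smooth_between n C C' (\<lambda>x. x)"
  by (auto simp: smooth_between_def Ck_ident)

lemma smooth_between_continuous: "smooth_between n C C' f \<Longrightarrow> continuous_on C f"
  unfolding smooth_between_def using Ck.simps(1)[of n C f] by presburger

lemma smooth_between_image: "smooth_between n C C' f \<Longrightarrow> f ` C \<subseteq> C'"
  by (simp add: smooth_between_def)

section \<open>Coordinate spaces and sites of plot domains\<close>

lemma Rn_0: "Rn 0 = {0}"
  by (auto simp: Rn_def)

lemma subspace_Rn: "subspace (Rn n)"
proof -
  have "Poly_Mapping.keys (c *\<^sub>R x) \<subseteq> Poly_Mapping.keys x" for c and x :: fvec
    by (auto simp: in_keys_iff scaleR_poly_mapping_def)
  moreover have "Poly_Mapping.keys (x + y) \<subseteq> Poly_Mapping.keys x \<union> Poly_Mapping.keys y" for x y :: fvec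
    by (rule keys_add)
  ultimately show ?thesis
    unfolding subspace_def Rn_def by (simp) blast
qed

text \<open>Preimages of convex sets under smooth functions need not be convex, so domains cannot be
  assumed closed under preimages. What open and convex domains share is that the domains inside a
  given domain form a base of its topology. \<open>domain_point\<close> provides the source of the
  constant plots.\<close>

locale plot_site =
  fixes domain :: "nat \<Rightarrow> fvec set \<Rightarrow> bool"
  assumes domain_base:
      "domain n U \<Longrightarrow> openin (top_of_set U) W \<Longrightarrow> x \<in> W \<Longrightarrow>
       \<exists>V. domain n V \<and> openin (top_of_set U) V \<and> x \<in> V \<and> V \<subseteq> W"
    and domain_point: "domain 0 (Rn 0)"

lemma plot_site_open: "plot_site open_domain"
proof
  show "\<exists>V. open_domain n V \<and> openin (top_of_set U) V \<and> x \<in> V \<and> V \<subseteq> W"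
    if "open_domain n U" "openin (top_of_set U) W" "x \<in> W" for n U W x
    using that openin_trans[OF that(2) that(1)[unfolded open_domain_def]]
    unfolding open_domain_def by (intro exI[of _ W]) simp
qed (simp add: open_domain_def)

text \<open>At a boundary point \<open>x\<close> of \<open>C\<close> it is not evident that a small
  piece of \<open>C\<close> has interior. A homothety with centre \<open>x\<close> carries an
  interior ball of \<open>C\<close> as close to \<open>x\<close> as desired, and convexity keeps its
  image inside \<open>C\<close>.\<close>

lemma convex_domain_ball:
  assumes "convex_domain n C" "x \<in> C" "e > 0"
  shows "convex_domain n (ball x e \<inter> C)"
proof -
  have C: "C \<subseteq> Rn n" "convex C" and ne: "top_of_set (Rn n) interior_of C \<noteq> {}"
    using assms by (auto simp: convex_domain_def)
  obtain z T where T: "openin (top_of_set (Rn n)) T" "z \<in> T" "T \<subseteq> C"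
    using ne by (auto simp: interior_of_def)
  then obtain d where d: "d > 0" "ball z d \<inter> Rn n \<subseteq> C"
    by (meson openin_contains_ball order_trans)
  \<comment> \<open>This ratio keeps the displacement \<open>t * norm (z - x)\<close> below
    \<open>e / 2\<close>; the summand \<open>1\<close> covers the case \<open>z = x\<close>, and
    \<open>min 1\<close> makes \<open>t\<close> a weight of a convex combination.\<close>
  define t where "t = min 1 (e / (2 * (norm (z - x) + 1)))"
  define y where "y = x + t *\<^sub>R (z - x)"
  have t: "0 < t" "t \<le> 1"
    using assms(3) by (auto simp: t_def add_nonneg_pos)
  have xR: "x \<in> Rn n" and zR: "z \<in> Rn n"
    using assms C T by auto
  have yR: "y \<in> Rn n"
    unfolding y_def using subspace_Rn[of n] xR zR by (simp add: subspace_add subspace_diff subspace_mul)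
  have near: "ball y (t * d) \<inter> Rn n \<subseteq> C"
  proof
    fix w assume w: "w \<in> ball y (t * d) \<inter> Rn n"
    \<comment> \<open>The inverse homothety: \<open>u\<close> is the point near \<open>z\<close>
      that is carried to \<open>w\<close>, which exhibits \<open>w\<close> as a convex combination
      of \<open>x\<close> and \<open>u\<close>.\<close>
    define u where "u = z + (1 / t) *\<^sub>R (w - y)"
    have "u \<in> Rn n"
      unfolding u_def using w zR yR subspace_Rn[of n] by (simp add: subspace_add subspace_diff subspace_mul)
    moreover have "u \<in> ball z d"
    proof -
      have "norm ((1 / t) *\<^sub>R (w - y)) < d"
        using w t unfolding norm_scaleR by (simp add: dist_norm norm_minus_commute field_simps)
      then show ?thesis by (simp add: u_def dist_norm)
    qed
    ultimately have "u \<in> C" using d by blast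
    moreover have "w = (1 - t) *\<^sub>R x + t *\<^sub>R u"
      using t by (simp add: u_def y_def algebra_simps)
    ultimately show "w \<in> C"
      using C(2) assms(2) t by (simp add: convexD)
  qed
  have "dist x y < e"
  proof -
    have "dist x y = t * norm (z - x)"
      using t by (simp add: y_def dist_norm)
    also have "\<dots> \<le> (e / (2 * (norm (z - x) + 1))) * norm (z - x)"
      by (intro mult_right_mono) (auto simp: t_def)
    also have "\<dots> < e"
      using assms(3) by (simp add: field_simps add_nonneg_pos add_pos_nonneg)
    finally show ?thesis .
  qed
  then have y: "y \<in> Rn n \<inter> (ball x e \<inter> ball y (t * d))"
    using yR t d by simp
  have "Rn n \<inter> (ball x e \<inter> ball y (t * d)) \<subseteq> ball x e \<inter> C"
    using near by blast
  moreover have "openin (top_of_set (Rn n)) (Rn n \<inter> (ball x e \<inter> ball y (t * d)))"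
    by (intro openin_open_Int open_Int open_ball)
  ultimately have "y \<in> top_of_set (Rn n) interior_of (ball x e \<inter> C)"
    using y unfolding interior_of_def by blast
  moreover have "convex (ball x e \<inter> C)"
    by (intro convex_Int C convex_ball)
  ultimately show ?thesis
    using C unfolding convex_domain_def by blast
qed

text \<open>A relatively open \<open>W\<close> is in general not convex; intersecting the domain
  with a ball inside \<open>W\<close> restores convexity.\<close>

lemma plot_site_convex: "plot_site convex_domain"
proof
  show "\<exists>V. convex_domain n V \<and> openin (top_of_set U) V \<and> x \<in> V \<and> V \<subseteq> W"
    if U: "convex_domain n U" "openin (top_of_set U) W" "x \<in> W" for n U W x
  proof -
    have "x \<in> U" using U openin_imp_subset by blast
    obtain e where "e > 0" "ball x e \<inter> U \<subseteq> W"
      using U by (meson openin_contains_ball)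
    moreover have "convex_domain n (ball x e \<inter> U)"
      using convex_domain_ball[OF U(1) \<open>x \<in> U\<close> \<open>e > 0\<close>] .
    moreover have "openin (top_of_set U) (ball x e \<inter> U)"
      by (simp add: openin_open_Int Int_commute)
    ultimately show ?thesis
      using \<open>x \<in> U\<close> by (intro exI[of _ "ball x e \<inter> U"]) simp
  qed
  show "convex_domain 0 (Rn 0)"
    using interior_of_topspace[of "top_of_set (Rn 0)"] by (simp add: convex_domain_def Rn_0)
qed


section \<open>Small sets\<close>

locale universe =
  fixes u :: "'u itself"
  assumes universe: "grothendieck_universe u"
begin

abbreviation small' :: "'a set \<Rightarrow> bool" where
  "small' \<equiv> small u"

lemma infinite_universe: "infinite (UNIV :: 'u set)"
  and small_Pow_universe: "small' A \<Longrightarrow> small' (Pow A)"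
  and small_Union_universe: "small' \<A> \<Longrightarrow> (\<And>A. A \<in> \<A> \<Longrightarrow> small' A) \<Longrightarrow> small' (\<Union>\<A>)"
  for A :: "'u set" and \<A> :: "'u set set"
  using universe unfolding grothendieck_universe_def small_def by simp_all

lemma small_surj:
  assumes "small' A" "B \<subseteq> f ` A"
  shows "small' B"
proof -
  have "|B| \<le>o |A|"
    using assms(2) card_of_image card_of_mono1 ordLeq_transitive by blast
  then show ?thesis
    using assms(1) ordLeq_ordLess_trans unfolding small_def by blast
qed

lemma small_subset: "small' A \<Longrightarrow> B \<subseteq> A \<Longrightarrow> small' B"
  using small_surj[of A B id] by simp

lemma small_image: "small' A \<Longrightarrow> small' (f ` A)"
  using small_surj by blast

lemma small_inj:
  assumes "inj_on f A" "f ` A \<subseteq> B" "small' B"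
  shows "small' A"
proof (rule small_surj[OF assms(3)])
  show "A \<subseteq> inv_into A f ` B"
  proof
    fix x assume "x \<in> A"
    then show "x \<in> inv_into A f ` B"
      using assms(1,2) by (intro image_eqI[of _ _ "f x"]) auto
  qed
qed

text \<open>Points of spaces must be elements of \<open>'u\<close>, whereas limits, colimits and
  exponentials naturally consist of tuples, classes and functions. Each construction below replaces
  its natural point set by the image under such a code.\<close>

lemma small_code:
  assumes "small' A"
  obtains e :: "'a \<Rightarrow> 'u" where "inj_on e A"
proof -
  have "|A| \<le>o |UNIV :: 'u set|"
    using assms ordLess_imp_ordLeq unfolding small_def by blast
  then show ?thesis
    using that card_of_ordLeq[of A "UNIV :: 'u set"] by blast
qed

lemma finite_small: "finite A \<Longrightarrow> small' A"
  unfolding small_def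
  using finite_ordLess_infinite[OF card_of_Well_order card_of_Well_order] infinite_universe
  by (simp add: Field_card_of)

lemma small_Pow:
  assumes "small' A"
  shows "small' (Pow A)"
proof -
  obtain e :: "'a \<Rightarrow> 'u" where e: "inj_on e A"
    using small_code assms by blast
  have "small' (Pow (e ` A))"
    using small_Pow_universe small_image[OF assms] by blast
  then show ?thesis
    by (rule small_inj[OF inj_on_image_Pow[OF e], rotated]) auto
qed

text \<open>\<open>small_Union_universe\<close> concerns families of subsets of \<open>'u\<close>,
  so pairs are first coded there. Infinity of the universe supplies the injection of
  \<open>'u \<times> 'u\<close> into \<open>'u\<close>, and the coded sum is a small union of the
  small slices with fixed first coordinate.\<close>

lemma small_Sigma:
  assumes "small' I" "\<And>i. i \<in> I \<Longrightarrow> small' (A i)"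
  shows "small' (Sigma I A)"
proof -
  obtain f :: "'a \<Rightarrow> 'u" where f: "inj_on f I"
    using small_code assms(1) by blast
  have "\<exists>e :: 'b \<Rightarrow> 'u. inj_on e (A i)" if "i \<in> I" for i
    using small_code[OF assms(2)[OF that]] by blast
  then obtain e :: "'a \<Rightarrow> 'b \<Rightarrow> 'u" where e: "\<And>i. i \<in> I \<Longrightarrow> inj_on (e i) (A i)"
    by metis
  have "|UNIV \<times> UNIV :: ('u \<times> 'u) set| \<le>o |UNIV :: 'u set|"
    using infinite_universe card_of_Times_same_infinite ordIso_imp_ordLeq by fastforce
  then obtain p :: "'u \<times> 'u \<Rightarrow> 'u" where p: "inj p"
    unfolding card_of_ordLeq[symmetric] by auto
  define g where "g = (\<lambda>(i, x). p (f i, e i x))"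
  let ?F = "(\<lambda>i. (\<lambda>x. g (i, x)) ` A i) ` I"
  have "small' (\<Union> ?F)"
    by (rule small_Union_universe) (auto intro: assms small_image)
  moreover have "g ` Sigma I A \<subseteq> \<Union> ?F"
    by auto
  moreover have "inj_on g (Sigma I A)"
  proof (rule inj_onI)
    fix a b assume ab: "a \<in> Sigma I A" "b \<in> Sigma I A" "g a = g b"
    then have "(f (fst a), e (fst a) (snd a)) = (f (fst b), e (fst b) (snd b))"
      using p by (auto simp: g_def inj_eq split: prod.splits)
    then have eq: "f (fst a) = f (fst b)" "e (fst a) (snd a) = e (fst b) (snd b)"
      by simp_all
    have "fst a = fst b"
      by (rule inj_onD[OF f eq(1)]) (use ab in auto)
    moreover have "snd a = snd b"
      by (rule inj_onD[OF e, of "fst b"]) (use ab eq(2) \<open>fst a = fst b\<close> in auto)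
    ultimately show "a = b"
      by (rule prod_eqI)
  qed
  ultimately show ?thesis
    using small_inj[of g "Sigma I A"] by simp
qed

text \<open>An extensional function is determined by its graph over \<open>I\<close>, which is a
  subset of \<open>Sigma I A\<close>; thus the bound comes from a power set.\<close>

lemma small_PiE:
  assumes "small' I" "\<And>i. i \<in> I \<Longrightarrow> small' (A i)"
  shows "small' (Pi\<^sub>E I A)"
proof (rule small_inj)
  show "inj_on (\<lambda>f. (\<lambda>i. (i, f i)) ` I) (Pi\<^sub>E I A)"
  proof (rule inj_onI)
    fix f g assume fg: "f \<in> Pi\<^sub>E I A" "g \<in> Pi\<^sub>E I A" "(\<lambda>i. (i, f i)) ` I = (\<lambda>i. (i, g i)) ` I"
    have "f i = g i" if "i \<in> I" for i
    proof -
      have "(i, f i) \<in> (\<lambda>i. (i, g i)) ` I"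
        using that unfolding fg(3)[symmetric] by (rule imageI)
      then show ?thesis by auto
    qed
    then show "f = g"
      by (rule PiE_ext[OF fg(1,2)])
  qed
  show "(\<lambda>f. (\<lambda>i. (i, f i)) ` I) ` Pi\<^sub>E I A \<subseteq> Pow (Sigma I A)"
    by auto
  show "small' (Pow (Sigma I A))"
    by (intro small_Pow small_Sigma assms)
qed

end

section \<open>Adjoints and cartesian closed categories\<close>

context category
begin

lemma Hom_Ob: "f \<in> Hom C a b \<Longrightarrow> a \<in> Ob C" "f \<in> Hom C a b \<Longrightarrow> b \<in> Ob C"
  using Dom_in Cod_in unfolding Hom_def by auto

lemma binary_product_eqI:
  assumes P: "is_binary_product C x y P p q"
    and h: "h \<in> Hom C A P" "h' \<in> Hom C A P"
    and eq: "p \<odot> h = p \<odot> h'" "q \<odot> h = q \<odot> h'"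
  shows "h = h'"
proof -
  have pq: "p \<in> Hom C P x" "q \<in> Hom C P y"
    using P unfolding is_binary_product_def by auto
  have "\<exists>!k. k \<in> Hom C A P \<and> p \<odot> k = p \<odot> h \<and> q \<odot> k = q \<odot> h"
    using P Hom_Ob(1)[OF h(1)] Comp_in[OF h(1) pq(1)] Comp_in[OF h(1) pq(2)]
    unfolding is_binary_product_def by simp
  then show ?thesis
    using h eq by auto
qed

lemma binary_product_pair:
  assumes P: "is_binary_product C x y P p q" and fg: "f \<in> Hom C A x" "g \<in> Hom C A y"
  obtains h where "h \<in> Hom C A P" "p \<odot> h = f" "q \<odot> h = g"
proof -
  have "\<exists>!h. h \<in> Hom C A P \<and> p \<odot> h = f \<and> q \<odot> h = g"
    using P Hom_Ob(1)[OF fg(1)] fg unfolding is_binary_product_def by simp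
  then show ?thesis
    using that by auto
qed

end

text \<open>The adjoint is assembled from a universal arrow \<open>\<epsilon>\<close> at each object
  of \<open>D\<close>. Transposition \<open>T\<close> is the unique factorization through it, and
  uniqueness forces both functoriality of \<open>Ga\<close> and naturality of the bijection.\<close>

lemma has_right_adjointI:
  fixes C :: "('a, 'b) category" and D :: "('c, 'd) category"
  assumes C: "category C" and D: "category D" and F: "is_functor C D Fo Fa"
    and univ: "\<And>b. b \<in> Ob D \<Longrightarrow> \<exists>G \<epsilon>. G \<in> Ob C \<and> \<epsilon> \<in> Hom D (Fo G) b \<and>
        (\<forall>a\<in>Ob C. \<forall>h\<in>Hom D (Fo a) b. \<exists>!k. k \<in> Hom C a G \<and> \<epsilon> \<odot>\<^bsub>D\<^esub> Fa k = h)"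
  shows "has_right_adjoint C D Fo Fa"
proof -
  interpret C: category C by fact
  interpret D: category D by fact
  have FO: "Fo a \<in> Ob D" if "a \<in> Ob C" for a
    using F that unfolding is_functor_def by blast
  have FA: "Fa f \<in> Hom D (Fo a) (Fo b)" if "f \<in> Hom C a b" for a b f
    using F that unfolding is_functor_def by blast
  have FI: "Fa (Ident C a) = Ident D (Fo a)" if "a \<in> Ob C" for a
    using F that unfolding is_functor_def by blast
  have FC: "Fa (g \<odot>\<^bsub>C\<^esub> f) = Fa g \<odot>\<^bsub>D\<^esub> Fa f" if "f \<in> Hom C a b" "g \<in> Hom C b c" for a b c f g
    using F that unfolding is_functor_def by blast
  have "\<forall>b\<in>Ob D. \<exists>p. fst p \<in> Ob C \<and> snd p \<in> Hom D (Fo (fst p)) b \<and>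
        (\<forall>a\<in>Ob C. \<forall>h\<in>Hom D (Fo a) b. \<exists>!k. k \<in> Hom C a (fst p) \<and> snd p \<odot>\<^bsub>D\<^esub> Fa k = h)"
    using univ by fastforce
  from bchoice[OF this] obtain p where p: "\<And>b. b \<in> Ob D \<Longrightarrow>
        fst (p b) \<in> Ob C \<and> snd (p b) \<in> Hom D (Fo (fst (p b))) b \<and>
        (\<forall>a\<in>Ob C. \<forall>h\<in>Hom D (Fo a) b. \<exists>!k. k \<in> Hom C a (fst (p b)) \<and> snd (p b) \<odot>\<^bsub>D\<^esub> Fa k = h)"
    by blast
  define Go where "Go = (\<lambda>b. fst (p b))"
  define \<epsilon> where "\<epsilon> = (\<lambda>b. snd (p b))"
  have GO: "Go b \<in> Ob C" and eps: "\<epsilon> b \<in> Hom D (Fo (Go b)) b" if "b \<in> Ob D" for b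
    using p[OF that] by (auto simp: Go_def \<epsilon>_def)
  have u: "\<exists>!k. k \<in> Hom C a (Go b) \<and> \<epsilon> b \<odot>\<^bsub>D\<^esub> Fa k = h"
    if "b \<in> Ob D" "a \<in> Ob C" "h \<in> Hom D (Fo a) b" for a b h
    using p[OF that(1)] that(2,3) by (auto simp: Go_def \<epsilon>_def)
  define T where "T = (\<lambda>a b h. THE k. k \<in> Hom C a (Go b) \<and> \<epsilon> b \<odot>\<^bsub>D\<^esub> Fa k = h)"
  have T: "T a b h \<in> Hom C a (Go b)" "\<epsilon> b \<odot>\<^bsub>D\<^esub> Fa (T a b h) = h"
    if "b \<in> Ob D" "a \<in> Ob C" "h \<in> Hom D (Fo a) b" for a b h
    using theI'[OF u[OF that]] unfolding T_def by auto
  have eval_in: "\<epsilon> b \<odot>\<^bsub>D\<^esub> Fa k \<in> Hom D (Fo a) b" if "b \<in> Ob D" "k \<in> Hom C a (Go b)" for a b k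
    using D.Comp_in[OF FA[OF that(2)] eps[OF that(1)]] .
  have T_eq: "T a b h = k" if "b \<in> Ob D" "k \<in> Hom C a (Go b)" "\<epsilon> b \<odot>\<^bsub>D\<^esub> Fa k = h" for a b h k
  proof -
    have a: "a \<in> Ob C" using C.Hom_Ob(1)[OF that(2)] .
    have "\<exists>!k. k \<in> Hom C a (Go b) \<and> \<epsilon> b \<odot>\<^bsub>D\<^esub> Fa k = h"
      using u[OF that(1) a] eval_in[OF that(1,2)] that(3) by simp
    then show ?thesis
      unfolding T_def using that(2,3) by (intro the1_equality) auto
  qed
  \<comment> \<open>Naturality of the counit leaves no other choice: \<open>Ga g\<close> is the
    transpose of \<open>g\<close> after the counit at the source of \<open>g\<close>.\<close>
  define Ga where "Ga = (\<lambda>g. T (Go (Dom D g)) (Cod D g) (g \<odot>\<^bsub>D\<^esub> \<epsilon> (Dom D g)))"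
  have Ga: "Ga g \<in> Hom C (Go b) (Go b')" "\<epsilon> b' \<odot>\<^bsub>D\<^esub> Fa (Ga g) = g \<odot>\<^bsub>D\<^esub> \<epsilon> b"
    and Ga_eq: "Ga g = T (Go b) b' (g \<odot>\<^bsub>D\<^esub> \<epsilon> b)"
    if g: "g \<in> Hom D b b'" for g b b'
  proof -
    have b: "b \<in> Ob D" "b' \<in> Ob D" using D.Hom_Ob g by auto
    show eq: "Ga g = T (Go b) b' (g \<odot>\<^bsub>D\<^esub> \<epsilon> b)"
      using g by (simp add: Ga_def Hom_def)
    show "Ga g \<in> Hom C (Go b) (Go b')" "\<epsilon> b' \<odot>\<^bsub>D\<^esub> Fa (Ga g) = g \<odot>\<^bsub>D\<^esub> \<epsilon> b"
      using T[OF b(2) GO[OF b(1)] D.Comp_in[OF eps[OF b(1)] g]] by (simp_all add: eq)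
  qed
  have "is_functor D C Go Ga"
    unfolding is_functor_def
  proof (intro conjI ballI allI)
    fix b assume b: "b \<in> Ob D"
    note i = D.Ident_in[OF b]
    show "Ga (Ident D b) = Ident C (Go b)"
      unfolding Ga_eq[OF i]
    proof (rule T_eq[OF b C.Ident_in[OF GO[OF b]]])
      show "\<epsilon> b \<odot>\<^bsub>D\<^esub> Fa (Ident C (Go b)) = Ident D b \<odot>\<^bsub>D\<^esub> \<epsilon> b"
        using D.Ident_left[OF eps[OF b]] D.Ident_right[OF eps[OF b]] FI[OF GO[OF b]] by simp
    qed
  next
    fix a b c f g assume f: "f \<in> Hom D a b" and g: "g \<in> Hom D b c"
    have ob: "a \<in> Ob D" "b \<in> Ob D" "c \<in> Ob D" using D.Hom_Ob f g by auto
    show "Ga (g \<odot>\<^bsub>D\<^esub> f) = Ga g \<odot>\<^bsub>C\<^esub> Ga f"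
      unfolding Ga_eq[OF D.Comp_in[OF f g]]
    proof (rule T_eq[OF ob(3) C.Comp_in[OF Ga(1)[OF f] Ga(1)[OF g]]])
      have "\<epsilon> c \<odot>\<^bsub>D\<^esub> Fa (Ga g \<odot>\<^bsub>C\<^esub> Ga f) = (\<epsilon> c \<odot>\<^bsub>D\<^esub> Fa (Ga g)) \<odot>\<^bsub>D\<^esub> Fa (Ga f)"
        using FC[OF Ga(1)[OF f] Ga(1)[OF g]]
          D.Comp_assoc[OF FA[OF Ga(1)[OF f]] FA[OF Ga(1)[OF g]] eps[OF ob(3)]] by simp
      also have "\<dots> = g \<odot>\<^bsub>D\<^esub> (\<epsilon> b \<odot>\<^bsub>D\<^esub> Fa (Ga f))"
        using Ga(2)[OF g] D.Comp_assoc[OF FA[OF Ga(1)[OF f]] eps[OF ob(2)] g] by simp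
      also have "\<dots> = (g \<odot>\<^bsub>D\<^esub> f) \<odot>\<^bsub>D\<^esub> \<epsilon> a"
        using Ga(2)[OF f] D.Comp_assoc[OF eps[OF ob(1)] f g] by simp
      finally show "\<epsilon> c \<odot>\<^bsub>D\<^esub> Fa (Ga g \<odot>\<^bsub>C\<^esub> Ga f) = (g \<odot>\<^bsub>D\<^esub> f) \<odot>\<^bsub>D\<^esub> \<epsilon> a" .
    qed
  qed (use GO Ga(1) in auto)
  moreover have "bij_betw (T a b) (Hom D (Fo a) b) (Hom C a (Go b))" if "a \<in> Ob C" "b \<in> Ob D" for a b
  proof (rule bij_betw_byWitness[where f' = "\<lambda>k. \<epsilon> b \<odot>\<^bsub>D\<^esub> Fa k"])
    show "\<forall>h\<in>Hom D (Fo a) b. \<epsilon> b \<odot>\<^bsub>D\<^esub> Fa (T a b h) = h"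
      using T(2)[OF that(2,1)] by simp
    show "\<forall>k\<in>Hom C a (Go b). T a b (\<epsilon> b \<odot>\<^bsub>D\<^esub> Fa k) = k"
      using T_eq[OF that(2)] by simp
    show "T a b ` Hom D (Fo a) b \<subseteq> Hom C a (Go b)"
      using T(1)[OF that(2,1)] by auto
    show "(\<lambda>k. \<epsilon> b \<odot>\<^bsub>D\<^esub> Fa k) ` Hom C a (Go b) \<subseteq> Hom D (Fo a) b"
      using eval_in[OF that(2)] by auto
  qed
  moreover have "T a' b' (g \<odot>\<^bsub>D\<^esub> h \<odot>\<^bsub>D\<^esub> Fa f) = Ga g \<odot>\<^bsub>C\<^esub> T a b h \<odot>\<^bsub>C\<^esub> f"
    if f: "f \<in> Hom C a' a" and g: "g \<in> Hom D b b'" and h: "h \<in> Hom D (Fo a) b" for a a' b b' f g h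
  proof -
    have ob: "a \<in> Ob C" "b \<in> Ob D" "b' \<in> Ob D" using D.Hom_Ob g C.Hom_Ob f by auto
    note t = T(1)[OF ob(2,1) h]
    note gt = C.Comp_in[OF t Ga(1)[OF g]]
    show ?thesis
    proof (rule T_eq[OF ob(3) C.Comp_in[OF f gt]])
      have "\<epsilon> b' \<odot>\<^bsub>D\<^esub> Fa (Ga g \<odot>\<^bsub>C\<^esub> T a b h) = g \<odot>\<^bsub>D\<^esub> h"
      proof -
        have "\<epsilon> b' \<odot>\<^bsub>D\<^esub> Fa (Ga g \<odot>\<^bsub>C\<^esub> T a b h) = (\<epsilon> b' \<odot>\<^bsub>D\<^esub> Fa (Ga g)) \<odot>\<^bsub>D\<^esub> Fa (T a b h)"
          using FC[OF t Ga(1)[OF g]] D.Comp_assoc[OF FA[OF t] FA[OF Ga(1)[OF g]] eps[OF ob(3)]] by simp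
        then show ?thesis
          using Ga(2)[OF g] D.Comp_assoc[OF FA[OF t] eps[OF ob(2)] g] T(2)[OF ob(2,1) h] by simp
      qed
      then show "\<epsilon> b' \<odot>\<^bsub>D\<^esub> Fa (Ga g \<odot>\<^bsub>C\<^esub> T a b h \<odot>\<^bsub>C\<^esub> f) = g \<odot>\<^bsub>D\<^esub> h \<odot>\<^bsub>D\<^esub> Fa f"
        using FC[OF f gt] D.Comp_assoc[OF FA[OF f] FA[OF gt] eps[OF ob(3)]] by simp
    qed
  qed
  ultimately show ?thesis
    unfolding has_right_adjoint_def
    by (intro exI[of _ Go] exI[of _ Ga] exI[of _ T] conjI ballI allI) simp_all
qed

text \<open>\<open>is_product_functor\<close> demands only compatibility with the projections.
  Identities and composites are then preserved because arrows into a product agree once their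
  projections do.\<close>

lemma product_functor_is_functor:
  fixes C :: "('o, 'm) category" (structure)
  assumes C: "category C"
    and P: "\<And>x. x \<in> Ob C \<Longrightarrow> is_binary_product C x y (Fo x) (p x) (q x)"
    and F: "\<And>x x' f. f \<in> Hom C x x' \<Longrightarrow> Fa f \<in> Hom C (Fo x) (Fo x') \<and>
           p x' \<odot>\<^bsub>C\<^esub> Fa f = f \<odot>\<^bsub>C\<^esub> p x \<and> q x' \<odot>\<^bsub>C\<^esub> Fa f = q x"
  shows "is_functor C C Fo Fa"
proof -
  interpret category C by fact
  have pq: "Fo x \<in> Ob C" "p x \<in> Hom C (Fo x) x" "q x \<in> Hom C (Fo x) y" if "x \<in> Ob C" for x
    using P[OF that] unfolding is_binary_product_def by auto
  show ?thesis
    unfolding is_functor_def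
  proof (intro conjI ballI allI)
    fix a assume a: "a \<in> Ob C"
    note i = Ident_in[OF a]
    show "Fa (Ident C a) = Ident C (Fo a)"
    proof (rule binary_product_eqI[OF P[OF a]])
      show "Fa (Ident C a) \<in> Hom C (Fo a) (Fo a)" using F[OF i] by simp
      show "Ident C (Fo a) \<in> Hom C (Fo a) (Fo a)" using Ident_in[OF pq(1)[OF a]] .
    qed (use F[OF i] Ident_left[OF pq(2)[OF a]] Ident_right[OF pq(2)[OF a]]
           Ident_right[OF pq(3)[OF a]] in simp_all)
  next
    fix a b c f g assume f: "f \<in> Hom C a b" and g: "g \<in> Hom C b c"
    have ob: "a \<in> Ob C" "b \<in> Ob C" "c \<in> Ob C" using Hom_Ob f g by auto
    note gf = Comp_in[OF f g]
    have Ff: "Fa f \<in> Hom C (Fo a) (Fo b)" and Fg: "Fa g \<in> Hom C (Fo b) (Fo c)" using F f g by blast+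
    show "Fa (g \<odot> f) = Fa g \<odot> Fa f"
    proof (rule binary_product_eqI[OF P[OF ob(3)] _ Comp_in[OF Ff Fg]])
      show "Fa (g \<odot> f) \<in> Hom C (Fo a) (Fo c)" using F[OF gf] by simp
      show "p c \<odot> Fa (g \<odot> f) = p c \<odot> (Fa g \<odot> Fa f)"
        using F[OF gf] F[OF g] F[OF f] Comp_assoc[OF Ff Fg pq(2)[OF ob(3)]]
          Comp_assoc[OF Ff pq(2)[OF ob(2)] g] Comp_assoc[OF pq(2)[OF ob(1)] f g] by simp
      show "q c \<odot> Fa (g \<odot> f) = q c \<odot> (Fa g \<odot> Fa f)"
        using F[OF gf] F[OF g] F[OF f] Comp_assoc[OF Ff Fg pq(3)[OF ob(3)]] by simp
    qed
  qed (use pq F in auto)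
qed

text \<open>Cartesian closedness speaks of every product functor, while a universal arrow is easiest
  to give for one choice \<open>P\<close> of products. The arrow \<open>m\<close> stands for
  \<open>k \<times> y\<close>; asking for its existence avoids defining \<open>P\<close> on
  arrows.\<close>

lemma cartesian_closedI:
  fixes C :: "('o, 'm) category" (structure)
  assumes C: "category C" and fp: "has_finite_products C"
    and prod: "\<And>x y. x \<in> Ob C \<Longrightarrow> y \<in> Ob C \<Longrightarrow> is_binary_product C x y (P x y) (p x y) (q x y)"
    and univ: "\<And>y b. y \<in> Ob C \<Longrightarrow> b \<in> Ob C \<Longrightarrow> \<exists>G \<epsilon>. G \<in> Ob C \<and> \<epsilon> \<in> Hom C (P G y) b \<and>
        (\<forall>a\<in>Ob C. \<forall>h\<in>Hom C (P a y) b. \<exists>!k. k \<in> Hom C a G \<and>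
           (\<exists>m\<in>Hom C (P a y) (P G y). p G y \<odot>\<^bsub>C\<^esub> m = k \<odot>\<^bsub>C\<^esub> p a y \<and> q G y \<odot>\<^bsub>C\<^esub> m = q a y \<and>
              \<epsilon> \<odot>\<^bsub>C\<^esub> m = h))"
  shows "cartesian_closed C"
proof -
  interpret category C by fact
  have "has_right_adjoint C C Fo Fa" if y: "y \<in> Ob C" and "is_product_functor C y Fo Fa" for y Fo Fa
  proof -
    obtain p' q' where P': "\<And>x. x \<in> Ob C \<Longrightarrow> is_binary_product C x y (Fo x) (p' x) (q' x)"
      and F: "\<And>x x' f. f \<in> Hom C x x' \<Longrightarrow> Fa f \<in> Hom C (Fo x) (Fo x') \<and>
           p' x' \<odot>\<^bsub>C\<^esub> Fa f = f \<odot>\<^bsub>C\<^esub> p' x \<and> q' x' \<odot>\<^bsub>C\<^esub> Fa f = q' x"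
      using \<open>is_product_functor C y Fo Fa\<close> unfolding is_product_functor_def by blast
    have pq': "p' x \<in> Hom C (Fo x) x" "q' x \<in> Hom C (Fo x) y" if "x \<in> Ob C" for x
      using P'[OF that] unfolding is_binary_product_def by auto
    have pq: "p x y \<in> Hom C (P x y) x" "q x y \<in> Hom C (P x y) y" if "x \<in> Ob C" for x
      using prod[OF that y] unfolding is_binary_product_def by auto
    show ?thesis
    proof (rule has_right_adjointI[OF C C product_functor_is_functor[OF C P' F]])
      fix b assume b: "b \<in> Ob C"
      from univ[OF y b] obtain G \<epsilon> where G: "G \<in> Ob C" and \<epsilon>: "\<epsilon> \<in> Hom C (P G y) b"
        and u: "\<forall>a\<in>Ob C. \<forall>h\<in>Hom C (P a y) b. \<exists>!k. k \<in> Hom C a G \<and>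
           (\<exists>m\<in>Hom C (P a y) (P G y). p G y \<odot> m = k \<odot> p a y \<and> q G y \<odot> m = q a y \<and> \<epsilon> \<odot> m = h)"
        by blast
      \<comment> \<open>\<open>\<theta>\<close> compares the two products of \<open>G\<close> and
        \<open>y\<close>, so \<open>\<epsilon> \<odot> \<theta>\<close> is the counit for the given
        functor. For \<open>a\<close> the comparison is needed in both directions, as
        \<open>\<rho>\<close> and \<open>\<tau>\<close>.\<close>
      obtain \<theta> where \<theta>: "\<theta> \<in> Hom C (Fo G) (P G y)" "p G y \<odot> \<theta> = p' G" "q G y \<odot> \<theta> = q' G"
        using binary_product_pair[OF prod[OF G y] pq'[OF G]] by blast
      have "\<exists>!k. k \<in> Hom C a G \<and> (\<epsilon> \<odot> \<theta>) \<odot> Fa k = h" if a: "a \<in> Ob C" and h: "h \<in> Hom C (Fo a) b" for a h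
      proof -
        obtain \<rho> where \<rho>: "\<rho> \<in> Hom C (P a y) (Fo a)" "p' a \<odot> \<rho> = p a y" "q' a \<odot> \<rho> = q a y"
          using binary_product_pair[OF P'[OF a] pq[OF a]] by blast
        obtain \<tau> where \<tau>: "\<tau> \<in> Hom C (Fo a) (P a y)" "p a y \<odot> \<tau> = p' a" "q a y \<odot> \<tau> = q' a"
          using binary_product_pair[OF prod[OF a y] pq'[OF a]] by blast
        have rt: "\<rho> \<odot> \<tau> = Ident C (Fo a)"
        proof (rule binary_product_eqI[OF P'[OF a] Comp_in[OF \<tau>(1) \<rho>(1)]])
          show "Ident C (Fo a) \<in> Hom C (Fo a) (Fo a)"
            using Ident_in Hom_Ob(1)[OF \<tau>(1)] by blast
        qed (use Comp_assoc[OF \<tau>(1) \<rho>(1) pq'(1)[OF a]] Comp_assoc[OF \<tau>(1) \<rho>(1) pq'(2)[OF a]] \<rho> \<tau>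
            Ident_right[OF pq'(1)[OF a]] Ident_right[OF pq'(2)[OF a]] in simp_all)
        have hr: "h \<odot> \<rho> \<in> Hom C (P a y) b" using Comp_in[OF \<rho>(1) h] .
        have hrt: "(h \<odot> \<rho>) \<odot> \<tau> = h"
          using Comp_assoc[OF \<tau>(1) \<rho>(1) h] rt Ident_right[OF h] by simp
        \<comment> \<open>From left to right, \<open>m\<close> is \<open>Fa k\<close> conjugated by
          the comparison arrows; from right to left, the projections identify
          \<open>\<theta> \<odot> Fa k\<close> with \<open>m \<odot> \<tau>\<close>. So the unique
          factorization of \<open>h \<odot> \<rho>\<close> for the fixed products becomes one of
          \<open>h\<close> for the given functor.\<close>
        have iff: "(\<epsilon> \<odot> \<theta>) \<odot> Fa k = h \<longleftrightarrow>
            (\<exists>m\<in>Hom C (P a y) (P G y). p G y \<odot> m = k \<odot> p a y \<and> q G y \<odot> m = q a y \<and> \<epsilon> \<odot> m = h \<odot> \<rho>)"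
          if k: "k \<in> Hom C a G" for k
        proof
          have Fk: "Fa k \<in> Hom C (Fo a) (Fo G)" using F[OF k] by simp
          note tF = Comp_in[OF Fk \<theta>(1)]
          assume L: "(\<epsilon> \<odot> \<theta>) \<odot> Fa k = h"
          show "\<exists>m\<in>Hom C (P a y) (P G y). p G y \<odot> m = k \<odot> p a y \<and> q G y \<odot> m = q a y \<and> \<epsilon> \<odot> m = h \<odot> \<rho>"
          proof (intro bexI[of _ "(\<theta> \<odot> Fa k) \<odot> \<rho>"] conjI)
            have "p G y \<odot> ((\<theta> \<odot> Fa k) \<odot> \<rho>) = (p G y \<odot> (\<theta> \<odot> Fa k)) \<odot> \<rho>"
              using Comp_assoc[OF \<rho>(1) tF pq(1)[OF G]] by simp
            also have "\<dots> = (k \<odot> p' a) \<odot> \<rho>"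
              using Comp_assoc[OF Fk \<theta>(1) pq(1)[OF G]] \<theta> F[OF k] by simp
            also have "\<dots> = k \<odot> p a y"
              using Comp_assoc[OF \<rho>(1) pq'(1)[OF a] k] \<rho> by simp
            finally show "p G y \<odot> ((\<theta> \<odot> Fa k) \<odot> \<rho>) = k \<odot> p a y" .
            have "q G y \<odot> ((\<theta> \<odot> Fa k) \<odot> \<rho>) = (q G y \<odot> (\<theta> \<odot> Fa k)) \<odot> \<rho>"
              using Comp_assoc[OF \<rho>(1) tF pq(2)[OF G]] by simp
            also have "\<dots> = q' a \<odot> \<rho>"
              using Comp_assoc[OF Fk \<theta>(1) pq(2)[OF G]] \<theta> F[OF k] by simp
            finally show "q G y \<odot> ((\<theta> \<odot> Fa k) \<odot> \<rho>) = q a y" using \<rho> by simp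
            show "\<epsilon> \<odot> ((\<theta> \<odot> Fa k) \<odot> \<rho>) = h \<odot> \<rho>"
              using L Comp_assoc[OF \<rho>(1) tF \<epsilon>] Comp_assoc[OF Fk \<theta>(1) \<epsilon>] by simp
            show "(\<theta> \<odot> Fa k) \<odot> \<rho> \<in> Hom C (P a y) (P G y)" using Comp_in[OF \<rho>(1) tF] .
          qed
        next
          have Fk: "Fa k \<in> Hom C (Fo a) (Fo G)" using F[OF k] by simp
          assume "\<exists>m\<in>Hom C (P a y) (P G y). p G y \<odot> m = k \<odot> p a y \<and> q G y \<odot> m = q a y \<and> \<epsilon> \<odot> m = h \<odot> \<rho>"
          then obtain m where m: "m \<in> Hom C (P a y) (P G y)" "p G y \<odot> m = k \<odot> p a y"
              "q G y \<odot> m = q a y" "\<epsilon> \<odot> m = h \<odot> \<rho>"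
            by blast
          have "\<theta> \<odot> Fa k = m \<odot> \<tau>"
          proof (rule binary_product_eqI[OF prod[OF G y] Comp_in[OF Fk \<theta>(1)] Comp_in[OF \<tau>(1) m(1)]])
            show "p G y \<odot> (\<theta> \<odot> Fa k) = p G y \<odot> (m \<odot> \<tau>)"
              using Comp_assoc[OF Fk \<theta>(1) pq(1)[OF G]] \<theta> F[OF k] Comp_assoc[OF \<tau>(1) m(1) pq(1)[OF G]]
                m Comp_assoc[OF \<tau>(1) pq(1)[OF a] k] \<tau> by simp
            show "q G y \<odot> (\<theta> \<odot> Fa k) = q G y \<odot> (m \<odot> \<tau>)"
              using Comp_assoc[OF Fk \<theta>(1) pq(2)[OF G]] \<theta> F[OF k] Comp_assoc[OF \<tau>(1) m(1) pq(2)[OF G]]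
                m \<tau> by simp
          qed
          then show "(\<epsilon> \<odot> \<theta>) \<odot> Fa k = h"
            using Comp_assoc[OF Fk \<theta>(1) \<epsilon>] Comp_assoc[OF \<tau>(1) m(1) \<epsilon>] m(4) hrt by simp
        qed
        have eq: "(k \<in> Hom C a G \<and> (\<epsilon> \<odot> \<theta>) \<odot> Fa k = h) \<longleftrightarrow> (k \<in> Hom C a G \<and>
            (\<exists>m\<in>Hom C (P a y) (P G y). p G y \<odot> m = k \<odot> p a y \<and> q G y \<odot> m = q a y \<and> \<epsilon> \<odot> m = h \<odot> \<rho>))" for k
          by (rule conj_cong[OF refl iff])
        show ?thesis
          unfolding eq by (rule u[rule_format, OF a hr])
      qed
      then show "\<exists>G \<epsilon>. G \<in> Ob C \<and> \<epsilon> \<in> Hom C (Fo G) b \<and>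
          (\<forall>a\<in>Ob C. \<forall>h\<in>Hom C (Fo a) b. \<exists>!k. k \<in> Hom C a G \<and> \<epsilon> \<odot> Fa k = h)"
        by (intro exI[of _ G] exI[of _ "\<epsilon> \<odot> \<theta>"] conjI ballI G Comp_in[OF \<theta>(1) \<epsilon>])
    qed
  qed
  then show ?thesis
    using fp unfolding cartesian_closed_def by blast
qed

section \<open>Initial and final structures\<close>

lemma restrict_compose: "V \<subseteq> U \<Longrightarrow> restrict (compose U g f) V = compose V g (restrict f V)"
  by (auto simp: compose_def restrict_def fun_eq_iff)

lemma compose_funcset: "f \<in> U \<rightarrow>\<^sub>E A \<Longrightarrow> g \<in> A \<rightarrow> B \<Longrightarrow> compose U g f \<in> U \<rightarrow>\<^sub>E B"
  by (auto simp: compose_def PiE_iff)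

lemma smooth_map_funcset: "smooth_map X Y f \<Longrightarrow> f \<in> points X \<rightarrow>\<^sub>E points Y"
  by (simp add: smooth_map_def)

lemma smooth_map_plot: "smooth_map X Y f \<Longrightarrow> \<phi> \<in> plots X n U \<Longrightarrow> compose U f \<phi> \<in> plots Y n U"
  by (simp add: smooth_map_def)

lemma smooth_map_eqI:
  "smooth_map X Y f \<Longrightarrow> smooth_map X Z g \<Longrightarrow> (\<And>x. x \<in> points X \<Longrightarrow> f x = g x) \<Longrightarrow> f = g"
  using extensionalityI[of f "points X" g] by (simp add: smooth_map_def PiE_def)

section \<open>Consequences of the plot axioms\<close>

context plot_site
begin

abbreviation space :: "'a plot_space \<Rightarrow> bool" where
  "space \<equiv> is_plot_space domain"

lemma plot_domain: "space X \<Longrightarrow> \<phi> \<in> plots X n U \<Longrightarrow> domain n U"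
  and plot_funcset: "space X \<Longrightarrow> \<phi> \<in> plots X n U \<Longrightarrow> \<phi> \<in> U \<rightarrow>\<^sub>E points X"
  unfolding is_plot_space_def by (elim conjE, drule spec[of _ n], drule spec[of _ U], drule (1) bspec, elim conjE, assumption)+

lemma plot_smooth_compose:
  assumes "space X" "\<phi> \<in> plots X n U" "domain m U'" "smooth_between m U' U f"
  shows "compose U' \<phi> f \<in> plots X m U'"
proof -
  have "\<forall>n U m U' \<phi> f. \<phi> \<in> plots X n U \<and> domain m U' \<and> smooth_between m U' U f
        \<longrightarrow> compose U' \<phi> f \<in> plots X m U'"
    using assms(1) unfolding is_plot_space_def by (elim conjE)
  from this[THEN spec, THEN spec, THEN spec, THEN spec, THEN spec, THEN spec, THEN mp, OF conjI, OF assms(2) conjI, OF assms(3,4)]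
  show ?thesis .
qed

text \<open>The covering axiom in pointwise form. The cover consists of all domains on which
  \<open>\<phi>\<close> restricts to a plot, so no neighbourhoods have to be chosen.\<close>

lemma plot_glue:
  assumes X: "space X" and U: "domain n U" and \<phi>: "\<phi> \<in> U \<rightarrow>\<^sub>E points X"
    and loc: "\<And>x. x \<in> U \<Longrightarrow>
      \<exists>V. domain n V \<and> openin (top_of_set U) V \<and> x \<in> V \<and> restrict \<phi> V \<in> plots X n V"
  shows "\<phi> \<in> plots X n U"
proof -
  define \<U> where "\<U> = {V. domain n V \<and> openin (top_of_set U) V \<and> restrict \<phi> V \<in> plots X n V}"
  have "\<Union>\<U> = U"
  proof
    show "\<Union>\<U> \<subseteq> U"
      unfolding \<U>_def by (auto dest: openin_imp_subset)
    show "U \<subseteq> \<Union>\<U>"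
    proof
      fix x assume "x \<in> U"
      from loc[OF this] obtain V where "V \<in> \<U>" "x \<in> V"
        unfolding \<U>_def by auto
      then show "x \<in> \<Union>\<U>" by (rule UnionI)
    qed
  qed
  moreover have "\<forall>V\<in>\<U>. domain n V \<and> openin (top_of_set U) V"
    and "\<forall>V\<in>\<U>. restrict \<phi> V \<in> plots X n V"
    by (auto simp: \<U>_def)
  moreover have "\<forall>n U \<U> \<phi>. domain n U \<and> (\<forall>V\<in>\<U>. domain n V \<and> openin (top_of_set U) V) \<and> \<Union>\<U> = U \<and>
        \<phi> \<in> U \<rightarrow>\<^sub>E points X \<and> (\<forall>V\<in>\<U>. restrict \<phi> V \<in> plots X n V) \<longrightarrow> \<phi> \<in> plots X n U"
    using X unfolding is_plot_space_def by (elim conjE)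
  from this[THEN spec, THEN spec, THEN spec, THEN spec, THEN mp, of n U \<U> \<phi>]
  have "domain n U \<and> (\<forall>V\<in>\<U>. domain n V \<and> openin (top_of_set U) V) \<and> \<Union>\<U> = U \<and>
        \<phi> \<in> U \<rightarrow>\<^sub>E points X \<and> (\<forall>V\<in>\<U>. restrict \<phi> V \<in> plots X n V) \<Longrightarrow> \<phi> \<in> plots X n U" .
  ultimately show ?thesis
    using U \<phi> by simp
qed

text \<open>A constant factors through the single point of \<open>Rn 0\<close>, where the third
  axiom applies, along the smooth constant function with value \<open>0\<close>.\<close>

lemma plot_const:
  assumes "space X" "x \<in> points X" "domain n U"
  shows "(\<lambda>_\<in>U. x) \<in> plots X n U"
proof -
  have "(\<lambda>_\<in>Rn 0. x) \<in> plots X 0 (Rn 0)"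
    using assms(1,2) unfolding is_plot_space_def by (elim conjE) (erule bspec)
  then have "compose U (\<lambda>_\<in>Rn 0. x) (\<lambda>_. 0) \<in> plots X n U"
    using assms by (intro plot_smooth_compose) (auto simp: Rn_0 smooth_between_const)
  moreover have "compose U (\<lambda>_\<in>Rn 0. x) (\<lambda>_. 0) = (\<lambda>_\<in>U. x)"
    by (auto simp: compose_def Rn_0)
  ultimately show ?thesis by simp
qed

text \<open>Restriction is pullback along the inclusion. Allowing \<open>m\<close> to differ from
  \<open>n\<close> matters when one set is a domain in several dimensions, as the empty open set
  is.\<close>

lemma plot_restrict:
  assumes "space X" "\<phi> \<in> plots X n U" "domain m V" "V \<subseteq> U"
  shows "restrict \<phi> V \<in> plots X m V"
proof -
  have "compose V \<phi> (\<lambda>x. x) \<in> plots X m V"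
    using assms by (intro plot_smooth_compose) (auto simp: smooth_between_inclusion)
  then show ?thesis
    by (simp add: compose_def)
qed

lemma is_plot_spaceI:
  assumes "\<And>n U \<phi>. \<phi> \<in> plots X n U \<Longrightarrow> domain n U"
    and "\<And>n U \<phi>. \<phi> \<in> plots X n U \<Longrightarrow> \<phi> \<in> U \<rightarrow>\<^sub>E points X"
    and "\<And>n U m U' \<phi> f. \<phi> \<in> plots X n U \<Longrightarrow> domain m U' \<Longrightarrow> smooth_between m U' U f \<Longrightarrow>
      compose U' \<phi> f \<in> plots X m U'"
    and glue: "\<And>n U \<phi>. domain n U \<Longrightarrow> \<phi> \<in> U \<rightarrow>\<^sub>E points X \<Longrightarrow>
      (\<And>x. x \<in> U \<Longrightarrow> \<exists>V. domain n V \<and> openin (top_of_set U) V \<and> x \<in> V \<and> restrict \<phi> V \<in> plots X n V) \<Longrightarrow>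
      \<phi> \<in> plots X n U"
    and "\<And>x. x \<in> points X \<Longrightarrow> (\<lambda>_\<in>Rn 0. x) \<in> plots X 0 (Rn 0)"
  shows "space X"
  unfolding is_plot_space_def
proof (intro conjI allI ballI impI)
  fix n U \<U> \<phi>
  assume *: "domain n U \<and> (\<forall>V\<in>\<U>. domain n V \<and> openin (top_of_set U) V) \<and> \<Union>\<U> = U \<and>
        \<phi> \<in> U \<rightarrow>\<^sub>E points X \<and> (\<forall>V\<in>\<U>. restrict \<phi> V \<in> plots X n V)"
  show "\<phi> \<in> plots X n U"
  proof (rule glue)
    fix x assume "x \<in> U"
    then obtain V where "V \<in> \<U>" "x \<in> V" using * by blast
    then show "\<exists>V. domain n V \<and> openin (top_of_set U) V \<and> x \<in> V \<and> restrict \<phi> V \<in> plots X n V"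
      using * by (intro exI[of _ V]) simp
  qed (use * in simp_all)
qed (use assms(1,2,3,5) in auto)

section \<open>Initial structures\<close>

definition initial_space ::
    "'a set \<Rightarrow> 'i set \<Rightarrow> ('i \<Rightarrow> 'b plot_space) \<Rightarrow> ('i \<Rightarrow> 'a \<Rightarrow> 'b) \<Rightarrow> 'a plot_space" where
  "initial_space P I X \<pi> = \<lparr> points = P,
     plots = (\<lambda>n U. {\<phi> \<in> U \<rightarrow>\<^sub>E P. domain n U \<and> (\<forall>i\<in>I. compose U (\<pi> i) \<phi> \<in> plots (X i) n U)}) \<rparr>"

lemma points_initial_space [simp]: "points (initial_space P I X \<pi>) = P"
  by (simp add: initial_space_def)

lemma plots_initial_space:
  "\<phi> \<in> plots (initial_space P I X \<pi>) n U \<longleftrightarrow>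
   \<phi> \<in> U \<rightarrow>\<^sub>E P \<and> domain n U \<and> (\<forall>i\<in>I. compose U (\<pi> i) \<phi> \<in> plots (X i) n U)"
  by (simp add: initial_space_def)

text \<open>Each axiom for the new structure follows from the same axiom in every
  \<open>X i\<close>, applied after composing with \<open>\<pi> i\<close>.\<close>

lemma space_initial_space:
  assumes X: "\<And>i. i \<in> I \<Longrightarrow> space (X i)" and \<pi>: "\<And>i. i \<in> I \<Longrightarrow> \<pi> i \<in> P \<rightarrow> points (X i)"
  shows "space (initial_space P I X \<pi>)"
proof (rule is_plot_spaceI, unfold plots_initial_space points_initial_space)
  fix n U m U' \<phi> f
  assume \<phi>: "\<phi> \<in> U \<rightarrow>\<^sub>E P \<and> domain n U \<and> (\<forall>i\<in>I. compose U (\<pi> i) \<phi> \<in> plots (X i) n U)"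
    and U': "domain m U'" and f: "smooth_between m U' U f"
  have fU: "f \<in> U' \<rightarrow> U" using smooth_between_image[OF f] by auto
  have "compose U' (\<pi> i) (compose U' \<phi> f) \<in> plots (X i) m U'" if i: "i \<in> I" for i
  proof -
    have "compose U (\<pi> i) \<phi> \<in> plots (X i) n U" using \<phi> i by simp
    from plot_smooth_compose[OF X[OF i] this U' f] show ?thesis
      unfolding compose_assoc[OF fU] .
  qed
  moreover have "compose U' \<phi> f \<in> U' \<rightarrow>\<^sub>E P"
    using \<phi> fU by (auto simp: compose_def PiE_iff)
  ultimately show "compose U' \<phi> f \<in> U' \<rightarrow>\<^sub>E P \<and> domain m U' \<and>
      (\<forall>i\<in>I. compose U' (\<pi> i) (compose U' \<phi> f) \<in> plots (X i) m U')"
    using U' by simp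
next
  fix n U \<phi>
  assume U: "domain n U" and \<phi>: "\<phi> \<in> U \<rightarrow>\<^sub>E P"
    and loc: "\<And>x. x \<in> U \<Longrightarrow> \<exists>V. domain n V \<and> openin (top_of_set U) V \<and> x \<in> V \<and>
      restrict \<phi> V \<in> V \<rightarrow>\<^sub>E P \<and> domain n V \<and> (\<forall>i\<in>I. compose V (\<pi> i) (restrict \<phi> V) \<in> plots (X i) n V)"
  have "compose U (\<pi> i) \<phi> \<in> plots (X i) n U" if i: "i \<in> I" for i
  proof (rule plot_glue[OF X[OF i] U compose_funcset[OF \<phi> \<pi>[OF i]]])
    fix x assume "x \<in> U"
    then obtain V where V: "domain n V" "openin (top_of_set U) V" "x \<in> V"
        "compose V (\<pi> i) (restrict \<phi> V) \<in> plots (X i) n V"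
      using loc i by blast
    then show "\<exists>V. domain n V \<and> openin (top_of_set U) V \<and> x \<in> V \<and>
        restrict (compose U (\<pi> i) \<phi>) V \<in> plots (X i) n V"
      using restrict_compose[OF openin_imp_subset[OF V(2)], of "\<pi> i" \<phi>] by (intro exI[of _ V]) simp
  qed
  then show "\<phi> \<in> U \<rightarrow>\<^sub>E P \<and> domain n U \<and> (\<forall>i\<in>I. compose U (\<pi> i) \<phi> \<in> plots (X i) n U)"
    using U \<phi> by simp
next
  fix x assume x: "x \<in> P"
  have "compose (Rn 0) (\<pi> i) (\<lambda>_\<in>Rn 0. x) \<in> plots (X i) 0 (Rn 0)" if "i \<in> I" for i
  proof -
    have "compose (Rn 0) (\<pi> i) (\<lambda>_\<in>Rn 0. x) = (\<lambda>_\<in>Rn 0. \<pi> i x)"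
      by (auto simp: compose_def)
    then show ?thesis
      using plot_const[OF X[OF that] _ domain_point, of "\<pi> i x"] \<pi>[OF that] x by auto
  qed
  then show "(\<lambda>_\<in>Rn 0. x) \<in> Rn 0 \<rightarrow>\<^sub>E P \<and> domain 0 (Rn 0) \<and>
      (\<forall>i\<in>I. compose (Rn 0) (\<pi> i) (\<lambda>_\<in>Rn 0. x) \<in> plots (X i) 0 (Rn 0))"
    using x domain_point by auto
qed auto

lemma smooth_map_initial_space:
  "smooth_map (initial_space P I X \<pi>) (X i) (restrict (\<pi> i) P)" if "i \<in> I" "\<pi> i \<in> P \<rightarrow> points (X i)"
  unfolding smooth_map_def
proof (intro conjI allI ballI)
  fix n U \<phi> assume "\<phi> \<in> plots (initial_space P I X \<pi>) n U"
  then have "\<phi> \<in> U \<rightarrow>\<^sub>E P" "compose U (\<pi> i) \<phi> \<in> plots (X i) n U"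
    using that by (auto simp: plots_initial_space)
  moreover from this have "compose U (restrict (\<pi> i) P) \<phi> = compose U (\<pi> i) \<phi>"
    by (auto simp: compose_def PiE_iff)
  ultimately show "compose U (restrict (\<pi> i) P) \<phi> \<in> plots (X i) n U"
    by simp
qed (use that in auto)

lemma smooth_map_into_initial_space:
  assumes "space A" "h \<in> points A \<rightarrow>\<^sub>E P"
    and "\<And>i. i \<in> I \<Longrightarrow> smooth_map A (X i) (compose (points A) (\<pi> i) h)"
  shows "smooth_map A (initial_space P I X \<pi>) h"
  unfolding smooth_map_def
proof (intro conjI allI ballI)
  fix n U \<phi> assume \<phi>: "\<phi> \<in> plots A n U"
  have f: "\<phi> \<in> U \<rightarrow>\<^sub>E points A" using plot_funcset[OF assms(1) \<phi>] .
  have "compose U (\<pi> i) (compose U h \<phi>) = compose U (compose (points A) (\<pi> i) h) \<phi>" for i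
    using f by (intro compose_assoc) auto
  then have "compose U (\<pi> i) (compose U h \<phi>) \<in> plots (X i) n U" if "i \<in> I" for i
    using smooth_map_plot[OF assms(3)[OF that] \<phi>] by simp
  moreover have "compose U h \<phi> \<in> U \<rightarrow>\<^sub>E P"
    using f assms(2) by (intro compose_funcset) auto
  ultimately show "compose U h \<phi> \<in> plots (initial_space P I X \<pi>) n U"
    using plot_domain[OF assms(1) \<phi>] by (simp add: plots_initial_space)
qed (use assms in auto)

section \<open>Final structures\<close>

definition final_space ::
    "'a set \<Rightarrow> 'i set \<Rightarrow> ('i \<Rightarrow> 'b plot_space) \<Rightarrow> ('i \<Rightarrow> 'b \<Rightarrow> 'a) \<Rightarrow> 'a plot_space" where
  "final_space P I X \<iota> = \<lparr> points = P,
     plots = (\<lambda>n U. {\<phi> \<in> U \<rightarrow>\<^sub>E P. domain n U \<and>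
       (\<forall>x\<in>U. \<exists>V i \<psi>. domain n V \<and> openin (top_of_set U) V \<and> x \<in> V \<and> i \<in> I \<and>
          \<psi> \<in> plots (X i) n V \<and> restrict \<phi> V = compose V (\<iota> i) \<psi>)}) \<rparr>"

lemma points_final_space [simp]: "points (final_space P I X \<iota>) = P"
  by (simp add: final_space_def)

lemma plots_final_space:
  "\<phi> \<in> plots (final_space P I X \<iota>) n U \<longleftrightarrow> \<phi> \<in> U \<rightarrow>\<^sub>E P \<and> domain n U \<and>
   (\<forall>x\<in>U. \<exists>V i \<psi>. domain n V \<and> openin (top_of_set U) V \<and> x \<in> V \<and> i \<in> I \<and>
      \<psi> \<in> plots (X i) n V \<and> restrict \<phi> V = compose V (\<iota> i) \<psi>)"
  by (simp add: final_space_def)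

text \<open>Liftability is demanded only near each point, which builds the gluing axiom into the
  structure. The equation for \<open>P\<close> says that the \<open>\<iota> i\<close> are jointly
  surjective; it makes every constant lift.\<close>

lemma space_final_space:
  assumes X: "\<And>i. i \<in> I \<Longrightarrow> space (X i)" and P: "P = (\<Union>i\<in>I. \<iota> i ` points (X i))"
  shows "space (final_space P I X \<iota>)"
proof (rule is_plot_spaceI, unfold plots_final_space points_final_space)
  fix n U m U' \<phi> f
  assume \<phi>: "\<phi> \<in> U \<rightarrow>\<^sub>E P \<and> domain n U \<and>
      (\<forall>x\<in>U. \<exists>V i \<psi>. domain n V \<and> openin (top_of_set U) V \<and> x \<in> V \<and> i \<in> I \<and>
        \<psi> \<in> plots (X i) n V \<and> restrict \<phi> V = compose V (\<iota> i) \<psi>)"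
    and U': "domain m U'" and f: "smooth_between m U' U f"
  have fU: "f ` U' \<subseteq> U" using smooth_between_image[OF f] .
  have "\<exists>V i \<psi>. domain m V \<and> openin (top_of_set U') V \<and> x \<in> V \<and> i \<in> I \<and>
        \<psi> \<in> plots (X i) m V \<and> restrict (compose U' \<phi> f) V = compose V (\<iota> i) \<psi>" if x: "x \<in> U'" for x
  proof -
    obtain V i \<psi> where V: "domain n V" "openin (top_of_set U) V" "f x \<in> V" "i \<in> I"
        "\<psi> \<in> plots (X i) n V" "restrict \<phi> V = compose V (\<iota> i) \<psi>"
      using \<phi> fU x by blast
    \<comment> \<open>The lift over \<open>V\<close> is to be composed with \<open>f\<close>, but
      the preimage of \<open>V\<close> need not be a domain; \<open>domain_base\<close> shrinks it
      to a domain \<open>W\<close> around \<open>x\<close>.\<close>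
    have "openin (top_of_set U') (U' \<inter> f -` V)"
      using continuous_openin_preimage[OF smooth_between_continuous[OF f] _ V(2)] fU by auto
    then obtain W where W: "domain m W" "openin (top_of_set U') W" "x \<in> W" "W \<subseteq> U' \<inter> f -` V"
      using domain_base[OF U', of _ x] x V(3) by blast
    have fW: "smooth_between m W V f"
      using W(4) by (intro smooth_between_subset[OF f]) auto
    have "compose W \<psi> f \<in> plots (X i) m W"
      using plot_smooth_compose[OF X[OF V(4)] V(5) W(1) fW] .
    moreover have "restrict (compose U' \<phi> f) W = compose W (\<iota> i) (compose W \<psi> f)"
    proof
      fix y
      show "restrict (compose U' \<phi> f) W y = compose W (\<iota> i) (compose W \<psi> f) y"
        using W(4) fun_cong[OF V(6), of "f y"] by (auto simp: compose_def restrict_def)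
    qed
    ultimately show ?thesis
      using W V(4) by (intro exI[of _ W] exI[of _ i] exI[of _ "compose W \<psi> f"]) simp
  qed
  moreover have "compose U' \<phi> f \<in> U' \<rightarrow>\<^sub>E P"
    using \<phi> fU by (auto simp: compose_def PiE_iff)
  ultimately show "compose U' \<phi> f \<in> U' \<rightarrow>\<^sub>E P \<and> domain m U' \<and>
      (\<forall>x\<in>U'. \<exists>V i \<psi>. domain m V \<and> openin (top_of_set U') V \<and> x \<in> V \<and> i \<in> I \<and>
        \<psi> \<in> plots (X i) m V \<and> restrict (compose U' \<phi> f) V = compose V (\<iota> i) \<psi>)"
    using U' by simp
next
  fix n U \<phi>
  assume U: "domain n U" and \<phi>: "\<phi> \<in> U \<rightarrow>\<^sub>E P"
    and loc: "\<And>x. x \<in> U \<Longrightarrow> \<exists>V. domain n V \<and> openin (top_of_set U) V \<and> x \<in> V \<and>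
      restrict \<phi> V \<in> V \<rightarrow>\<^sub>E P \<and> domain n V \<and>
      (\<forall>x\<in>V. \<exists>W i \<psi>. domain n W \<and> openin (top_of_set V) W \<and> x \<in> W \<and> i \<in> I \<and>
        \<psi> \<in> plots (X i) n W \<and> restrict (restrict \<phi> V) W = compose W (\<iota> i) \<psi>)"
  have "\<exists>V i \<psi>. domain n V \<and> openin (top_of_set U) V \<and> x \<in> V \<and> i \<in> I \<and>
        \<psi> \<in> plots (X i) n V \<and> restrict \<phi> V = compose V (\<iota> i) \<psi>" if x: "x \<in> U" for x
  proof -
    obtain V where V: "openin (top_of_set U) V" "x \<in> V"
      "\<forall>x\<in>V. \<exists>W i \<psi>. domain n W \<and> openin (top_of_set V) W \<and> x \<in> W \<and> i \<in> I \<and>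
        \<psi> \<in> plots (X i) n W \<and> restrict (restrict \<phi> V) W = compose W (\<iota> i) \<psi>"
      using loc[OF x] by blast
    obtain W i \<psi> where W: "domain n W" "openin (top_of_set V) W" "x \<in> W" "i \<in> I"
        "\<psi> \<in> plots (X i) n W" "restrict (restrict \<phi> V) W = compose W (\<iota> i) \<psi>"
      using bspec[OF V(3,2)] by blast
    have "W \<subseteq> V" using openin_imp_subset[OF W(2)] .
    then have "restrict \<phi> W = compose W (\<iota> i) \<psi>"
      using W(6) by (simp add: Int_absorb1)
    then show ?thesis
      using W openin_trans[OF W(2) V(1)] by blast
  qed
  then show "\<phi> \<in> U \<rightarrow>\<^sub>E P \<and> domain n U \<and>
      (\<forall>x\<in>U. \<exists>V i \<psi>. domain n V \<and> openin (top_of_set U) V \<and> x \<in> V \<and> i \<in> I \<and>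
        \<psi> \<in> plots (X i) n V \<and> restrict \<phi> V = compose V (\<iota> i) \<psi>)"
    using U \<phi> by simp
next
  fix x assume x: "x \<in> P"
  then obtain i p where i: "i \<in> I" "p \<in> points (X i)" "x = \<iota> i p" unfolding P by blast
  have 1: "restrict (\<lambda>_\<in>Rn 0. x) (Rn 0) = compose (Rn 0) (\<iota> i) (\<lambda>_\<in>Rn 0. p)"
    using i by (auto simp: compose_def)
  have 2: "(\<lambda>_\<in>Rn 0. p) \<in> plots (X i) 0 (Rn 0)"
    using plot_const[OF X[OF i(1)] i(2) domain_point] .
  have "\<exists>V i \<psi>. domain 0 V \<and> openin (top_of_set (Rn 0)) V \<and> y \<in> V \<and> i \<in> I \<and>
        \<psi> \<in> plots (X i) 0 V \<and> restrict (\<lambda>_\<in>Rn 0. x) V = compose V (\<iota> i) \<psi>" if y: "y \<in> Rn 0" for y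
    by (rule exI[of _ "Rn 0"], rule exI[of _ i], rule exI[of _ "\<lambda>_\<in>Rn 0. p"],
        intro conjI domain_point openin_subtopology_self y i(1) 1 2)
  then show "(\<lambda>_\<in>Rn 0. x) \<in> Rn 0 \<rightarrow>\<^sub>E P \<and> domain 0 (Rn 0) \<and>
      (\<forall>y\<in>Rn 0. \<exists>V i \<psi>. domain 0 V \<and> openin (top_of_set (Rn 0)) V \<and> y \<in> V \<and> i \<in> I \<and>
        \<psi> \<in> plots (X i) 0 V \<and> restrict (\<lambda>_\<in>Rn 0. x) V = compose V (\<iota> i) \<psi>)"
    using x domain_point by auto
qed auto

lemma smooth_map_final_space:
  assumes X: "space (X i)" and i: "i \<in> I" and \<iota>: "\<iota> i \<in> points (X i) \<rightarrow> P"
  shows "smooth_map (X i) (final_space P I X \<iota>) (restrict (\<iota> i) (points (X i)))"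
  unfolding smooth_map_def
proof (intro conjI allI ballI)
  fix n U \<phi> assume \<phi>: "\<phi> \<in> plots (X i) n U"
  have f: "\<phi> \<in> U \<rightarrow>\<^sub>E points (X i)" using plot_funcset[OF X \<phi>] .
  have eq: "compose U (restrict (\<iota> i) (points (X i))) \<phi> = compose U (\<iota> i) \<phi>"
    using f by (auto simp: compose_def PiE_iff)
  have "compose U (\<iota> i) \<phi> \<in> U \<rightarrow>\<^sub>E P"
    using f \<iota> by (rule compose_funcset)
  moreover have "restrict (compose U (\<iota> i) \<phi>) U = compose U (\<iota> i) \<phi>"
    by (simp add: compose_def)
  moreover have "domain n U" using plot_domain[OF X \<phi>] .
  ultimately show "compose U (restrict (\<iota> i) (points (X i))) \<phi> \<in> plots (final_space P I X \<iota>) n U"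
    unfolding eq plots_final_space using i \<phi>
    by (intro conjI ballI exI[of _ U] exI[of _ i] exI[of _ \<phi>]) auto
qed (use assms in auto)

text \<open>Lifts of a plot exist only locally and through varying indices, so the image is
  recognized as a plot near each point and then glued in \<open>A\<close>.\<close>

lemma smooth_map_from_final_space:
  assumes A: "space A" and h: "h \<in> P \<rightarrow>\<^sub>E points A" and X: "\<And>i. i \<in> I \<Longrightarrow> space (X i)"
    and s: "\<And>i. i \<in> I \<Longrightarrow> smooth_map (X i) A (compose (points (X i)) h (\<iota> i))"
  shows "smooth_map (final_space P I X \<iota>) A h"
  unfolding smooth_map_def
proof (intro conjI allI ballI)
  fix n U \<phi> assume "\<phi> \<in> plots (final_space P I X \<iota>) n U"
  then have \<phi>: "\<phi> \<in> U \<rightarrow>\<^sub>E P" "domain n U" "\<forall>x\<in>U. \<exists>V i \<psi>. domain n V \<and> openin (top_of_set U) V \<and>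
      x \<in> V \<and> i \<in> I \<and> \<psi> \<in> plots (X i) n V \<and> restrict \<phi> V = compose V (\<iota> i) \<psi>"
    unfolding plots_final_space by simp_all
  show "compose U h \<phi> \<in> plots A n U"
  proof (rule plot_glue[OF A \<phi>(2)])
    show "compose U h \<phi> \<in> U \<rightarrow>\<^sub>E points A"
      using \<phi>(1) h by (intro compose_funcset) auto
    fix x assume "x \<in> U"
    then obtain V i \<psi> where V: "domain n V" "openin (top_of_set U) V" "x \<in> V" "i \<in> I"
        "\<psi> \<in> plots (X i) n V" "restrict \<phi> V = compose V (\<iota> i) \<psi>"
      using \<phi>(3) by blast
    have "restrict (compose U h \<phi>) V = compose V h (compose V (\<iota> i) \<psi>)"
      unfolding restrict_compose[OF openin_imp_subset[OF V(2)]] V(6) ..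
    also have "\<dots> = compose V (compose (points (X i)) h (\<iota> i)) \<psi>"
      using plot_funcset[OF X[OF V(4)] V(5)] by (intro compose_assoc) auto
    finally have "restrict (compose U h \<phi>) V \<in> plots A n V"
      using smooth_map_plot[OF s[OF V(4)] V(5)] by simp
    then show "\<exists>V. domain n V \<and> openin (top_of_set U) V \<and> x \<in> V \<and>
        restrict (compose U h \<phi>) V \<in> plots A n V"
      using V by blast
  qed
qed (use h in auto)

section \<open>Composites of smooth maps and of site maps\<close>

lemma smooth_map_compose:
  assumes "space X" "smooth_map X Y f" "smooth_map Y Z g"
  shows "smooth_map X Z (compose (points X) g f)"
  unfolding smooth_map_def
proof (intro conjI allI ballI)
  show "compose (points X) g f \<in> points X \<rightarrow>\<^sub>E points Z"
    using smooth_map_funcset[OF assms(2)] smooth_map_funcset[OF assms(3)]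
    by (intro compose_funcset[of f _ "points Y"]) auto
  fix n U \<phi> assume \<phi>: "\<phi> \<in> plots X n U"
  have "compose U (compose (points X) g f) \<phi> = compose U g (compose U f \<phi>)"
    using plot_funcset[OF assms(1) \<phi>] by (subst compose_assoc) auto
  then show "compose U (compose (points X) g f) \<phi> \<in> plots Z n U"
    using smooth_map_plot[OF assms(3)] smooth_map_plot[OF assms(2) \<phi>] by simp
qed

lemma smooth_map_ident:
  assumes "space X"
  shows "smooth_map X X (\<lambda>x\<in>points X. x)"
  unfolding smooth_map_def
proof (intro conjI allI ballI)
  fix n U \<phi> assume \<phi>: "\<phi> \<in> plots X n U"
  have "compose U (\<lambda>x\<in>points X. x) \<phi> = \<phi>"
    using plot_funcset[OF assms \<phi>] by (auto simp: compose_def fun_eq_iff PiE_iff extensional_def)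
  then show "compose U (\<lambda>x\<in>points X. x) \<phi> \<in> plots X n U"
    using \<phi> by simp
qed auto

text \<open>Closing the smooth functions under composition by definition makes the chain rule
  unnecessary: plots can be pulled back along such composites one factor at a time.\<close>

inductive site_map :: "nat \<Rightarrow> fvec set \<Rightarrow> fvec set \<Rightarrow> (fvec \<Rightarrow> fvec) \<Rightarrow> bool" where
  site_map_ident: "domain n U \<Longrightarrow> site_map n U U (\<lambda>x. x)"
| site_map_compose: "site_map m U' U f \<Longrightarrow> domain n U \<Longrightarrow> smooth_between n U V g \<Longrightarrow>
    site_map m U' V (\<lambda>x. g (f x))"

lemma site_map_domain: "site_map m U' U f \<Longrightarrow> domain m U'"
  by (induction rule: site_map.induct) auto

lemma site_map_image: "site_map m U' U f \<Longrightarrow> f \<in> U' \<rightarrow> U"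
proof (induction rule: site_map.induct)
  case (site_map_compose m U' U f n V g)
  then show ?case using smooth_between_image[OF site_map_compose.hyps(3)] by auto
qed auto

text \<open>The induction removes the outermost factor \<open>g\<close> by pulling
  \<open>\<phi>\<close> back along it first. The dimension \<open>k\<close> stays arbitrary because
  \<open>site_map\<close> does not record the dimension of its target.\<close>

lemma plot_site_map_compose:
  "site_map m U' U f \<Longrightarrow> space X \<Longrightarrow> \<phi> \<in> plots X k U \<Longrightarrow> compose U' \<phi> f \<in> plots X m U'"
proof (induction arbitrary: \<phi> k rule: site_map.induct)
  case (site_map_ident n U)
  then have "restrict \<phi> U \<in> plots X n U"
    by (intro plot_restrict) auto
  then show ?case by (simp only: compose_def)
next
  case (site_map_compose m U' U f n V g)
  have "compose U' (compose U \<phi> g) f \<in> plots X m U'"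
    using plot_smooth_compose[OF site_map_compose.prems site_map_compose.hyps(2,3)]
    by (rule site_map_compose.IH[OF site_map_compose.prems(1)])
  moreover have "compose U' (compose U \<phi> g) f = compose U' \<phi> (\<lambda>x. g (f x))"
    using site_map_image[OF site_map_compose.hyps(1)]
    by (auto simp: compose_def restrict_def fun_eq_iff Pi_iff)
  ultimately show ?case by simp
qed

text \<open>Every factor of the composite must again run between domains, so shrinking the target
  shrinks all intermediate domains. The induction proceeds from the target back to the source:
  continuity makes each preimage open, and \<open>domain_base\<close> replaces it by a
  domain.\<close>

lemma site_map_restrict:
  "site_map m U' U f \<Longrightarrow> domain k V \<Longrightarrow> openin (top_of_set U) V \<Longrightarrow> x \<in> U' \<Longrightarrow> f x \<in> V \<Longrightarrow>
   \<exists>V'. openin (top_of_set U') V' \<and> x \<in> V' \<and> site_map m V' V f"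
proof (induction arbitrary: V k rule: site_map.induct)
  case (site_map_ident n U)
  then obtain V' where V': "domain n V'" "openin (top_of_set U) V'" "x \<in> V'" "V' \<subseteq> V"
    using domain_base by blast
  then have "site_map n V' V (\<lambda>x. x)"
    using site_map_compose[OF site_map.site_map_ident[OF V'(1)] V'(1) smooth_between_inclusion] by simp
  then show ?case using V' by blast
next
  case (site_map_compose m U' U f n V0 g)
  have fx: "f x \<in> U"
    using site_map_image[OF site_map_compose.hyps(1)] site_map_compose.prems(3) by auto
  have "openin (top_of_set U) (U \<inter> g -` V)"
    using continuous_openin_preimage[OF smooth_between_continuous[OF site_map_compose.hyps(3)] _
        site_map_compose.prems(2)] smooth_between_image[OF site_map_compose.hyps(3)] by auto
  then obtain W where W: "domain n W" "openin (top_of_set U) W" "f x \<in> W" "W \<subseteq> U \<inter> g -` V"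
    using domain_base[OF site_map_compose.hyps(2), of _ "f x"] fx site_map_compose.prems(4) by blast
  obtain V' where V': "openin (top_of_set U') V'" "x \<in> V'" "site_map m V' W f"
    using site_map_compose.IH[OF W(1,2) site_map_compose.prems(3) W(3)] by blast
  have "smooth_between n W V g"
    using W(4) by (intro smooth_between_subset[OF site_map_compose.hyps(3)]) auto
  then have "site_map m V' V (\<lambda>x. g (f x))"
    using site_map.site_map_compose[OF V'(3) W(1)] by simp
  then show ?case using V' by blast
qed

end

section \<open>Limits and colimits of smooth spaces\<close>

abbreviation arrow_fun :: "'a \<times> 'b \<times> 'c \<Rightarrow> 'c" where
  "arrow_fun F \<equiv> snd (snd F)"

lemma smooth_category_simps:
  "Dom (smooth_category S) (X, Y, f) = X"
  "Cod (smooth_category S) (X, Y, f) = Y"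
  "Ident (smooth_category S) X = (X, X, \<lambda>x\<in>points X. x)"
  "(Y', Z, g) \<odot>\<^bsub>smooth_category S\<^esub> (X, Y, f) = (X, Z, compose (points X) g f)"
  by (simp_all add: smooth_category_def Let_def)

lemma compose_eq_app: "compose A g f = h \<Longrightarrow> x \<in> A \<Longrightarrow> g (f x) = h x"
  by (auto simp: compose_def)

locale smooth_site = plot_site domain + universe u
  for domain :: "nat \<Rightarrow> fvec set \<Rightarrow> bool" and u :: "'u itself"
begin

abbreviation Sm :: "('u plot_space, 'u smooth_arrow) category" where
  "Sm \<equiv> smooth_category space"

lemma Ob_Sm: "X \<in> Ob Sm \<longleftrightarrow> space X \<and> small' (points X)"
  by (simp add: smooth_category_def Let_def small_def)

lemma Ob_space: "X \<in> Ob Sm \<Longrightarrow> space X" and Ob_small: "X \<in> Ob Sm \<Longrightarrow> small' (points X)"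
  by (simp_all add: Ob_Sm)

lemma Ar_Sm: "(X, Y, f) \<in> Ar Sm \<longleftrightarrow> X \<in> Ob Sm \<and> Y \<in> Ob Sm \<and> smooth_map X Y f"
  by (simp add: smooth_category_def Let_def)

lemma Hom_Sm:
  "(X', Y', f) \<in> Hom Sm X Y \<longleftrightarrow> X' = X \<and> Y' = Y \<and> X \<in> Ob Sm \<and> Y \<in> Ob Sm \<and> smooth_map X Y f"
  unfolding Hom_def mem_Collect_eq Ar_Sm smooth_category_simps by auto

lemma Hom_SmE:
  assumes "F \<in> Hom Sm X Y"
  obtains f where "F = (X, Y, f)" "X \<in> Ob Sm" "Y \<in> Ob Sm" "smooth_map X Y f"
  using assms by (cases F) (auto simp: Hom_Sm)

lemma Hom_SmD:
  assumes "F \<in> Hom Sm X Y"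
  shows "F = (X, Y, arrow_fun F)" "X \<in> Ob Sm" "Y \<in> Ob Sm" "smooth_map X Y (arrow_fun F)"
  using assms by (auto elim: Hom_SmE)

lemma category_Sm: "category Sm"
proof
  fix F assume "F \<in> Ar Sm"
  then show "Dom Sm F \<in> Ob Sm" "Cod Sm F \<in> Ob Sm"
    by (cases F; simp add: Ar_Sm smooth_category_simps)+
next
  fix X assume "X \<in> Ob Sm"
  then show "Ident Sm X \<in> Hom Sm X X"
    by (simp add: smooth_category_simps Hom_Sm smooth_map_ident Ob_space)
next
  fix F G X Y Z assume "F \<in> Hom Sm X Y" "G \<in> Hom Sm Y Z"
  then show "G \<odot>\<^bsub>Sm\<^esub> F \<in> Hom Sm X Z"
    by (elim Hom_SmE) (simp add: smooth_category_simps Hom_Sm smooth_map_compose Ob_space)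
next
  fix F X Y assume F': "F \<in> Hom Sm X Y"
  obtain f where F: "F = (X, Y, f)" "f \<in> points X \<rightarrow>\<^sub>E points Y"
    using Hom_SmD(1)[OF F'] smooth_map_funcset[OF Hom_SmD(4)[OF F']] by blast
  have "compose (points X) (\<lambda>y\<in>points Y. y) f = f" "compose (points X) f (\<lambda>x\<in>points X. x) = f"
    using F(2) by (auto simp: compose_def fun_eq_iff PiE_iff extensional_def)
  then show "Ident Sm Y \<odot>\<^bsub>Sm\<^esub> F = F" "F \<odot>\<^bsub>Sm\<^esub> Ident Sm X = F"
    by (simp_all add: F smooth_category_simps)
next
  fix F G H X Y Z W assume F: "F \<in> Hom Sm X Y" and "G \<in> Hom Sm Y Z" "H \<in> Hom Sm Z W"
  then show "H \<odot>\<^bsub>Sm\<^esub> G \<odot>\<^bsub>Sm\<^esub> F = H \<odot>\<^bsub>Sm\<^esub> (G \<odot>\<^bsub>Sm\<^esub> F)"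
  proof (elim Hom_SmE)
    fix f g h assume *: "F = (X, Y, f)" "smooth_map X Y f" "G = (Y, Z, g)" "H = (Z, W, h)"
    then have "f \<in> points X \<rightarrow> points Y" using smooth_map_funcset by blast
    then show ?thesis by (simp add: * smooth_category_simps compose_assoc)
  qed
qed

text \<open>The common source of limits and of products in slices: tuples cut out of a product by a
  condition \<open>R\<close>, with the initial structure. As \<open>R\<close> concerns points alone,
  a family of maps factors as soon as its tuples satisfy \<open>R\<close> pointwise.\<close>

lemma sub_product:
  assumes I: "small' I" and X: "\<And>i. i \<in> I \<Longrightarrow> X i \<in> Ob Sm"
  shows "\<exists>L \<pi>. L \<in> Ob Sm \<and> (\<forall>i\<in>I. smooth_map L (X i) (\<pi> i)) \<and>
    (\<forall>a\<in>points L. R (\<lambda>i\<in>I. \<pi> i a)) \<and>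
    (\<forall>A \<alpha>. A \<in> Ob Sm \<and> (\<forall>i\<in>I. smooth_map A (X i) (\<alpha> i)) \<and>
       (\<forall>a\<in>points A. R (\<lambda>i\<in>I. \<alpha> i a)) \<longrightarrow>
       (\<exists>!h. smooth_map A L h \<and> (\<forall>i\<in>I. compose (points A) (\<pi> i) h = \<alpha> i)))"
proof -
  define S where "S = {x \<in> \<Pi>\<^sub>E i\<in>I. points (X i). R x}"
  have "small' (\<Pi>\<^sub>E i\<in>I. points (X i))"
    using I Ob_small[OF X] by (rule small_PiE)
  then have "small' S"
    by (rule small_subset) (simp add: S_def)
  then obtain e :: "('a \<Rightarrow> 'u) \<Rightarrow> 'u" where e: "inj_on e S"
    by (rule small_code)
  define \<pi> where "\<pi> = (\<lambda>i p. inv_into S e p i)"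
  define L where "L = initial_space (e ` S) I X \<pi>"
  \<comment> \<open>The points are codes, so \<open>\<pi>\<close> decodes before projecting; arrows
    are extensional functions, which calls for the restricted version.\<close>
  define \<pi>' where "\<pi>' = (\<lambda>i. restrict (\<pi> i) (e ` S))"
  have P: "points L = e ` S" by (simp add: L_def)
  have dec: "\<pi> i (e x) = x i" if "x \<in> S" for i x
    using e that by (simp add: \<pi>_def)
  have \<pi>: "\<pi> i \<in> e ` S \<rightarrow> points (X i)" if "i \<in> I" for i
    using that dec by (auto simp: S_def PiE_iff)
  have tuple: "(\<lambda>i\<in>I. \<pi>' i (e x)) = x" if "x \<in> S" for x
    using that dec[OF that] by (auto simp: \<pi>'_def S_def fun_eq_iff PiE_iff extensional_def)
  show ?thesis
  proof (intro exI[of _ L] exI[of _ \<pi>'] conjI ballI allI impI)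
    have "space L"
      unfolding L_def using Ob_space[OF X] \<pi> by (rule space_initial_space)
    moreover have "small' (points L)"
      unfolding P by (rule small_image[OF \<open>small' S\<close>])
    ultimately show "L \<in> Ob Sm" by (simp add: Ob_Sm)
    show "smooth_map L (X i) (\<pi>' i)" if "i \<in> I" for i
      unfolding L_def \<pi>'_def using that \<pi>[OF that] by (rule smooth_map_initial_space)
    show "R (\<lambda>i\<in>I. \<pi>' i a)" if a: "a \<in> points L" for a
    proof -
      obtain x where "x \<in> S" "a = e x" using a unfolding P by auto
      then show ?thesis using tuple by (simp add: S_def)
    qed
    fix A \<alpha> assume hyp: "A \<in> Ob Sm \<and> (\<forall>i\<in>I. smooth_map A (X i) (\<alpha> i)) \<and>
       (\<forall>a\<in>points A. R (\<lambda>i\<in>I. \<alpha> i a))"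
    have A: "A \<in> Ob Sm" and \<alpha>: "\<And>i. i \<in> I \<Longrightarrow> smooth_map A (X i) (\<alpha> i)"
      and R: "\<And>a. a \<in> points A \<Longrightarrow> R (\<lambda>i\<in>I. \<alpha> i a)"
      using hyp by simp_all
    define h where "h = (\<lambda>a\<in>points A. e (\<lambda>i\<in>I. \<alpha> i a))"
    have S: "(\<lambda>i\<in>I. \<alpha> i a) \<in> S" if "a \<in> points A" for a
      using R[OF that] smooth_map_funcset[OF \<alpha>] that by (auto simp: S_def)
    have hP: "h \<in> points A \<rightarrow>\<^sub>E e ` S"
      using S by (auto simp: h_def)
    have comp: "compose (points A) (\<pi> i) h = \<alpha> i" "compose (points A) (\<pi>' i) h = \<alpha> i" if "i \<in> I" for i
      using smooth_map_funcset[OF \<alpha>[OF that]] that S dec[OF S]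
      by (auto simp: compose_def h_def \<pi>'_def fun_eq_iff PiE_iff extensional_def)
    have h: "smooth_map A L h"
      unfolding L_def using Ob_space[OF A] hP
    proof (rule smooth_map_into_initial_space)
      show "smooth_map A (X i) (compose (points A) (\<pi> i) h)" if "i \<in> I" for i
        using comp(1)[OF that] \<alpha>[OF that] by simp
    qed
    show "\<exists>!h. smooth_map A L h \<and> (\<forall>i\<in>I. compose (points A) (\<pi>' i) h = \<alpha> i)"
    proof (rule ex1I[of _ h])
      show "smooth_map A L h \<and> (\<forall>i\<in>I. compose (points A) (\<pi>' i) h = \<alpha> i)"
        using h comp(2) by simp
      fix k assume k: "smooth_map A L k \<and> (\<forall>i\<in>I. compose (points A) (\<pi>' i) k = \<alpha> i)"
      show "k = h"
      proof (rule smooth_map_eqI[OF conjunct1[OF k] h])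
        fix a assume a: "a \<in> points A"
        obtain x where x: "x \<in> S" "k a = e x"
          using smooth_map_funcset[OF conjunct1[OF k]] a P by auto
        have "\<pi>' i (k a) = \<alpha> i a" if "i \<in> I" for i
          using compose_eq_app[of "points A" "\<pi>' i" k "\<alpha> i", OF _ a] k that by simp
        then have "(\<lambda>i\<in>I. \<alpha> i a) = (\<lambda>i\<in>I. \<pi>' i (k a))"
          by (intro restrict_ext) simp
        then have "(\<lambda>i\<in>I. \<alpha> i a) = x"
          unfolding x(2) tuple[OF x(1)] .
        then show "k a = h a"
          using a x(2) by (simp add: h_def)
      qed
    qed
  qed
qed

text \<open>The set of points is the usual set of matching families, obtained from
  \<open>sub_product\<close> with the matching equations of the diagram as \<open>R\<close>.\<close>

lemma limits_Sm:
  fixes J :: "('i, 'j) category"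
  assumes J: "category J" and small: "small' (Ob J)"
  shows "has_limits_of_shape J Sm"
  unfolding has_limits_of_shape_def
proof (intro allI impI)
  fix Fo Fa assume F: "is_functor J Sm Fo Fa"
  interpret J: category J by fact
  have FO: "Fo j \<in> Ob Sm" if "j \<in> Ob J" for j
    using F that by (simp add: is_functor_def)
  have FA: "Fa v \<in> Hom Sm (Fo j) (Fo k)" if "v \<in> Hom J j k" for j k v
    using F that by (simp add: is_functor_def)
  define R where "R = (\<lambda>x. \<forall>j k. \<forall>v\<in>Hom J j k. arrow_fun (Fa v) (x j) = x k)"
  obtain L \<pi> where L: "L \<in> Ob Sm" and \<pi>: "\<forall>j\<in>Ob J. smooth_map L (Fo j) (\<pi> j)"
    and R: "\<forall>a\<in>points L. R (\<lambda>j\<in>Ob J. \<pi> j a)"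
    and univ: "\<forall>A \<alpha>. A \<in> Ob Sm \<and> (\<forall>j\<in>Ob J. smooth_map A (Fo j) (\<alpha> j)) \<and>
       (\<forall>a\<in>points A. R (\<lambda>j\<in>Ob J. \<alpha> j a)) \<longrightarrow>
       (\<exists>!h. smooth_map A L h \<and> (\<forall>j\<in>Ob J. compose (points A) (\<pi> j) h = \<alpha> j))"
    using sub_product[where X = Fo and R = R, OF small FO] by blast
  \<comment> \<open>This turns commutation of arrows into equations between points. The converse
    direction uses that \<open>\<alpha> k\<close> is extensional.\<close>
  have cone: "Fa v \<odot>\<^bsub>Sm\<^esub> (A, Fo j, \<alpha> j) = (A, Fo k, \<alpha> k) \<longleftrightarrow>
      (\<forall>a\<in>points A. arrow_fun (Fa v) (\<alpha> j a) = \<alpha> k a)"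
    if v: "v \<in> Hom J j k" and \<alpha>: "smooth_map A (Fo k) (\<alpha> k)" for A \<alpha> v j k
  proof -
    have "Fa v \<odot>\<^bsub>Sm\<^esub> (A, Fo j, \<alpha> j) = (A, Fo k, compose (points A) (arrow_fun (Fa v)) (\<alpha> j))"
      using Hom_SmD(1)[OF FA[OF v]] smooth_category_simps(4) by metis
    moreover have "compose (points A) (arrow_fun (Fa v)) (\<alpha> j) = \<alpha> k \<longleftrightarrow>
        (\<forall>a\<in>points A. arrow_fun (Fa v) (\<alpha> j a) = \<alpha> k a)"
      using smooth_map_funcset[OF \<alpha>] by (auto simp: compose_def fun_eq_iff PiE_iff extensional_def)
    ultimately show ?thesis by simp
  qed
  have R_iff: "R (\<lambda>j\<in>Ob J. \<alpha> j) \<longleftrightarrow> (\<forall>j k. \<forall>v\<in>Hom J j k. arrow_fun (Fa v) (\<alpha> j) = \<alpha> k)" for \<alpha>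
    using J.Hom_Ob by (auto simp: R_def)
  have "is_limit J Sm Fo Fa L (\<lambda>j. (L, Fo j, \<pi> j))"
    unfolding is_limit_def
  proof (intro conjI allI impI)
    show "is_cone J Sm Fo Fa L (\<lambda>j. (L, Fo j, \<pi> j))"
      unfolding is_cone_def
    proof (intro conjI allI ballI)
      fix j k v assume v: "v \<in> Hom J j k"
      show "Fa v \<odot>\<^bsub>Sm\<^esub> (L, Fo j, \<pi> j) = (L, Fo k, \<pi> k)"
        using cone[of v j k L \<pi>, OF v \<pi>[rule_format, OF J.Hom_Ob(2)[OF v]]] R v by (simp add: R_iff)
    qed (use L \<pi> FO Hom_Sm in auto)
    fix A \<alpha> assume A: "is_cone J Sm Fo Fa A \<alpha>"
    have AO: "A \<in> Ob Sm" and Hom: "\<And>j. j \<in> Ob J \<Longrightarrow> \<alpha> j \<in> Hom Sm A (Fo j)"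
      and comm: "\<And>j k v. v \<in> Hom J j k \<Longrightarrow> Fa v \<odot>\<^bsub>Sm\<^esub> \<alpha> j = \<alpha> k"
      using A by (simp_all add: is_cone_def)
    define \<beta> where "\<beta> = (\<lambda>j. arrow_fun (\<alpha> j))"
    have \<alpha>: "\<alpha> j = (A, Fo j, \<beta> j)" "smooth_map A (Fo j) (\<beta> j)" if "j \<in> Ob J" for j
      using Hom_SmD[OF Hom[OF that]] by (simp_all add: \<beta>_def)
    have "R (\<lambda>j\<in>Ob J. \<beta> j a)" if a: "a \<in> points A" for a
      unfolding R_iff
    proof (intro allI ballI)
      fix j k v assume v: "v \<in> Hom J j k"
      have jk: "j \<in> Ob J" "k \<in> Ob J" using J.Hom_Ob[OF v] by auto
      show "arrow_fun (Fa v) (\<beta> j a) = \<beta> k a"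
        using cone[of v j k A \<beta>, OF v \<alpha>(2)[OF jk(2)]] comm[OF v] \<alpha>(1) jk a by auto
    qed
    then have "\<exists>!h. smooth_map A L h \<and> (\<forall>j\<in>Ob J. compose (points A) (\<pi> j) h = \<beta> j)"
      using univ[THEN spec, THEN spec, THEN mp, of A \<beta>] AO \<alpha>(2) by simp
    then obtain h where h: "smooth_map A L h" "\<And>j. j \<in> Ob J \<Longrightarrow> compose (points A) (\<pi> j) h = \<beta> j"
      and uniq: "\<And>k. smooth_map A L k \<Longrightarrow> (\<forall>j\<in>Ob J. compose (points A) (\<pi> j) k = \<beta> j) \<Longrightarrow> k = h"
      by (metis (no_types, lifting))
    show "\<exists>!h. h \<in> Hom Sm A L \<and> (\<forall>j\<in>Ob J. (L, Fo j, \<pi> j) \<odot>\<^bsub>Sm\<^esub> h = \<alpha> j)"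
    proof (rule ex1I[of _ "(A, L, h)"])
      show "(A, L, h) \<in> Hom Sm A L \<and> (\<forall>j\<in>Ob J. (L, Fo j, \<pi> j) \<odot>\<^bsub>Sm\<^esub> (A, L, h) = \<alpha> j)"
        using AO L h \<alpha>(1) by (simp add: Hom_Sm smooth_category_simps)
      fix K assume K: "K \<in> Hom Sm A L \<and> (\<forall>j\<in>Ob J. (L, Fo j, \<pi> j) \<odot>\<^bsub>Sm\<^esub> K = \<alpha> j)"
      then obtain k where k: "K = (A, L, k)" "smooth_map A L k" by (auto elim: Hom_SmE)
      have "\<forall>j\<in>Ob J. compose (points A) (\<pi> j) k = \<beta> j"
        using K \<alpha>(1) by (simp add: k smooth_category_simps)
      then show "K = (A, L, h)"
        using uniq[OF k(2)] k(1) by simp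
    qed
  qed
  then show "\<exists>L \<pi>. is_limit J Sm Fo Fa L \<pi>" by blast
qed

text \<open>The final structure takes care of smoothness, so the work lies in the set of points: a
  quotient of the disjoint union on which every cocone is well defined.\<close>

lemma colimits_Sm:
  fixes J :: "('i, 'j) category"
  assumes J: "category J" and small: "small' (Ob J)"
  shows "has_colimits_of_shape J Sm"
  unfolding has_colimits_of_shape_def
proof (intro allI impI)
  fix Fo Fa assume F: "is_functor J Sm Fo Fa"
  interpret J: category J by fact
  have FO: "Fo j \<in> Ob Sm" if "j \<in> Ob J" for j
    using F that by (simp add: is_functor_def)
  have FA: "Fa v \<in> Hom Sm (Fo j) (Fo k)" if "v \<in> Hom J j k" for j k v
    using F that by (simp add: is_functor_def)
  define S where "S = Sigma (Ob J) (\<lambda>j. points (Fo j))"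
  \<comment> \<open>Identifying points that no cocone separates avoids generating an equivalence relation.\<close>
  define agree where "agree = (\<lambda>s t. \<forall>A \<alpha>. is_cocone J Sm Fo Fa A \<alpha> \<longrightarrow>
    arrow_fun (\<alpha> (fst s)) (snd s) = arrow_fun (\<alpha> (fst t)) (snd t))"
  define q where "q = (\<lambda>s. {t \<in> S. agree s t})"
  have q_eq: "q s = q t \<longleftrightarrow> agree s t" if "s \<in> S" "t \<in> S" for s t
  proof
    assume "q s = q t"
    moreover have "t \<in> q t" using that by (simp add: q_def agree_def)
    ultimately have "t \<in> q s" by simp
    then show "agree s t" by (simp add: q_def)
  qed (auto simp: q_def agree_def)
  have "small' S"
    unfolding S_def using small Ob_small[OF FO] by (rule small_Sigma)
  then have "small' (q ` S)" by (rule small_image)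
  then obtain e :: "('i \<times> 'u) set \<Rightarrow> 'u" where e: "inj_on e (q ` S)"
    by (rule small_code)
  define \<iota> where "\<iota> = (\<lambda>j x. e (q (j, x)))"
  define P where "P = (\<Union>j\<in>Ob J. \<iota> j ` points (Fo j))"
  define L where "L = final_space P (Ob J) Fo \<iota>"
  define \<iota>' where "\<iota>' = (\<lambda>j. restrict (\<iota> j) (points (Fo j)))"
  have \<iota>_eq: "\<iota> j x = \<iota> k y \<longleftrightarrow> agree (j, x) (k, y)"
    if "j \<in> Ob J" "x \<in> points (Fo j)" "k \<in> Ob J" "y \<in> points (Fo k)" for j x k y
  proof -
    have "(j, x) \<in> S" "(k, y) \<in> S" using that by (auto simp: S_def)
    then show ?thesis using q_eq inj_on_eq_iff[OF e] by (simp add: \<iota>_def)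
  qed
  have LO: "L \<in> Ob Sm"
  proof -
    have "P \<subseteq> e ` q ` S" by (auto simp: P_def \<iota>_def S_def)
    then have "small' (points L)"
      using small_subset[OF small_image[OF \<open>small' (q ` S)\<close>, of e]] by (simp add: L_def)
    moreover have "space L"
      unfolding L_def using Ob_space[OF FO] P_def by (rule space_final_space)
    ultimately show ?thesis by (simp add: Ob_Sm)
  qed
  have \<iota>P: "\<iota> j \<in> points (Fo j) \<rightarrow> P" if "j \<in> Ob J" for j
    using that by (auto simp: P_def)
  have \<iota>: "smooth_map (Fo j) L (\<iota>' j)" if "j \<in> Ob J" for j
    unfolding L_def \<iota>'_def
    using Ob_space[OF FO[OF that]] that \<iota>P[OF that] by (rule smooth_map_final_space)
  have cocone_eq: "arrow_fun (\<alpha> k) (arrow_fun (Fa v) x) = arrow_fun (\<alpha> j) x"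
    if A: "is_cocone J Sm Fo Fa A \<alpha>" and v: "v \<in> Hom J j k" and x: "x \<in> points (Fo j)" for A \<alpha> j k v x
  proof -
    have jk: "j \<in> Ob J" "k \<in> Ob J" using J.Hom_Ob[OF v] by auto
    have "\<alpha> k \<in> Hom Sm (Fo k) A" and eq: "\<alpha> k \<odot>\<^bsub>Sm\<^esub> Fa v = \<alpha> j"
      using A v jk by (simp_all add: is_cocone_def)
    then have "\<alpha> k \<odot>\<^bsub>Sm\<^esub> Fa v = (Fo j, A, compose (points (Fo j)) (arrow_fun (\<alpha> k)) (arrow_fun (Fa v)))"
      using Hom_SmD(1)[OF FA[OF v]] Hom_SmD(1) smooth_category_simps(4) by metis
    then have "arrow_fun (\<alpha> j) = compose (points (Fo j)) (arrow_fun (\<alpha> k)) (arrow_fun (Fa v))"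
      using eq by simp
    then show ?thesis using x by (simp add: compose_def)
  qed
  have "is_colimit J Sm Fo Fa L (\<lambda>j. (Fo j, L, \<iota>' j))"
    unfolding is_colimit_def
  proof (intro conjI allI impI)
    show "is_cocone J Sm Fo Fa L (\<lambda>j. (Fo j, L, \<iota>' j))"
      unfolding is_cocone_def
    proof (intro conjI allI ballI)
      fix j k v assume v: "v \<in> Hom J j k"
      have jk: "j \<in> Ob J" "k \<in> Ob J" using J.Hom_Ob[OF v] by auto
      obtain f where f: "Fa v = (Fo j, Fo k, f)" "smooth_map (Fo j) (Fo k) f"
        using FA[OF v] by (auto elim: Hom_SmE)
      have "\<iota>' k (f x) = \<iota>' j x" if x: "x \<in> points (Fo j)" for x
      proof -
        have "f x \<in> points (Fo k)" using smooth_map_funcset[OF f(2)] x by auto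
        \<comment> \<open>The injections are not yet known to commute with the diagram; they do
          because every cocone already takes the same value at \<open>(k, f x)\<close> and
          \<open>(j, x)\<close>.\<close>
        moreover have "agree (k, f x) (j, x)"
          using cocone_eq[OF _ v x] f(1) by (simp add: agree_def)
        ultimately show ?thesis using \<iota>_eq jk x by (simp add: \<iota>'_def)
      qed
      then have "compose (points (Fo j)) (\<iota>' k) f = \<iota>' j"
        by (auto simp: compose_def \<iota>'_def fun_eq_iff)
      then show "(Fo k, L, \<iota>' k) \<odot>\<^bsub>Sm\<^esub> Fa v = (Fo j, L, \<iota>' j)"
        by (simp add: f smooth_category_simps)
    qed (use LO \<iota> FO Hom_Sm in auto)
    fix A \<alpha> assume A: "is_cocone J Sm Fo Fa A \<alpha>"
    have AO: "A \<in> Ob Sm" and Hom: "\<And>j. j \<in> Ob J \<Longrightarrow> \<alpha> j \<in> Hom Sm (Fo j) A"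
      using A by (simp_all add: is_cocone_def)
    define \<beta> where "\<beta> = (\<lambda>j. arrow_fun (\<alpha> j))"
    have \<alpha>: "\<alpha> j = (Fo j, A, \<beta> j)" "smooth_map (Fo j) A (\<beta> j)" if "j \<in> Ob J" for j
      using Hom_SmD[OF Hom[OF that]] by (simp_all add: \<beta>_def)
    \<comment> \<open>Any representative serves: \<open>\<alpha>\<close> is among the cocones over
      which \<open>agree\<close> quantifies, so \<open>\<beta>\<close> takes the same value at all
      representatives of \<open>p\<close>.\<close>
    define pick where "pick = (\<lambda>p. SOME s. s \<in> S \<and> \<iota> (fst s) (snd s) = p)"
    define h where "h = (\<lambda>p\<in>P. \<beta> (fst (pick p)) (snd (pick p)))"
    have h_\<iota>: "h (\<iota> j x) = \<beta> j x" if "j \<in> Ob J" "x \<in> points (Fo j)" for j x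
    proof -
      have "pick (\<iota> j x) \<in> S \<and> \<iota> (fst (pick (\<iota> j x))) (snd (pick (\<iota> j x))) = \<iota> j x"
        unfolding pick_def by (rule someI[of _ "(j, x)"]) (use that in \<open>simp add: S_def\<close>)
      then have "agree (pick (\<iota> j x)) (j, x)"
        using \<iota>_eq[OF _ _ that] by (auto simp: S_def)
      then have "\<beta> (fst (pick (\<iota> j x))) (snd (pick (\<iota> j x))) = \<beta> j x"
        using A by (simp add: agree_def \<beta>_def)
      then show ?thesis using \<iota>P that by (auto simp: h_def)
    qed
    have hP: "h \<in> P \<rightarrow>\<^sub>E points A"
    proof (rule PiE_I)
      fix p assume "p \<in> P"
      then obtain j x where "j \<in> Ob J" "x \<in> points (Fo j)" "p = \<iota> j x" by (auto simp: P_def)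
      then show "h p \<in> points A"
        using h_\<iota> smooth_map_funcset[OF \<alpha>(2)] by auto
    qed (simp add: h_def)
    have comp: "compose (points (Fo j)) h (\<iota> j) = \<beta> j" "compose (points (Fo j)) h (\<iota>' j) = \<beta> j"
      if "j \<in> Ob J" for j
      using smooth_map_funcset[OF \<alpha>(2)[OF that]] h_\<iota>[OF that]
      by (auto simp: compose_def \<iota>'_def fun_eq_iff PiE_iff extensional_def)
    have h: "smooth_map L A h"
      unfolding L_def using Ob_space[OF AO] hP Ob_space[OF FO]
    proof (rule smooth_map_from_final_space)
      show "smooth_map (Fo j) A (compose (points (Fo j)) h (\<iota> j))" if "j \<in> Ob J" for j
        using comp(1)[OF that] \<alpha>(2)[OF that] by simp
    qed
    show "\<exists>!h. h \<in> Hom Sm L A \<and> (\<forall>j\<in>Ob J. h \<odot>\<^bsub>Sm\<^esub> (Fo j, L, \<iota>' j) = \<alpha> j)"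
    proof (rule ex1I[of _ "(L, A, h)"])
      show "(L, A, h) \<in> Hom Sm L A \<and> (\<forall>j\<in>Ob J. (L, A, h) \<odot>\<^bsub>Sm\<^esub> (Fo j, L, \<iota>' j) = \<alpha> j)"
        using AO LO h \<alpha>(1) comp by (simp add: Hom_Sm smooth_category_simps)
      fix K assume K: "K \<in> Hom Sm L A \<and> (\<forall>j\<in>Ob J. K \<odot>\<^bsub>Sm\<^esub> (Fo j, L, \<iota>' j) = \<alpha> j)"
      then obtain k where k: "K = (L, A, k)" "smooth_map L A k" by (auto elim: Hom_SmE)
      have "k = h"
      proof (rule smooth_map_eqI[OF k(2) h])
        fix p assume "p \<in> points L"
        then obtain j x where jx: "j \<in> Ob J" "x \<in> points (Fo j)" "p = \<iota> j x"
          by (auto simp: P_def L_def)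
        have "compose (points (Fo j)) k (\<iota>' j) = \<beta> j"
          using K jx(1) \<alpha>(1) by (simp add: k smooth_category_simps)
        then have "k (\<iota>' j x) = \<beta> j x"
          using jx(2) by (rule compose_eq_app)
        then show "k p = h p"
          using jx h_\<iota> by (simp add: \<iota>'_def)
      qed
      then show "K = (L, A, h)" using k by simp
    qed
  qed
  then show "\<exists>L \<iota>. is_colimit J Sm Fo Fa L \<iota>" by blast
qed

end

section \<open>Exponentials of fibred smooth spaces\<close>

context plot_site
begin

text \<open>A point of \<open>P\<close> stands for a map between the fibres over its base point.  Substitution along
  all site maps, not only along restrictions, is what makes a plot of such maps a morphism out of
  the fibre product.\<close>

definition fibre_map_space ::
    "'b set \<Rightarrow> 'a plot_space \<Rightarrow> ('b \<Rightarrow> 'a) \<Rightarrow> ('b \<Rightarrow> 'a \<Rightarrow> 'a) \<Rightarrow> 'a plot_space \<Rightarrow> ('a \<Rightarrow> 'a) \<Rightarrow>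
     'a plot_space \<Rightarrow> 'b plot_space" where
  "fibre_map_space P B base ap Y y Z = \<lparr> points = P,
     plots = (\<lambda>n U. {\<phi> \<in> U \<rightarrow>\<^sub>E P. domain n U \<and> compose U base \<phi> \<in> plots B n U \<and>
       (\<forall>m U' f \<psi>. site_map m U' U f \<and> \<psi> \<in> plots Y m U' \<and> (\<forall>x\<in>U'. y (\<psi> x) = base (\<phi> (f x))) \<longrightarrow>
          (\<lambda>x\<in>U'. ap (\<phi> (f x)) (\<psi> x)) \<in> plots Z m U')}) \<rparr>"

lemma points_fibre_map_space [simp]: "points (fibre_map_space P B base ap Y y Z) = P"
  by (simp add: fibre_map_space_def)

lemma plots_fibre_map_space:
  "\<phi> \<in> plots (fibre_map_space P B base ap Y y Z) n U \<longleftrightarrow>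
   \<phi> \<in> U \<rightarrow>\<^sub>E P \<and> domain n U \<and> compose U base \<phi> \<in> plots B n U \<and>
   (\<forall>m U' f \<psi>. site_map m U' U f \<and> \<psi> \<in> plots Y m U' \<and> (\<forall>x\<in>U'. y (\<psi> x) = base (\<phi> (f x))) \<longrightarrow>
      (\<lambda>x\<in>U'. ap (\<phi> (f x)) (\<psi> x)) \<in> plots Z m U')"
  by (simp add: fibre_map_space_def)

text \<open>Stability under reparametrization holds because a smooth function can be appended to a
  site map. Gluing reduces to gluing in \<open>B\<close> and in \<open>Z\<close>. The hypothesis
  \<open>smooth\<close> states the test condition for constant families, which the third axiom
  requires.\<close>

lemma space_fibre_map_space:
  assumes B: "space B" and Y: "space Y" and Z: "space Z"
    and base: "base \<in> P \<rightarrow> points B"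
    and ap: "\<And>w t. w \<in> P \<Longrightarrow> t \<in> points Y \<Longrightarrow> y t = base w \<Longrightarrow> ap w t \<in> points Z"
    and smooth: "\<And>w n U \<psi>. w \<in> P \<Longrightarrow> \<psi> \<in> plots Y n U \<Longrightarrow> (\<And>x. x \<in> U \<Longrightarrow> y (\<psi> x) = base w) \<Longrightarrow>
      (\<lambda>x\<in>U. ap w (\<psi> x)) \<in> plots Z n U"
  shows "space (fibre_map_space P B base ap Y y Z)"
    (is "space ?G")
proof (rule is_plot_spaceI)
  fix n U m U' \<phi> f
  assume "\<phi> \<in> plots ?G n U" and U': "domain m U'" and f: "smooth_between m U' U f"
  then have \<phi>: "\<phi> \<in> U \<rightarrow>\<^sub>E P" "domain n U" "compose U base \<phi> \<in> plots B n U"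
    and sub: "\<And>m U' f \<psi>. site_map m U' U f \<Longrightarrow> \<psi> \<in> plots Y m U' \<Longrightarrow>
      (\<forall>x\<in>U'. y (\<psi> x) = base (\<phi> (f x))) \<Longrightarrow> (\<lambda>x\<in>U'. ap (\<phi> (f x)) (\<psi> x)) \<in> plots Z m U'"
    by (simp_all add: plots_fibre_map_space)
  have fU: "f \<in> U' \<rightarrow> U" using smooth_between_image[OF f] by auto
  have "compose U' base (compose U' \<phi> f) \<in> plots B m U'"
    using plot_smooth_compose[OF B \<phi>(3) U' f] unfolding compose_assoc[OF fU] .
  moreover have "compose U' \<phi> f \<in> U' \<rightarrow>\<^sub>E P"
    using \<phi> fU by (auto simp: compose_def PiE_iff)
  moreover have "(\<lambda>x\<in>U''. ap (compose U' \<phi> f (f' x)) (\<psi> x)) \<in> plots Z k U''"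
    if f': "site_map k U'' U' f'" and \<psi>: "\<psi> \<in> plots Y k U''"
      and eq: "\<forall>x\<in>U''. y (\<psi> x) = base (compose U' \<phi> f (f' x))" for k U'' f' \<psi>
  proof -
    have c: "compose U' \<phi> f (f' x) = \<phi> (f (f' x))" if "x \<in> U''" for x
      using site_map_image[OF f'] that by (auto simp: compose_def)
    have "(\<lambda>x\<in>U''. ap (\<phi> (f (f' x))) (\<psi> x)) \<in> plots Z k U''"
      using sub[OF site_map_compose[OF f' U' f] \<psi>] eq c by simp
    moreover have "(\<lambda>x\<in>U''. ap (\<phi> (f (f' x))) (\<psi> x)) = (\<lambda>x\<in>U''. ap (compose U' \<phi> f (f' x)) (\<psi> x))"
      using c by (intro restrict_ext) simp
    ultimately show ?thesis by simp
  qed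
  ultimately show "compose U' \<phi> f \<in> plots ?G m U'"
    using U' by (simp add: plots_fibre_map_space)
next
  fix n U \<phi>
  assume U: "domain n U" and \<phi>: "\<phi> \<in> U \<rightarrow>\<^sub>E points ?G"
    and loc: "\<And>x. x \<in> U \<Longrightarrow> \<exists>V. domain n V \<and> openin (top_of_set U) V \<and> x \<in> V \<and> restrict \<phi> V \<in> plots ?G n V"
  have \<phi>P: "\<phi> \<in> U \<rightarrow>\<^sub>E P" using \<phi> by simp
  have "compose U base \<phi> \<in> plots B n U"
  proof (rule plot_glue[OF B U compose_funcset[OF \<phi>P base]])
    fix x assume "x \<in> U"
    then obtain V where V: "domain n V" "openin (top_of_set U) V" "x \<in> V" "restrict \<phi> V \<in> plots ?G n V"
      using loc by blast
    have "compose V base (restrict \<phi> V) \<in> plots B n V"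
      using V(4) by (simp add: plots_fibre_map_space)
    then show "\<exists>V. domain n V \<and> openin (top_of_set U) V \<and> x \<in> V \<and> restrict (compose U base \<phi>) V \<in> plots B n V"
      using V restrict_compose[OF openin_imp_subset[OF V(2)], of base \<phi>] by (intro exI[of _ V]) simp
  qed
  moreover have "(\<lambda>x\<in>U'. ap (\<phi> (f x)) (\<psi> x)) \<in> plots Z m U'"
    if f: "site_map m U' U f" and \<psi>: "\<psi> \<in> plots Y m U'" and eq: "\<forall>x\<in>U'. y (\<psi> x) = base (\<phi> (f x))"
    for m U' f \<psi>
  proof (rule plot_glue[OF Z site_map_domain[OF f]])
    show "(\<lambda>x\<in>U'. ap (\<phi> (f x)) (\<psi> x)) \<in> U' \<rightarrow>\<^sub>E points Z"
    proof (rule restrict_PiE_iff[THEN iffD2], rule ballI)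
      fix x assume x: "x \<in> U'"
      show "ap (\<phi> (f x)) (\<psi> x) \<in> points Z"
      proof (rule ap)
        show "\<phi> (f x) \<in> P" using \<phi>P site_map_image[OF f] x by auto
        show "\<psi> x \<in> points Y" using plot_funcset[OF Y \<psi>] x by auto
        show "y (\<psi> x) = base (\<phi> (f x))" using eq x by simp
      qed
    qed
    fix x assume x: "x \<in> U'"
    then have "f x \<in> U" using site_map_image[OF f] by auto
    then obtain V where V: "domain n V" "openin (top_of_set U) V" "f x \<in> V" "restrict \<phi> V \<in> plots ?G n V"
      using loc by blast
    \<comment> \<open>The neighbourhood \<open>V\<close> lies in the domain of
      \<open>\<phi>\<close>, but gluing takes place over the domain \<open>U'\<close> of the test
      plot, so \<open>V\<close> is traced back along \<open>f\<close>.\<close>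
    obtain V' where V': "openin (top_of_set U') V'" "x \<in> V'" "site_map m V' V f"
      using site_map_restrict[OF f V(1,2) x V(3)] by blast
    have V'U: "V' \<subseteq> U'" using openin_imp_subset[OF V'(1)] .
    have fV: "f x \<in> V" if "x \<in> V'" for x using site_map_image[OF V'(3)] that by auto
    note dV = site_map_domain[OF V'(3)]
    have \<psi>V: "restrict \<psi> V' \<in> plots Y m V'" using plot_restrict[OF Y \<psi> dV V'U] .
    have "\<forall>x\<in>V'. y (restrict \<psi> V' x) = base (restrict \<phi> V (f x))"
      using eq V'U fV by auto
    then have "(\<lambda>x\<in>V'. ap (restrict \<phi> V (f x)) (restrict \<psi> V' x)) \<in> plots Z m V'"
      using V(4) V'(3) \<psi>V by (simp only: plots_fibre_map_space)
    moreover have "(\<lambda>x\<in>V'. ap (restrict \<phi> V (f x)) (restrict \<psi> V' x)) =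
        restrict (\<lambda>x\<in>U'. ap (\<phi> (f x)) (\<psi> x)) V'"
    proof
      fix x show "(\<lambda>x\<in>V'. ap (restrict \<phi> V (f x)) (restrict \<psi> V' x)) x =
          restrict (\<lambda>x\<in>U'. ap (\<phi> (f x)) (\<psi> x)) V' x"
        using V'U fV by (cases "x \<in> V'") auto
    qed
    ultimately show "\<exists>V. domain m V \<and> openin (top_of_set U') V \<and> x \<in> V \<and>
        restrict (\<lambda>x\<in>U'. ap (\<phi> (f x)) (\<psi> x)) V \<in> plots Z m V"
      using dV V'(1,2) by (intro exI[of _ V']) simp
  qed
  ultimately show "\<phi> \<in> plots ?G n U"
    using U \<phi>P by (simp add: plots_fibre_map_space)
next
  fix w assume "w \<in> points ?G"
  then have w: "w \<in> P" by simp
  have "compose (Rn 0) base (\<lambda>_\<in>Rn 0. w) = (\<lambda>_\<in>Rn 0. base w)"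
    by (auto simp: compose_def)
  then have "compose (Rn 0) base (\<lambda>_\<in>Rn 0. w) \<in> plots B 0 (Rn 0)"
    using plot_const[OF B _ domain_point, of "base w"] base w by auto
  moreover have "(\<lambda>x\<in>U'. ap ((\<lambda>_\<in>Rn 0. w) (f x)) (\<psi> x)) \<in> plots Z m U'"
    if f: "site_map m U' (Rn 0) f" and \<psi>: "\<psi> \<in> plots Y m U'"
      and eq: "\<forall>x\<in>U'. y (\<psi> x) = base ((\<lambda>_\<in>Rn 0. w) (f x))" for m U' f \<psi>
  proof -
    have c: "(\<lambda>_\<in>Rn 0. w) (f x) = w" if "x \<in> U'" for x
      using site_map_image[OF f] that by auto
    have "(\<lambda>x\<in>U'. ap ((\<lambda>_\<in>Rn 0. w) (f x)) (\<psi> x)) = (\<lambda>x\<in>U'. ap w (\<psi> x))"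
      using c by (intro restrict_ext) simp
    moreover have "y (\<psi> x) = base w" if "x \<in> U'" for x
      using eq c that by simp
    ultimately show ?thesis
      using smooth[OF w \<psi>] by simp
  qed
  ultimately show "(\<lambda>_\<in>Rn 0. w) \<in> plots ?G 0 (Rn 0)"
    using w domain_point by (simp add: plots_fibre_map_space)
qed (simp_all add: plots_fibre_map_space)

end

section \<open>Fibre products of spaces\<close>

context smooth_site
begin

text \<open>A fibre product described by points and plots instead of arrows: besides the bijection
  with matching pairs, plots are detected by the projections. The functions \<open>a\<close> and
  \<open>y\<close> enter only through the equation that they impose on points.\<close>

definition is_pullback_space where
  "is_pullback_space A a Y y P p q \<longleftrightarrow>
     P \<in> Ob Sm \<and> smooth_map P A p \<and> smooth_map P Y q \<and> (\<forall>w\<in>points P. a (p w) = y (q w)) \<and>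
     (\<forall>s\<in>points A. \<forall>t\<in>points Y. a s = y t \<longrightarrow> (\<exists>!w. w \<in> points P \<and> p w = s \<and> q w = t)) \<and>
     (\<forall>n U. \<forall>\<phi>\<in>U \<rightarrow>\<^sub>E points P.
        compose U p \<phi> \<in> plots A n U \<and> compose U q \<phi> \<in> plots Y n U \<longrightarrow> \<phi> \<in> plots P n U)"

lemma pullback_space_ex:
  assumes A: "A \<in> Ob Sm" and Y: "Y \<in> Ob Sm"
  shows "\<exists>P p q. is_pullback_space A a Y y P p q"
proof -
  define S where "S = {(s, t). s \<in> points A \<and> t \<in> points Y \<and> a s = y t}"
  have "small' (points A \<times> points Y)"
    using small_Sigma[OF Ob_small[OF A] Ob_small[OF Y]] .
  then have S: "small' S"
    by (rule small_subset) (auto simp: S_def)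
  then obtain e :: "'u \<times> 'u \<Rightarrow> 'u" where e: "inj_on e S"
    by (rule small_code)
  \<comment> \<open>Truth values index the two projections, so that they form one family for
    \<open>initial_space\<close>; this structure makes them detect plots.\<close>
  define \<pi> where "\<pi> = (\<lambda>b w. if b then fst (inv_into S e w) else snd (inv_into S e w))"
  define X where "X = (\<lambda>b. if b then A else Y)"
  define P where "P = initial_space (e ` S) UNIV X \<pi>"
  have dec: "\<pi> True (e x) = fst x" "\<pi> False (e x) = snd x" if "x \<in> S" for x
    using that e by (simp_all add: \<pi>_def)
  have \<pi>: "\<pi> b \<in> e ` S \<rightarrow> points (X b)" for b
    using dec by (cases b) (auto simp: S_def X_def)
  have pts: "points P = e ` S" by (simp add: P_def)
  have X: "space (X b)" for b using A Y Ob_space by (simp add: X_def)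
  have "space P"
    unfolding P_def using X \<pi> by (rule space_initial_space)
  then have P: "P \<in> Ob Sm"
    using small_image[OF S] by (simp add: Ob_Sm pts)
  define p where "p = restrict (\<pi> True) (e ` S)"
  define q where "q = restrict (\<pi> False) (e ` S)"
  have "is_pullback_space A a Y y P p q"
    unfolding is_pullback_space_def
  proof (intro conjI ballI allI impI)
    show "smooth_map P A p" "smooth_map P Y q"
      using smooth_map_initial_space[where \<pi> = \<pi> and P = "e ` S" and X = X, OF UNIV_I \<pi>[of True]]
        smooth_map_initial_space[where \<pi> = \<pi> and P = "e ` S" and X = X, OF UNIV_I \<pi>[of False]]
      by (simp_all add: P_def p_def q_def X_def)
    show "a (p w) = y (q w)" if "w \<in> points P" for w
      using that dec by (auto simp: pts p_def q_def S_def)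
    show "\<exists>!w. w \<in> points P \<and> p w = s \<and> q w = t" if "s \<in> points A" "t \<in> points Y" "a s = y t" for s t
    proof -
      have st: "(s, t) \<in> S" using that by (simp add: S_def)
      show ?thesis
      proof (rule ex1I[of _ "e (s, t)"])
        show "e (s, t) \<in> points P \<and> p (e (s, t)) = s \<and> q (e (s, t)) = t"
          using st dec by (simp add: pts p_def q_def)
        fix w assume w: "w \<in> points P \<and> p w = s \<and> q w = t"
        then obtain x where x: "x \<in> S" "w = e x" by (auto simp: pts)
        then have "x = (s, t)"
          using w dec[OF x(1)] by (intro prod_eqI) (simp_all add: p_def q_def)
        then show "w = e (s, t)" using x by simp
      qed
    qed
    fix n U \<phi>
    assume \<phi>: "\<phi> \<in> U \<rightarrow>\<^sub>E points P" and pl: "compose U p \<phi> \<in> plots A n U \<and> compose U q \<phi> \<in> plots Y n U"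
    have "compose U (\<pi> True) \<phi> = compose U p \<phi>" "compose U (\<pi> False) \<phi> = compose U q \<phi>"
      using \<phi> by (auto simp: compose_def p_def q_def pts PiE_iff)
    then have "\<forall>b\<in>UNIV. compose U (\<pi> b) \<phi> \<in> plots (X b) n U"
      using pl by (auto simp: X_def split: if_splits)
    moreover have "domain n U"
      using plot_domain[OF Ob_space[OF A]] pl by blast
    ultimately show "\<phi> \<in> plots P n U"
      using \<phi> by (simp add: P_def plots_initial_space)
  qed (fact P)
  then show ?thesis by blast
qed

context
  fixes A Y P :: "'u plot_space" and a y p q
  assumes A: "A \<in> Ob Sm" and Y: "Y \<in> Ob Sm" and PB: "is_pullback_space A a Y y P p q"
begin

lemma pullback_space_Ob: "P \<in> Ob Sm"
  and pullback_space_fst: "smooth_map P A p"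
  and pullback_space_snd: "smooth_map P Y q"
  and pullback_space_square: "w \<in> points P \<Longrightarrow> a (p w) = y (q w)"
  using PB by (simp_all add: is_pullback_space_def)

lemma pullback_space_pair:
  "s \<in> points A \<Longrightarrow> t \<in> points Y \<Longrightarrow> a s = y t \<Longrightarrow> \<exists>!w. w \<in> points P \<and> p w = s \<and> q w = t"
  using PB by (simp add: is_pullback_space_def)

lemma pullback_space_plotI:
  "\<phi> \<in> U \<rightarrow>\<^sub>E points P \<Longrightarrow> compose U p \<phi> \<in> plots A n U \<Longrightarrow> compose U q \<phi> \<in> plots Y n U \<Longrightarrow>
   \<phi> \<in> plots P n U"
  using PB by (simp add: is_pullback_space_def)

lemma pullback_space_eqI:
  assumes "w \<in> points P" "w' \<in> points P" "p w = p w'" "q w = q w'"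
  shows "w = w'"
proof -
  have "p w \<in> points A" "q w \<in> points Y"
    using smooth_map_funcset[OF pullback_space_fst] smooth_map_funcset[OF pullback_space_snd] assms(1)
    by auto
  then have "\<exists>!v. v \<in> points P \<and> p v = p w \<and> q v = q w"
    using pullback_space_square[OF assms(1)] by (rule pullback_space_pair)
  then show ?thesis
    using assms by (elim ex1E) metis
qed

text \<open>Stated for an arbitrary set \<open>D\<close>, so that it serves for plots, where
  \<open>D\<close> is a domain, as well as for maps out of a space.\<close>

lemma pullback_space_lift:
  assumes f: "f \<in> D \<rightarrow>\<^sub>E points A" and g: "g \<in> D \<rightarrow>\<^sub>E points Y" and eq: "\<And>d. d \<in> D \<Longrightarrow> a (f d) = y (g d)"
  obtains h where "h \<in> D \<rightarrow>\<^sub>E points P" "compose D p h = f" "compose D q h = g"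
proof -
  have "\<forall>d\<in>D. \<exists>w. w \<in> points P \<and> p w = f d \<and> q w = g d"
  proof
    fix d assume d: "d \<in> D"
    have "f d \<in> points A" "g d \<in> points Y" using f g d by auto
    from ex1_implies_ex[OF pullback_space_pair[OF this eq[OF d]]]
    show "\<exists>w. w \<in> points P \<and> p w = f d \<and> q w = g d" .
  qed
  from bchoice[OF this] obtain k where k: "\<forall>d\<in>D. k d \<in> points P \<and> p (k d) = f d \<and> q (k d) = g d" ..
  show thesis
  proof (rule that[of "restrict k D"])
    show "restrict k D \<in> D \<rightarrow>\<^sub>E points P" using k by auto
    show "compose D p (restrict k D) = f" "compose D q (restrict k D) = g"
      using k f g by (auto simp: compose_def fun_eq_iff PiE_iff extensional_def)
  qed
qed

lemma pullback_space_plot: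
  assumes "\<phi> \<in> plots A n U" "\<psi> \<in> plots Y n U" "\<And>x. x \<in> U \<Longrightarrow> a (\<phi> x) = y (\<psi> x)"
  obtains \<xi> where "\<xi> \<in> plots P n U" "compose U p \<xi> = \<phi>" "compose U q \<xi> = \<psi>"
proof -
  obtain \<xi> where \<xi>: "\<xi> \<in> U \<rightarrow>\<^sub>E points P" "compose U p \<xi> = \<phi>" "compose U q \<xi> = \<psi>"
    by (rule pullback_space_lift[OF plot_funcset[OF Ob_space[OF A] assms(1)]
          plot_funcset[OF Ob_space[OF Y] assms(2)] assms(3)])
  then show thesis
    using that[of \<xi>] pullback_space_plotI[OF \<xi>(1)] assms(1,2) by simp
qed

lemma pullback_space_map:
  assumes X: "space X" and f: "smooth_map X A f" and g: "smooth_map X Y g"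
    and eq: "\<And>s. s \<in> points X \<Longrightarrow> a (f s) = y (g s)"
  obtains h where "smooth_map X P h" "compose (points X) p h = f" "compose (points X) q h = g"
proof -
  obtain h where h: "h \<in> points X \<rightarrow>\<^sub>E points P" "compose (points X) p h = f" "compose (points X) q h = g"
    by (rule pullback_space_lift[OF smooth_map_funcset[OF f] smooth_map_funcset[OF g] eq])
  have "smooth_map X P h"
    unfolding smooth_map_def
  proof (intro conjI allI ballI)
    fix n U \<phi> assume \<phi>: "\<phi> \<in> plots X n U"
    have f\<phi>: "\<phi> \<in> U \<rightarrow>\<^sub>E points X" using plot_funcset[OF X \<phi>] .
    then have \<phi>': "\<phi> \<in> U \<rightarrow> points X" by auto
    show "compose U h \<phi> \<in> plots P n U"
    proof (rule pullback_space_plotI)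
      show "compose U h \<phi> \<in> U \<rightarrow>\<^sub>E points P"
        using f\<phi> h(1) by (intro compose_funcset) auto
      show "compose U p (compose U h \<phi>) \<in> plots A n U" "compose U q (compose U h \<phi>) \<in> plots Y n U"
        using smooth_map_plot[OF f \<phi>] smooth_map_plot[OF g \<phi>] unfolding compose_assoc[OF \<phi>'] h(2,3) .
    qed
  qed (fact h(1))
  then show thesis using that h by blast
qed

end

text \<open>The universal property compares a point \<open>w\<close> of \<open>P A a\<close> with
  the point \<open>w'\<close> of \<open>P G g\<close> above it, rather than using the map of fibre
  products induced by \<open>k\<close>. In this form it is a statement about points, and the induced
  map is built only in the passage to the slice.\<close>

lemma fibre_exponential:
  assumes B: "B \<in> Ob Sm" and Y: "Y \<in> Ob Sm" and Z: "Z \<in> Ob Sm"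
    and y: "smooth_map Y B y" and z: "smooth_map Z B z"
    and pullbacks: "\<forall>A\<in>Ob Sm. \<forall>a. is_pullback_space A a Y y (P A a) (p A a) (q A a)"
  shows "\<exists>G g \<epsilon>. G \<in> Ob Sm \<and> smooth_map G B g \<and> smooth_map (P G g) Z \<epsilon> \<and>
    (\<forall>w\<in>points (P G g). z (\<epsilon> w) = g (p G g w)) \<and>
    (\<forall>A a h. A \<in> Ob Sm \<and> smooth_map A B a \<and> smooth_map (P A a) Z h \<and>
       (\<forall>w\<in>points (P A a). z (h w) = a (p A a w)) \<longrightarrow>
       (\<exists>!k. smooth_map A G k \<and> (\<forall>s\<in>points A. g (k s) = a s) \<and>
          (\<forall>w\<in>points (P A a). \<forall>w'\<in>points (P G g).
             p G g w' = k (p A a w) \<and> q G g w' = q A a w \<longrightarrow> \<epsilon> w' = h w)))"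
proof -
  have PB: "is_pullback_space A a Y y (P A a) (p A a) (q A a)" if "A \<in> Ob Sm" for A a
    using pullbacks that by simp
  define fib where "fib = (\<lambda>\<beta>. {t \<in> points Y. y t = \<beta>})"
  \<comment> \<open>The base point is stored beside the map because it cannot be recovered from the
    map when the fibre is empty: all empty fibres have the same extensional function.\<close>
  define S where "S = {(\<beta>, f). \<beta> \<in> points B \<and> f \<in> fib \<beta> \<rightarrow>\<^sub>E points Z \<and> (\<forall>t\<in>fib \<beta>. z (f t) = \<beta>) \<and>
    (\<forall>n U. \<forall>\<psi>\<in>plots Y n U. (\<forall>x\<in>U. y (\<psi> x) = \<beta>) \<longrightarrow> (\<lambda>x\<in>U. f (\<psi> x)) \<in> plots Z n U)}"
  have "small' (Sigma (points B) (\<lambda>\<beta>. fib \<beta> \<rightarrow>\<^sub>E points Z))"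
  proof (intro small_Sigma small_PiE Ob_small B Z)
    show "small' (fib \<beta>)" for \<beta>
      by (rule small_subset[OF Ob_small[OF Y]]) (auto simp: fib_def)
  qed
  then have smallS: "small' S"
    by (rule small_subset) (auto simp: S_def)
  then obtain e :: "'u \<times> ('u \<Rightarrow> 'u) \<Rightarrow> 'u" where e: "inj_on e S"
    by (rule small_code)
  define base where "base = (\<lambda>w. fst (inv_into S e w))"
  define ap where "ap = (\<lambda>w. snd (inv_into S e w))"
  define G where "G = fibre_map_space (e ` S) B base ap Y y Z"
  define g where "g = restrict base (e ` S)"
  have dec: "base (e (\<beta>, f)) = \<beta>" "ap (e (\<beta>, f)) = f" if "(\<beta>, f) \<in> S" for \<beta> f
    using that e by (simp_all add: base_def ap_def)
  have pts: "points G = e ` S" by (simp add: G_def)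
  have base: "base \<in> e ` S \<rightarrow> points B"
    using dec by (auto simp: S_def)
  have ap_in: "ap w t \<in> points Z" and ap_over: "z (ap w t) = base w"
    if w: "w \<in> e ` S" and t: "t \<in> points Y" "y t = base w" for w t
  proof -
    obtain \<beta> f where f: "(\<beta>, f) \<in> S" "w = e (\<beta>, f)" using w by auto
    have "t \<in> fib \<beta>" using t f dec by (simp add: fib_def)
    then show "ap w t \<in> points Z" "z (ap w t) = base w"
      using f dec[OF f(1)] by (auto simp: S_def)
  qed
  have ap_smooth: "(\<lambda>x\<in>U. ap w (\<psi> x)) \<in> plots Z n U"
    if w: "w \<in> e ` S" and \<psi>: "\<psi> \<in> plots Y n U" and eq: "\<And>x. x \<in> U \<Longrightarrow> y (\<psi> x) = base w" for w n U \<psi>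
  proof -
    obtain \<beta> f where f: "(\<beta>, f) \<in> S" "w = e (\<beta>, f)" using w by auto
    have "\<forall>x\<in>U. y (\<psi> x) = \<beta>" using eq f(2) dec[OF f(1)] by simp
    then show ?thesis
      using f(1) \<psi> by (simp add: f(2) dec[OF f(1)]) (simp add: S_def)
  qed
  have "space G"
    unfolding G_def using Ob_space[OF B] Ob_space[OF Y] Ob_space[OF Z] base ap_in ap_smooth
    by (rule space_fibre_map_space)
  then have GO: "G \<in> Ob Sm"
    using small_image[OF smallS] by (simp add: Ob_Sm pts)
  have G_plot: "\<phi> \<in> plots G n U \<longleftrightarrow> \<phi> \<in> U \<rightarrow>\<^sub>E e ` S \<and> domain n U \<and> compose U base \<phi> \<in> plots B n U \<and>
     (\<forall>m U' f \<psi>. site_map m U' U f \<and> \<psi> \<in> plots Y m U' \<and> (\<forall>x\<in>U'. y (\<psi> x) = base (\<phi> (f x))) \<longrightarrow>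
      (\<lambda>x\<in>U'. ap (\<phi> (f x)) (\<psi> x)) \<in> plots Z m U')" for \<phi> n U
    unfolding G_def by (rule plots_fibre_map_space)
  have g: "smooth_map G B g"
    unfolding smooth_map_def
  proof (intro conjI allI ballI)
    show "g \<in> points G \<rightarrow>\<^sub>E points B" using base by (auto simp: g_def pts)
    fix n U \<phi> assume "\<phi> \<in> plots G n U"
    then have \<phi>: "\<phi> \<in> U \<rightarrow>\<^sub>E e ` S" "compose U base \<phi> \<in> plots B n U" by (simp_all add: G_plot)
    have "compose U g \<phi> = compose U base \<phi>"
      using \<phi>(1) by (auto simp: compose_def g_def PiE_iff)
    then show "compose U g \<phi> \<in> plots B n U" using \<phi>(2) by simp
  qed
  note PG = GO Y PB[OF GO, of g]
  define \<epsilon> where "\<epsilon> = (\<lambda>w\<in>points (P G g). ap (p G g w) (q G g w))"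
  have pq: "p G g w \<in> e ` S" "q G g w \<in> points Y" "y (q G g w) = base (p G g w)" "g (p G g w) = base (p G g w)"
    if w: "w \<in> points (P G g)" for w
  proof -
    show 1: "p G g w \<in> e ` S" and "q G g w \<in> points Y"
      using smooth_map_funcset[OF pullback_space_fst[OF PG]]
        smooth_map_funcset[OF pullback_space_snd[OF PG]] w by (auto simp: pts)
    show "g (p G g w) = base (p G g w)" using 1 by (simp add: g_def)
    then show "y (q G g w) = base (p G g w)" using pullback_space_square[OF PG w] by simp
  qed
  have \<epsilon>: "smooth_map (P G g) Z \<epsilon>"
    unfolding smooth_map_def
  proof (intro conjI allI ballI)
    show "\<epsilon> \<in> points (P G g) \<rightarrow>\<^sub>E points Z" using ap_in pq by (auto simp: \<epsilon>_def)
    fix n U \<xi> assume \<xi>: "\<xi> \<in> plots (P G g) n U"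
    have \<xi>P: "\<xi> \<in> U \<rightarrow>\<^sub>E points (P G g)"
      using plot_funcset[OF Ob_space[OF pullback_space_Ob[OF PG]] \<xi>] .
    have in_P: "\<xi> x \<in> points (P G g)" if "x \<in> U" for x using \<xi>P that by auto
    have 1: "compose U (p G g) \<xi> \<in> plots G n U" using smooth_map_plot[OF pullback_space_fst[OF PG] \<xi>] .
    have 2: "compose U (q G g) \<xi> \<in> plots Y n U" using smooth_map_plot[OF pullback_space_snd[OF PG] \<xi>] .
    have 3: "\<forall>x\<in>U. y (compose U (q G g) \<xi> x) = base (compose U (p G g) \<xi> x)"
      using pq(3)[OF in_P] by (simp add: compose_def)
    \<comment> \<open>Smoothness of evaluation is the test condition for plots of \<open>G\<close>,
      taken at the identity.\<close>
    have "site_map n U U (\<lambda>x. x)"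
      using site_map_ident plot_domain[OF Ob_space[OF Y] 2] by blast
    then have "(\<lambda>x\<in>U. ap (compose U (p G g) \<xi> x) (compose U (q G g) \<xi> x)) \<in> plots Z n U"
      using 1[unfolded G_plot] 2 3 by simp
    moreover have "compose U \<epsilon> \<xi> = (\<lambda>x\<in>U. ap (compose U (p G g) \<xi> x) (compose U (q G g) \<xi> x))"
      using in_P by (auto simp: compose_def \<epsilon>_def)
    ultimately show "compose U \<epsilon> \<xi> \<in> plots Z n U" by simp
  qed
  have \<epsilon>_over: "\<forall>w\<in>points (P G g). z (\<epsilon> w) = g (p G g w)"
    using ap_over pq by (simp add: \<epsilon>_def)
  have univ: "\<exists>!k. smooth_map A G k \<and> (\<forall>s\<in>points A. g (k s) = a s) \<and>
      (\<forall>w\<in>points (P A a). \<forall>w'\<in>points (P G g).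
         p G g w' = k (p A a w) \<and> q G g w' = q A a w \<longrightarrow> \<epsilon> w' = h w)"
    if A: "A \<in> Ob Sm" and a: "smooth_map A B a" and h: "smooth_map (P A a) Z h"
      and over: "\<forall>w\<in>points (P A a). z (h w) = a (p A a w)" for A a h
  proof -
    note PA = A Y PB[OF A, of a]
    \<comment> \<open>This is \<open>h\<close> as a function of two variables. On matching pairs
      \<open>pullback_space_pair\<close> makes the description unique; elsewhere the value is
      unspecified.\<close>
    define h' where "h' = (\<lambda>s t. h (THE w. w \<in> points (P A a) \<and> p A a w = s \<and> q A a w = t))"
    have h'_pq: "h' (p A a w) (q A a w) = h w" if w: "w \<in> points (P A a)" for w
    proof -
      have "(THE w'. w' \<in> points (P A a) \<and> p A a w' = p A a w \<and> q A a w' = q A a w) = w"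
        by (rule the_equality) (use w pullback_space_eqI[OF PA] in auto)
      then show ?thesis by (simp add: h'_def)
    qed
    have pair: "\<exists>w\<in>points (P A a). p A a w = s \<and> q A a w = t"
      if "s \<in> points A" "t \<in> points Y" "a s = y t" for s t
      using ex1_implies_ex[OF pullback_space_pair[OF PA that]] by blast
    define k where "k = (\<lambda>s\<in>points A. e (a s, \<lambda>t\<in>fib (a s). h' s t))"
    have aB: "a s \<in> points B" if "s \<in> points A" for s
      using smooth_map_funcset[OF a] that by auto
    \<comment> \<open>Joint smoothness in both variables. It is applied with a constant first
      argument, to show that \<open>k\<close> takes values in fibre maps, and with a reparametrized
      plot of \<open>A\<close>, to show that \<open>k\<close> is smooth.\<close>
    have h'_plot: "(\<lambda>x\<in>U. h' (\<alpha> x) (\<psi> x)) \<in> plots Z n U"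
      if \<alpha>: "\<alpha> \<in> plots A n U" and \<psi>: "\<psi> \<in> plots Y n U" and eq: "\<And>x. x \<in> U \<Longrightarrow> a (\<alpha> x) = y (\<psi> x)"
      for \<alpha> \<psi> n U
    proof -
      obtain \<xi> where \<xi>: "\<xi> \<in> plots (P A a) n U" "compose U (p A a) \<xi> = \<alpha>" "compose U (q A a) \<xi> = \<psi>"
        by (rule pullback_space_plot[OF PA \<alpha> \<psi> eq])
      have "\<xi> x \<in> points (P A a)" if "x \<in> U" for x
        using plot_funcset[OF Ob_space[OF pullback_space_Ob[OF PA]] \<xi>(1)] that by auto
      then have "(\<lambda>x\<in>U. h' (\<alpha> x) (\<psi> x)) = compose U h \<xi>"
        unfolding \<xi>(2,3)[symmetric] using h'_pq by (auto simp: compose_def)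
      then show ?thesis
        using smooth_map_plot[OF h \<xi>(1)] by simp
    qed
    have kS: "(a s, \<lambda>t\<in>fib (a s). h' s t) \<in> S" if s: "s \<in> points A" for s
    proof -
      have hz: "h' s t \<in> points Z" "z (h' s t) = a s" if "t \<in> fib (a s)" for t
      proof -
        obtain w where w: "w \<in> points (P A a)" "p A a w = s" "q A a w = t"
          using pair[OF s, of t] \<open>t \<in> fib (a s)\<close> by (auto simp: fib_def)
        then have "h' s t = h w" using h'_pq by blast
        then show "h' s t \<in> points Z" "z (h' s t) = a s"
          using smooth_map_funcset[OF h] w over by auto
      qed
      have "(\<lambda>x\<in>U. (\<lambda>t\<in>fib (a s). h' s t) (\<psi> x)) \<in> plots Z n U"
        if \<psi>: "\<psi> \<in> plots Y n U" and eq: "\<forall>x\<in>U. y (\<psi> x) = a s" for n U \<psi>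
      proof -
        \<comment> \<open>Freezing \<open>s\<close> as a constant plot turns joint smoothness into
          smoothness on the single fibre over \<open>a s\<close>.\<close>
        have "(\<lambda>_\<in>U. s) \<in> plots A n U"
          using plot_const[OF Ob_space[OF A] s] plot_domain[OF Ob_space[OF Y] \<psi>] by blast
        then have "(\<lambda>x\<in>U. h' ((\<lambda>_\<in>U. s) x) (\<psi> x)) \<in> plots Z n U"
          by (rule h'_plot) (use \<psi> eq in auto)
        moreover have "(\<lambda>x\<in>U. (\<lambda>t\<in>fib (a s). h' s t) (\<psi> x)) = (\<lambda>x\<in>U. h' ((\<lambda>_\<in>U. s) x) (\<psi> x))"
          using eq plot_funcset[OF Ob_space[OF Y] \<psi>] by (intro restrict_ext) (auto simp: fib_def)
        ultimately show ?thesis by simp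
      qed
      then show ?thesis
        using aB[OF s] hz by (simp add: S_def)
    qed
    have k_eq: "base (k s) = a s" "g (k s) = a s" "k s \<in> e ` S" if s: "s \<in> points A" for s
      using dec[OF kS[OF s]] kS[OF s] s by (simp_all add: k_def g_def)
    have k_ap: "ap (k s) t = h' s t" if "s \<in> points A" "t \<in> fib (a s)" for s t
      using dec[OF kS[OF that(1)]] that by (simp add: k_def)
    have k: "smooth_map A G k"
      unfolding smooth_map_def
    proof (intro conjI allI ballI)
      show kG: "k \<in> points A \<rightarrow>\<^sub>E points G" using k_eq(3) by (auto simp: k_def pts)
      fix n U \<alpha> assume \<alpha>: "\<alpha> \<in> plots A n U"
      have \<alpha>A: "\<alpha> \<in> U \<rightarrow>\<^sub>E points A" using plot_funcset[OF Ob_space[OF A] \<alpha>] .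
      have "compose U base (compose U k \<alpha>) = compose U a \<alpha>"
        using \<alpha>A k_eq(1) by (auto simp: compose_def PiE_iff)
      then have "compose U base (compose U k \<alpha>) \<in> plots B n U"
        using smooth_map_plot[OF a \<alpha>] by simp
      moreover have "compose U k \<alpha> \<in> U \<rightarrow>\<^sub>E e ` S"
        using \<alpha>A kG pts by (intro compose_funcset[of _ _ "points A"]) auto
      moreover have "domain n U" using plot_domain[OF Ob_space[OF A] \<alpha>] .
      moreover have "(\<lambda>x\<in>U'. ap (compose U k \<alpha> (f x)) (\<psi> x)) \<in> plots Z m U'"
        if f: "site_map m U' U f" and \<psi>: "\<psi> \<in> plots Y m U'"
          and eq: "\<forall>x\<in>U'. y (\<psi> x) = base (compose U k \<alpha> (f x))" for m U' f \<psi>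
      proof -
        have fx: "f x \<in> U" "\<alpha> (f x) \<in> points A" "\<psi> x \<in> points Y" if "x \<in> U'" for x
          using site_map_image[OF f] \<alpha>A plot_funcset[OF Ob_space[OF Y] \<psi>] that by auto
        have y\<psi>: "a (\<alpha> (f x)) = y (\<psi> x)" if "x \<in> U'" for x
          using eq that fx[OF that] k_eq(1) by (simp add: compose_def)
        \<comment> \<open>\<open>\<alpha>\<close> lives over \<open>U\<close> and
          \<open>\<psi>\<close> over \<open>U'\<close>; pulling \<open>\<alpha>\<close> back along
          the site map \<open>f\<close> makes the two plots a matching pair over one domain.\<close>
        have "(\<lambda>x\<in>U'. h' (compose U' \<alpha> f x) (\<psi> x)) \<in> plots Z m U'"
          by (rule h'_plot[OF plot_site_map_compose[OF f Ob_space[OF A] \<alpha>] \<psi>])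
             (simp add: compose_def y\<psi>)
        moreover have "(\<lambda>x\<in>U'. ap (compose U k \<alpha> (f x)) (\<psi> x)) = (\<lambda>x\<in>U'. h' (compose U' \<alpha> f x) (\<psi> x))"
          using fx y\<psi> k_ap by (intro restrict_ext) (simp add: compose_def fib_def)
        ultimately show ?thesis by simp
      qed
      ultimately show "compose U k \<alpha> \<in> plots G n U" by (simp add: G_plot)
    qed
    have p_in: "p A a w \<in> points A" "q A a w \<in> fib (a (p A a w))" if w: "w \<in> points (P A a)" for w
      using smooth_map_funcset[OF pullback_space_fst[OF PA]]
        smooth_map_funcset[OF pullback_space_snd[OF PA]] pullback_space_square[OF PA w] w
      by (auto simp: fib_def)
    show ?thesis
    proof (rule ex1I[of _ k])
      have "\<epsilon> w' = h w" if w: "w \<in> points (P A a)" and w': "w' \<in> points (P G g)"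
        and eq: "p G g w' = k (p A a w)" "q G g w' = q A a w" for w w'
        using w' eq k_ap[OF p_in[OF w]] h'_pq[OF w] by (simp add: \<epsilon>_def)
      then show "smooth_map A G k \<and> (\<forall>s\<in>points A. g (k s) = a s) \<and>
         (\<forall>w\<in>points (P A a). \<forall>w'\<in>points (P G g).
           p G g w' = k (p A a w) \<and> q G g w' = q A a w \<longrightarrow> \<epsilon> w' = h w)"
        using k k_eq(2) by simp
    next
      fix k' assume "smooth_map A G k' \<and> (\<forall>s\<in>points A. g (k' s) = a s) \<and>
         (\<forall>w\<in>points (P A a). \<forall>w'\<in>points (P G g).
           p G g w' = k' (p A a w) \<and> q G g w' = q A a w \<longrightarrow> \<epsilon> w' = h w)"
      then have k': "smooth_map A G k'" and gk': "\<And>s. s \<in> points A \<Longrightarrow> g (k' s) = a s"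
        and \<epsilon>k': "\<And>w w'. w \<in> points (P A a) \<Longrightarrow> w' \<in> points (P G g) \<Longrightarrow>
           p G g w' = k' (p A a w) \<Longrightarrow> q G g w' = q A a w \<Longrightarrow> \<epsilon> w' = h w"
        by simp_all
      show "k' = k"
      proof (rule smooth_map_eqI[OF k' k])
        fix s assume s: "s \<in> points A"
        \<comment> \<open>The components of \<open>k' s\<close> are both forced: \<open>g\<close>
          reads off the base point, and for each \<open>t\<close> in the fibre
          \<open>\<epsilon>\<close> reads off the value at \<open>t\<close>, at the point of
          \<open>P G g\<close> over \<open>k' s\<close> and \<open>t\<close>.\<close>
        have k's: "k' s \<in> points G" using smooth_map_funcset[OF k'] s by auto
        then obtain \<beta> f where f: "(\<beta>, f) \<in> S" "k' s = e (\<beta>, f)" by (auto simp: pts)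
        have "\<beta> = a s"
          using gk'[OF s] f dec[OF f(1)] by (simp add: g_def)
        have "f t = h' s t" if t: "t \<in> fib (a s)" for t
        proof -
          have tY: "t \<in> points Y" "y t = a s" using t by (auto simp: fib_def)
          obtain w where w: "w \<in> points (P A a)" "p A a w = s" "q A a w = t"
            using pair[OF s tY(1)] tY(2) by auto
          have "\<exists>!w'. w' \<in> points (P G g) \<and> p G g w' = k' s \<and> q G g w' = t"
            using pullback_space_pair[OF PG k's tY(1)] gk'[OF s] tY(2) by simp
          then obtain w' where w': "w' \<in> points (P G g)" "p G g w' = k' s" "q G g w' = t" by auto
          have "h' s t = h w" using h'_pq[OF w(1)] w by simp
          also have "\<dots> = \<epsilon> w'" using \<epsilon>k'[OF w(1) w'(1)] w w' by simp
          also have "\<dots> = f t" using w' f(2) dec[OF f(1)] by (simp add: \<epsilon>_def)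
          finally show ?thesis ..
        qed
        moreover have "f \<in> extensional (fib (a s))"
          using f(1) \<open>\<beta> = a s\<close> by (auto simp: S_def PiE_def)
        ultimately have "f = (\<lambda>t\<in>fib (a s). h' s t)"
          by (auto simp: fun_eq_iff extensional_def)
        then show "k' s = k s"
          using s f(2) \<open>\<beta> = a s\<close> by (simp add: k_def)
      qed
    qed
  qed
  show ?thesis
    by (rule exI[of _ G], rule exI[of _ g], rule exI[of _ \<epsilon>]) (intro conjI allI impI GO g \<epsilon> \<epsilon>_over, elim conjE, rule univ, assumption+)
qed

end

section \<open>Slices of the category of smooth spaces\<close>

lemma slice_simps:
  "Dom (slice C B) (p, q, f) = p" "Cod (slice C B) (p, q, f) = q"
  "Ident (slice C B) p = (p, p, Ident C (Dom C p))"
  "(q', r, g) \<odot>\<^bsub>slice C B\<^esub> (p, q, f) = (p, r, g \<odot>\<^bsub>C\<^esub> f)"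
  by (simp_all add: slice_def)

lemma Ob_slice_iff: "p \<in> Ob (slice C B) \<longleftrightarrow> p \<in> Ar C \<and> Cod C p = B"
  by (simp add: slice_def)

lemma Ar_slice_iff: "(p, q, f) \<in> Ar (slice C B) \<longleftrightarrow> p \<in> Ob (slice C B) \<and> q \<in> Ob (slice C B) \<and>
    f \<in> Hom C (Dom C p) (Dom C q) \<and> q \<odot>\<^bsub>C\<^esub> f = p"
  by (auto simp: slice_def)

lemma Hom_slice_iff: "(p', q', f) \<in> Hom (slice C B) p q \<longleftrightarrow> p' = p \<and> q' = q \<and>
    p \<in> Ob (slice C B) \<and> q \<in> Ob (slice C B) \<and> f \<in> Hom C (Dom C p) (Dom C q) \<and> q \<odot>\<^bsub>C\<^esub> f = p"
  unfolding Hom_def[of "slice C B"] mem_Collect_eq Ar_slice_iff slice_simps by auto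

lemma category_slice:
  fixes C :: "('o, 'm) category" (structure)
  assumes "category C"
  shows "category (slice C B)"
proof -
  interpret category C by fact
  have ob: "p \<in> Hom C (Dom C p) B" if "p \<in> Ob (slice C B)" for p
    using that by (simp add: Ob_slice_iff Hom_def)
  show ?thesis
  proof
    fix F assume "F \<in> Ar (slice C B)"
    then show "Dom (slice C B) F \<in> Ob (slice C B)" "Cod (slice C B) F \<in> Ob (slice C B)"
      by (cases F; simp add: Ar_slice_iff slice_simps)+
  next
    fix p assume p: "p \<in> Ob (slice C B)"
    show "Ident (slice C B) p \<in> Hom (slice C B) p p"
      using p Ident_in[OF Hom_Ob(1)[OF ob[OF p]]] Ident_right[OF ob[OF p]]
      by (simp add: slice_simps Hom_slice_iff)
  next
    fix F G p q r assume F: "F \<in> Hom (slice C B) p q" and G: "G \<in> Hom (slice C B) q r"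
    obtain f where f: "F = (p, q, f)" "f \<in> Hom C (Dom C p) (Dom C q)" "q \<odot> f = p" "p \<in> Ob (slice C B)"
      using F by (cases F) (auto simp: Hom_slice_iff)
    obtain g where g: "G = (q, r, g)" "g \<in> Hom C (Dom C q) (Dom C r)" "r \<odot> g = q" "r \<in> Ob (slice C B)"
      using G by (cases G) (auto simp: Hom_slice_iff)
    show "G \<odot>\<^bsub>slice C B\<^esub> F \<in> Hom (slice C B) p r"
      using Comp_in[OF f(2) g(2)] Comp_assoc[OF f(2) g(2) ob[OF g(4)]] f g
      by (simp add: slice_simps Hom_slice_iff)
  next
    fix F p q assume F: "F \<in> Hom (slice C B) p q"
    obtain f where f: "F = (p, q, f)" "f \<in> Hom C (Dom C p) (Dom C q)"
      using F by (cases F) (auto simp: Hom_slice_iff)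
    show "Ident (slice C B) q \<odot>\<^bsub>slice C B\<^esub> F = F" "F \<odot>\<^bsub>slice C B\<^esub> Ident (slice C B) p = F"
      using Ident_left[OF f(2)] Ident_right[OF f(2)] by (simp_all add: f slice_simps)
  next
    fix F G H p q r s
    assume F: "F \<in> Hom (slice C B) p q" and G: "G \<in> Hom (slice C B) q r" and H: "H \<in> Hom (slice C B) r s"
    obtain f where f: "F = (p, q, f)" "f \<in> Hom C (Dom C p) (Dom C q)"
      using F by (cases F) (auto simp: Hom_slice_iff)
    obtain g where g: "G = (q, r, g)" "g \<in> Hom C (Dom C q) (Dom C r)"
      using G by (cases G) (auto simp: Hom_slice_iff)
    obtain h where h: "H = (r, s, h)" "h \<in> Hom C (Dom C r) (Dom C s)"
      using H by (cases H) (auto simp: Hom_slice_iff)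
    show "H \<odot>\<^bsub>slice C B\<^esub> G \<odot>\<^bsub>slice C B\<^esub> F = H \<odot>\<^bsub>slice C B\<^esub> (G \<odot>\<^bsub>slice C B\<^esub> F)"
      using Comp_assoc[OF f(2) g(2) h(2)] by (simp add: f g h slice_simps)
  qed
qed

section \<open>Products and exponentials in the slices\<close>

context smooth_site
begin

abbreviation over_map where
  "over_map B X x Y y f \<equiv> ((X, B, x), (Y, B, y), (X, Y, f))"

lemma Ob_slice: "(X, B', x) \<in> Ob (slice Sm B) \<longleftrightarrow> B' = B \<and> X \<in> Ob Sm \<and> B \<in> Ob Sm \<and> smooth_map X B x"
  unfolding Ob_slice_iff Ar_Sm smooth_category_simps by auto

lemma Ob_sliceE:
  assumes "F \<in> Ob (slice Sm B)"
  obtains X x where "F = (X, B, x)" "X \<in> Ob Sm" "B \<in> Ob Sm" "smooth_map X B x"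
  using assms by (cases F) (auto simp: Ob_slice)

lemma over_map_Hom:
  "over_map B X x Y y f \<in> Hom (slice Sm B) (X, B, x) (Y, B, y) \<longleftrightarrow>
   X \<in> Ob Sm \<and> Y \<in> Ob Sm \<and> B \<in> Ob Sm \<and> smooth_map X B x \<and> smooth_map Y B y \<and> smooth_map X Y f \<and>
   (\<forall>s\<in>points X. y (f s) = x s)"
proof -
  have "compose (points X) y f = x \<longleftrightarrow> (\<forall>s\<in>points X. y (f s) = x s)" if "smooth_map X B x"
    using smooth_map_funcset[OF that] by (auto simp: compose_def fun_eq_iff PiE_iff extensional_def)
  then show ?thesis
    unfolding Hom_slice_iff Ob_slice smooth_category_simps Hom_Sm by auto
qed

lemma slice_HomE:
  assumes "F \<in> Hom (slice Sm B) (X, B, x) (Y, B, y)"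
  obtains f where "F = over_map B X x Y y f" "X \<in> Ob Sm" "Y \<in> Ob Sm" "B \<in> Ob Sm"
    "smooth_map X B x" "smooth_map Y B y" "smooth_map X Y f" "\<And>s. s \<in> points X \<Longrightarrow> y (f s) = x s"
proof -
  obtain p q X' Y' f where F: "F = (p, q, X', Y', f)"
    by (cases F)
  have "p = (X, B, x)" "q = (Y, B, y)" "(X', Y', f) \<in> Hom Sm X Y"
    using assms unfolding F Hom_slice_iff smooth_category_simps by auto
  then have F': "F = over_map B X x Y y f"
    by (simp add: F Hom_Sm)
  show thesis
    using assms that[OF F'] unfolding F' over_map_Hom by blast
qed

lemma over_map_comp:
  "(F, (Z, B, z), (Y, Z, g)) \<odot>\<^bsub>slice Sm B\<^esub> ((X, B, x), F', (X, Y, f)) =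
   over_map B X x Z z (compose (points X) g f)"
  by (simp add: slice_simps smooth_category_simps)

lemma finite_products_slice:
  assumes B: "B \<in> Ob Sm"
  shows "has_finite_products (slice Sm B)"
  unfolding has_finite_products_def
proof (intro allI impI)
  fix I :: "nat set" and Xs assume I: "finite I \<and> Xs ` I \<subseteq> Ob (slice Sm B)"
  define X where "X = (\<lambda>i. fst (Xs i))"
  define x where "x = (\<lambda>i. arrow_fun (Xs i))"
  have Xs: "Xs i = (X i, B, x i)" "X i \<in> Ob Sm" "smooth_map (X i) B (x i)" if "i \<in> I" for i
  proof -
    have "Xs i \<in> Ob (slice Sm B)" using I that by auto
    then show "Xs i = (X i, B, x i)" "X i \<in> Ob Sm" "smooth_map (X i) B (x i)"
      by (auto elim!: Ob_sliceE simp: X_def x_def)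
  qed
  \<comment> \<open>The index \<open>None\<close> carries the common base point. As a component of
    its own it supplies the structure map of the product, and for the empty family it leaves
    \<open>B\<close> itself, the terminal object of the slice.\<close>
  define K where "K = insert None (Some ` I)"
  define X' where "X' = case_option B X"
  define R where "R = (\<lambda>v. \<forall>i\<in>I. x i (v (Some i)) = v None)"
  have "small' K" using I by (simp add: K_def finite_small)
  moreover have "X' k \<in> Ob Sm" if "k \<in> K" for k
    using that B Xs(2) by (auto simp: K_def X'_def)
  ultimately obtain L \<pi> where L: "L \<in> Ob Sm" and \<pi>: "\<forall>k\<in>K. smooth_map L (X' k) (\<pi> k)"
    and R: "\<forall>a\<in>points L. R (\<lambda>k\<in>K. \<pi> k a)"
    and univ: "\<forall>A \<alpha>. A \<in> Ob Sm \<and> (\<forall>k\<in>K. smooth_map A (X' k) (\<alpha> k)) \<and>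
       (\<forall>a\<in>points A. R (\<lambda>k\<in>K. \<alpha> k a)) \<longrightarrow>
       (\<exists>!h. smooth_map A L h \<and> (\<forall>k\<in>K. compose (points A) (\<pi> k) h = \<alpha> k))"
    using sub_product[where X = X' and R = R] by blast
  have R_iff: "R (\<lambda>k\<in>K. v k) \<longleftrightarrow> (\<forall>i\<in>I. x i (v (Some i)) = v None)" for v
    by (auto simp: R_def K_def)
  have \<pi>N: "smooth_map L B (\<pi> None)" using \<pi> by (auto simp: K_def X'_def)
  have \<pi>S: "smooth_map L (X i) (\<pi> (Some i))" if "i \<in> I" for i using \<pi> that by (auto simp: K_def X'_def)
  define pr where "pr = (\<lambda>i. over_map B L (\<pi> None) (X i) (x i) (\<pi> (Some i)))"
  have "is_product (slice Sm B) I Xs (L, B, \<pi> None) pr"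
    unfolding is_product_def
  proof (intro conjI ballI allI impI)
    show "(L, B, \<pi> None) \<in> Ob (slice Sm B)"
      using L B \<pi>N by (simp add: Ob_slice)
    show "pr i \<in> Hom (slice Sm B) (L, B, \<pi> None) (Xs i)" if "i \<in> I" for i
      unfolding Xs(1)[OF that] pr_def over_map_Hom
      using L B Xs[OF that] \<pi>N \<pi>S[OF that] R that by (simp add: R_iff)
    fix A' \<alpha> assume A': "A' \<in> Ob (slice Sm B)" and \<alpha>: "\<forall>i\<in>I. \<alpha> i \<in> Hom (slice Sm B) A' (Xs i)"
    obtain A a where A: "A' = (A, B, a)" "A \<in> Ob Sm" "smooth_map A B a"
      using A' by (elim Ob_sliceE) (rule that, (assumption | simp)+)
    define \<beta> where "\<beta> = (\<lambda>i. arrow_fun (arrow_fun (\<alpha> i)))"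
    have \<alpha>_eq: "\<alpha> i = over_map B A a (X i) (x i) (\<beta> i)" and \<beta>: "smooth_map A (X i) (\<beta> i)"
      and over: "\<And>s. s \<in> points A \<Longrightarrow> x i (\<beta> i s) = a s" if "i \<in> I" for i
    proof -
      have "\<alpha> i \<in> Hom (slice Sm B) (A, B, a) (X i, B, x i)" using \<alpha> that Xs A by simp
      then obtain f where "\<alpha> i = over_map B A a (X i) (x i) f" "smooth_map A (X i) f"
          "\<And>s. s \<in> points A \<Longrightarrow> x i (f s) = a s"
        by (elim slice_HomE) (rule that, (assumption | simp)+)
      then show "\<alpha> i = over_map B A a (X i) (x i) (\<beta> i)" "smooth_map A (X i) (\<beta> i)"
        "\<And>s. s \<in> points A \<Longrightarrow> x i (\<beta> i s) = a s"
        by (simp_all add: \<beta>_def)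
    qed
    define \<gamma> where "\<gamma> = case_option a \<beta>"
    have "\<forall>k\<in>K. smooth_map A (X' k) (\<gamma> k)"
      using A \<beta> by (auto simp: K_def X'_def \<gamma>_def)
    moreover have "\<forall>s\<in>points A. R (\<lambda>k\<in>K. \<gamma> k s)"
      using over by (simp add: R_iff \<gamma>_def)
    ultimately have ex1: "\<exists>!h. smooth_map A L h \<and> (\<forall>k\<in>K. compose (points A) (\<pi> k) h = \<gamma> k)"
      using univ[THEN spec, THEN spec, THEN mp, of A \<gamma>] A(2) by simp
    have K_iff: "(\<forall>k\<in>K. compose (points A) (\<pi> k) h = \<gamma> k) \<longleftrightarrow>
        compose (points A) (\<pi> None) h = a \<and> (\<forall>i\<in>I. compose (points A) (\<pi> (Some i)) h = \<beta> i)" for h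
      by (simp add: K_def \<gamma>_def)
    from ex1 obtain h where h: "smooth_map A L h" "compose (points A) (\<pi> None) h = a"
        "\<forall>i\<in>I. compose (points A) (\<pi> (Some i)) h = \<beta> i"
      unfolding K_iff by (elim ex1E conjE)
    show "\<exists>!h. h \<in> Hom (slice Sm B) A' (L, B, \<pi> None) \<and> (\<forall>i\<in>I. pr i \<odot>\<^bsub>slice Sm B\<^esub> h = \<alpha> i)"
    proof (rule ex1I[of _ "over_map B A a L (\<pi> None) h"])
      show "over_map B A a L (\<pi> None) h \<in> Hom (slice Sm B) A' (L, B, \<pi> None) \<and>
          (\<forall>i\<in>I. pr i \<odot>\<^bsub>slice Sm B\<^esub> over_map B A a L (\<pi> None) h = \<alpha> i)"
        unfolding A(1) over_map_Hom pr_def over_map_comp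
        using A L B \<pi>N h \<alpha>_eq compose_eq_app[OF h(2)] by simp
      fix H assume H: "H \<in> Hom (slice Sm B) A' (L, B, \<pi> None) \<and> (\<forall>i\<in>I. pr i \<odot>\<^bsub>slice Sm B\<^esub> H = \<alpha> i)"
      then have "H \<in> Hom (slice Sm B) (A, B, a) (L, B, \<pi> None)" using A by simp
      then obtain k where k: "H = over_map B A a L (\<pi> None) k" "smooth_map A L k"
          "\<And>s. s \<in> points A \<Longrightarrow> \<pi> None (k s) = a s"
        by (elim slice_HomE) (rule that, (assumption | simp)+)
      have "compose (points A) (\<pi> None) k = a"
        using k(3) smooth_map_funcset[OF A(3)] by (auto simp: compose_def fun_eq_iff PiE_iff extensional_def)
      moreover have "\<forall>i\<in>I. compose (points A) (\<pi> (Some i)) k = \<beta> i"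
        using H \<alpha>_eq unfolding k(1) pr_def over_map_comp by simp
      ultimately have "k = h"
        using ex1 k(2) h unfolding K_iff by (elim ex1E) metis
      then show "H = over_map B A a L (\<pi> None) h" using k by simp
    qed
  qed
  then show "\<exists>P \<pi>. is_product (slice Sm B) I Xs P \<pi>" by blast
qed

text \<open>A choice is fixed because \<open>cartesian_closedI\<close> expects the product object
  and its projections as functions of the factors.\<close>

definition fibre_product where
  "fibre_product A a Y y = (SOME t. is_pullback_space A a Y y (fst t) (fst (snd t)) (snd (snd t)))"

definition fibre_product_space where "fibre_product_space A a Y y = fst (fibre_product A a Y y)"
definition fibre_product_fst where "fibre_product_fst A a Y y = fst (snd (fibre_product A a Y y))"
definition fibre_product_snd where "fibre_product_snd A a Y y = snd (snd (fibre_product A a Y y))"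

lemma fibre_product:
  assumes "A \<in> Ob Sm" "Y \<in> Ob Sm"
  shows "is_pullback_space A a Y y (fibre_product_space A a Y y) (fibre_product_fst A a Y y)
    (fibre_product_snd A a Y y)"
proof -
  obtain P p q where "is_pullback_space A a Y y P p q"
    using pullback_space_ex[OF assms] by blast
  then have "is_pullback_space A a Y y (fst (P, p, q)) (fst (snd (P, p, q))) (snd (snd (P, p, q)))"
    by simp
  then show ?thesis
    unfolding fibre_product_space_def fibre_product_fst_def fibre_product_snd_def fibre_product_def
    by (rule someI)
qed

text \<open>The structure map over the base, taken through the first factor; the matching equation
  makes it equal to the one through the second.\<close>

definition fibre_product_base where
  "fibre_product_base A a Y y =
     compose (points (fibre_product_space A a Y y)) a (fibre_product_fst A a Y y)"

definition slice_product where
  "slice_product B F G = (fibre_product_space (fst F) (arrow_fun F) (fst G) (arrow_fun G), B,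
     fibre_product_base (fst F) (arrow_fun F) (fst G) (arrow_fun G))"

definition slice_fst where
  "slice_fst B F G = (slice_product B F G, F, (fst (slice_product B F G), fst F,
     fibre_product_fst (fst F) (arrow_fun F) (fst G) (arrow_fun G)))"

definition slice_snd where
  "slice_snd B F G = (slice_product B F G, G, (fst (slice_product B F G), fst G,
     fibre_product_snd (fst F) (arrow_fun F) (fst G) (arrow_fun G)))"

context
  fixes B A a Y y P p q d
  assumes A: "A \<in> Ob Sm" and Y: "Y \<in> Ob Sm" and B: "B \<in> Ob Sm"
    and a: "smooth_map A B a" and y: "smooth_map Y B y"
  defines "P \<equiv> fibre_product_space A a Y y" and "p \<equiv> fibre_product_fst A a Y y"
    and "q \<equiv> fibre_product_snd A a Y y" and "d \<equiv> fibre_product_base A a Y y"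
begin

lemma fibre_product': "is_pullback_space A a Y y P p q"
  unfolding P_def p_def q_def using A Y by (rule fibre_product)

lemma fibre_product_base: "smooth_map P B d" "w \<in> points P \<Longrightarrow> d w = a (p w)"
proof -
  note pb = A Y fibre_product'
  show "smooth_map P B d"
    using smooth_map_compose[OF Ob_space[OF pullback_space_Ob[OF pb]] pullback_space_fst[OF pb] a]
    by (simp add: d_def fibre_product_base_def P_def p_def)
  show "w \<in> points P \<Longrightarrow> d w = a (p w)"
    by (simp add: d_def fibre_product_base_def P_def p_def compose_def)
qed

lemma slice_product_eqs:
  "slice_product B (A, B, a) (Y, B, y) = (P, B, d)"
  "slice_fst B (A, B, a) (Y, B, y) = over_map B P d A a p"
  "slice_snd B (A, B, a) (Y, B, y) = over_map B P d Y y q"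
  by (simp_all add: slice_product_def slice_fst_def slice_snd_def P_def p_def q_def d_def)

lemma slice_fst_Hom: "over_map B P d A a p \<in> Hom (slice Sm B) (P, B, d) (A, B, a)"
  and slice_snd_Hom: "over_map B P d Y y q \<in> Hom (slice Sm B) (P, B, d) (Y, B, y)"
proof -
  note pb = A Y fibre_product'
  have "d s = y (q s)" if "s \<in> points P" for s
    using fibre_product_base(2)[OF that] pullback_space_square[OF pb that] by simp
  then show "over_map B P d A a p \<in> Hom (slice Sm B) (P, B, d) (A, B, a)"
    "over_map B P d Y y q \<in> Hom (slice Sm B) (P, B, d) (Y, B, y)"
    unfolding over_map_Hom
    using A Y B a y pullback_space_Ob[OF pb] pullback_space_fst[OF pb] pullback_space_snd[OF pb]
      fibre_product_base by simp_all
qed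

text \<open>Two arrows of the slice with a common source automatically match, since both commute
  with the structure maps; so they factor through the fibre product.\<close>

lemma slice_binary_product:
  "is_binary_product (slice Sm B) (A, B, a) (Y, B, y) (P, B, d) (over_map B P d A a p) (over_map B P d Y y q)"
  unfolding is_binary_product_def
proof (intro conjI ballI)
  note pb = A Y fibre_product'
  have PO: "P \<in> Ob Sm" using pullback_space_Ob[OF pb] .
  show "(P, B, d) \<in> Ob (slice Sm B)"
    using PO B fibre_product_base(1) by (simp add: Ob_slice)
  show "over_map B P d A a p \<in> Hom (slice Sm B) (P, B, d) (A, B, a)"
    "over_map B P d Y y q \<in> Hom (slice Sm B) (P, B, d) (Y, B, y)"
    by (fact slice_fst_Hom slice_snd_Hom)+
  fix X' F G
  assume X': "X' \<in> Ob (slice Sm B)" and F: "F \<in> Hom (slice Sm B) X' (A, B, a)"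
    and G: "G \<in> Hom (slice Sm B) X' (Y, B, y)"
  obtain X x where X: "X' = (X, B, x)" "X \<in> Ob Sm" "smooth_map X B x"
    using X' by (elim Ob_sliceE) (rule that, (assumption | simp)+)
  obtain f where f: "F = over_map B X x A a f" "smooth_map X A f" "\<And>s. s \<in> points X \<Longrightarrow> a (f s) = x s"
    using F unfolding X(1) by (elim slice_HomE) (rule that, (assumption | simp)+)
  obtain g where g: "G = over_map B X x Y y g" "smooth_map X Y g" "\<And>s. s \<in> points X \<Longrightarrow> y (g s) = x s"
    using G unfolding X(1) by (elim slice_HomE) (rule that, (assumption | simp)+)
  have eq: "a (f s) = y (g s)" if "s \<in> points X" for s
    using f(3)[OF that] g(3)[OF that] by simp
  obtain h where h: "smooth_map X P h" "compose (points X) p h = f" "compose (points X) q h = g"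
    by (rule pullback_space_map[OF pb Ob_space[OF X(2)] f(2) g(2) eq])
  have hP: "h s \<in> points P" if "s \<in> points X" for s
    using smooth_map_funcset[OF h(1)] that by auto
  show "\<exists>!H. H \<in> Hom (slice Sm B) X' (P, B, d) \<and>
      over_map B P d A a p \<odot>\<^bsub>slice Sm B\<^esub> H = F \<and> over_map B P d Y y q \<odot>\<^bsub>slice Sm B\<^esub> H = G"
  proof (rule ex1I[of _ "over_map B X x P d h"])
    have "d (h s) = x s" if "s \<in> points X" for s
      using fibre_product_base(2)[OF hP[OF that]] compose_eq_app[OF h(2) that] f(3)[OF that] by simp
    then show "over_map B X x P d h \<in> Hom (slice Sm B) X' (P, B, d) \<and>
        over_map B P d A a p \<odot>\<^bsub>slice Sm B\<^esub> over_map B X x P d h = F \<and>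
        over_map B P d Y y q \<odot>\<^bsub>slice Sm B\<^esub> over_map B X x P d h = G"
      unfolding X(1) over_map_Hom over_map_comp using X PO B fibre_product_base(1) h f g by simp
    fix H assume H: "H \<in> Hom (slice Sm B) X' (P, B, d) \<and>
      over_map B P d A a p \<odot>\<^bsub>slice Sm B\<^esub> H = F \<and> over_map B P d Y y q \<odot>\<^bsub>slice Sm B\<^esub> H = G"
    then have "H \<in> Hom (slice Sm B) (X, B, x) (P, B, d)" using X by simp
    then obtain k where k: "H = over_map B X x P d k" "smooth_map X P k"
      by (elim slice_HomE) (rule that, (assumption | simp)+)
    have pk: "compose (points X) p k = f" "compose (points X) q k = g"
      using H unfolding k(1) over_map_comp f(1) g(1) by simp_all
    have "k = h"
    proof (rule smooth_map_eqI[OF k(2) h(1)])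
      fix s assume s: "s \<in> points X"
      show "k s = h s"
      proof (rule pullback_space_eqI[OF pb _ hP[OF s]])
        show "k s \<in> points P" using smooth_map_funcset[OF k(2)] s by auto
        show "p (k s) = p (h s)" "q (k s) = q (h s)"
          using compose_eq_app[OF pk(1) s] compose_eq_app[OF h(2) s]
            compose_eq_app[OF pk(2) s] compose_eq_app[OF h(3) s] by simp_all
      qed
    qed
    then show "H = over_map B X x P d h" using k by simp
  qed
qed

end

text \<open>The exponential comes from \<open>fibre_exponential\<close>; what remains is to
  translate its pointwise universal property into equations between arrows of the slice.\<close>

lemma cartesian_closed_slice:
  assumes B: "B \<in> Ob Sm"
  shows "cartesian_closed (slice Sm B)"
proof (rule cartesian_closedI[OF category_slice[OF category_Sm] finite_products_slice[OF B]])
  fix F G assume "F \<in> Ob (slice Sm B)" "G \<in> Ob (slice Sm B)"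
  then show "is_binary_product (slice Sm B) F G (slice_product B F G) (slice_fst B F G) (slice_snd B F G)"
  proof (elim Ob_sliceE)
    fix A a Y y
    assume *: "F = (A, B, a)" "A \<in> Ob Sm" "smooth_map A B a" "G = (Y, B, y)" "Y \<in> Ob Sm" "smooth_map Y B y"
    show ?thesis
      unfolding *(1,4) slice_product_eqs[OF *(2,5) B *(3,6)]
      by (rule slice_binary_product[OF *(2,5) B *(3,6)])
  qed
next
  fix Y' Z' assume "Y' \<in> Ob (slice Sm B)" "Z' \<in> Ob (slice Sm B)"
  then obtain Y y Z z where Y': "Y' = (Y, B, y)" and Y: "Y \<in> Ob Sm" and y: "smooth_map Y B y"
    and Z': "Z' = (Z, B, z)" and Z: "Z \<in> Ob Sm" and z: "smooth_map Z B z"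
    by (elim Ob_sliceE) blast
  define P where "P = (\<lambda>A a. fibre_product_space A a Y y)"
  define p where "p = (\<lambda>A a. fibre_product_fst A a Y y)"
  define q where "q = (\<lambda>A a. fibre_product_snd A a Y y)"
  define d where "d = (\<lambda>A a. fibre_product_base A a Y y)"
  have PB: "is_pullback_space A a Y y (P A a) (p A a) (q A a)" if "A \<in> Ob Sm" for A a
    unfolding P_def p_def q_def using that Y by (rule fibre_product)
  have pullbacks: "\<forall>A\<in>Ob Sm. \<forall>a. is_pullback_space A a Y y (P A a) (p A a) (q A a)"
    using PB by simp
  obtain G g \<epsilon> where G: "G \<in> Ob Sm" and g: "smooth_map G B g" and \<epsilon>: "smooth_map (P G g) Z \<epsilon>"
    and \<epsilon>_over: "\<forall>w\<in>points (P G g). z (\<epsilon> w) = g (p G g w)"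
    and univ: "\<forall>A a h. A \<in> Ob Sm \<and> smooth_map A B a \<and> smooth_map (P A a) Z h \<and>
       (\<forall>w\<in>points (P A a). z (h w) = a (p A a w)) \<longrightarrow>
       (\<exists>!k. smooth_map A G k \<and> (\<forall>s\<in>points A. g (k s) = a s) \<and>
          (\<forall>w\<in>points (P A a). \<forall>w'\<in>points (P G g).
             p G g w' = k (p A a w) \<and> q G g w' = q A a w \<longrightarrow> \<epsilon> w' = h w))"
    using fibre_exponential[of B Y Z y z P p q, OF B Y Z y z pullbacks] by (elim exE conjE)
  note PG = G Y PB[OF G, of g]
  have eqs: "slice_product B (A, B, a) (Y, B, y) = (P A a, B, d A a)"
      "slice_fst B (A, B, a) (Y, B, y) = over_map B (P A a) (d A a) A a (p A a)"
      "slice_snd B (A, B, a) (Y, B, y) = over_map B (P A a) (d A a) Y y (q A a)"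
    and dA: "smooth_map (P A a) B (d A a)" "\<And>w. w \<in> points (P A a) \<Longrightarrow> d A a w = a (p A a w)"
    if "A \<in> Ob Sm" "smooth_map A B a" for A a
    unfolding P_def p_def q_def d_def
    using slice_product_eqs[OF that(1) Y B that(2) y] fibre_product_base[OF that(1) Y B that(2) y] by simp_all
  have PO: "P A a \<in> Ob Sm" if "A \<in> Ob Sm" for A a
    using pullback_space_Ob[OF that Y PB[OF that]] .
  define E where "E = over_map B (P G g) (d G g) Z z \<epsilon>"
  have E: "E \<in> Hom (slice Sm B) (P G g, B, d G g) (Z, B, z)"
    unfolding E_def over_map_Hom using PO[OF G] Z B dA[OF G g] z \<epsilon> \<epsilon>_over by simp
  have "\<exists>!K. K \<in> Hom (slice Sm B) A' (G, B, g) \<and>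
      (\<exists>M\<in>Hom (slice Sm B) (slice_product B A' Y') (slice_product B (G, B, g) Y').
         slice_fst B (G, B, g) Y' \<odot>\<^bsub>slice Sm B\<^esub> M = K \<odot>\<^bsub>slice Sm B\<^esub> slice_fst B A' Y' \<and>
         slice_snd B (G, B, g) Y' \<odot>\<^bsub>slice Sm B\<^esub> M = slice_snd B A' Y' \<and> E \<odot>\<^bsub>slice Sm B\<^esub> M = H)"
    if A': "A' \<in> Ob (slice Sm B)" and H: "H \<in> Hom (slice Sm B) (slice_product B A' Y') Z'" for A' H
  proof -
    obtain A a where Aa: "A' = (A, B, a)" and A: "A \<in> Ob Sm" and a: "smooth_map A B a"
      using A' by (elim Ob_sliceE) (rule that, (assumption | simp)+)
    note PA = A Y PB[OF A, of a]
    have "H \<in> Hom (slice Sm B) (P A a, B, d A a) (Z, B, z)"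
      using H unfolding Aa Y' Z' eqs(1)[OF A a] .
    then obtain h where Hh: "H = over_map B (P A a) (d A a) Z z h" and h: "smooth_map (P A a) Z h"
      and h_over: "\<And>w. w \<in> points (P A a) \<Longrightarrow> z (h w) = d A a w"
      by (elim slice_HomE) (rule that, (assumption | simp)+)
    define good where "good = (\<lambda>k. \<forall>w\<in>points (P A a). \<forall>w'\<in>points (P G g).
             p G g w' = k (p A a w) \<and> q G g w' = q A a w \<longrightarrow> \<epsilon> w' = h w)"
    have ex1: "\<exists>!k. smooth_map A G k \<and> (\<forall>s\<in>points A. g (k s) = a s) \<and> good k"
      unfolding good_def using A a h h_over dA(2)[OF A a]
      by (intro univ[THEN spec, THEN spec, THEN spec, THEN mp]) simp
    \<comment> \<open>The projections determine the map underlying \<open>M\<close>: it sends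
      \<open>w\<close> to the point over \<open>k (p A a w)\<close> and \<open>q A a w\<close>.
      Hence the evaluation equation for \<open>M\<close> says the same as
      \<open>good k\<close>.\<close>
    have good_iff: "(\<exists>M\<in>Hom (slice Sm B) (P A a, B, d A a) (P G g, B, d G g).
         over_map B (P G g) (d G g) G g (p G g) \<odot>\<^bsub>slice Sm B\<^esub> M =
           over_map B A a G g k \<odot>\<^bsub>slice Sm B\<^esub> over_map B (P A a) (d A a) A a (p A a) \<and>
         over_map B (P G g) (d G g) Y y (q G g) \<odot>\<^bsub>slice Sm B\<^esub> M =
           over_map B (P A a) (d A a) Y y (q A a) \<and> E \<odot>\<^bsub>slice Sm B\<^esub> M = H) \<longleftrightarrow> good k" (is "?L \<longleftrightarrow> _")
      if k: "smooth_map A G k" and gk: "\<forall>s\<in>points A. g (k s) = a s" for k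
    proof
      assume ?L
      then obtain M where M: "M \<in> Hom (slice Sm B) (P A a, B, d A a) (P G g, B, d G g)"
        "over_map B (P G g) (d G g) G g (p G g) \<odot>\<^bsub>slice Sm B\<^esub> M =
           over_map B A a G g k \<odot>\<^bsub>slice Sm B\<^esub> over_map B (P A a) (d A a) A a (p A a)"
        "over_map B (P G g) (d G g) Y y (q G g) \<odot>\<^bsub>slice Sm B\<^esub> M = over_map B (P A a) (d A a) Y y (q A a)"
        "E \<odot>\<^bsub>slice Sm B\<^esub> M = H" by blast
      obtain \<mu> where \<mu>: "M = over_map B (P A a) (d A a) (P G g) (d G g) \<mu>" "smooth_map (P A a) (P G g) \<mu>"
        using M(1) by (elim slice_HomE) (rule that, (assumption | simp)+)
      have 1: "compose (points (P A a)) (p G g) \<mu> = compose (points (P A a)) k (p A a)"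
        and 2: "compose (points (P A a)) (q G g) \<mu> = q A a"
        and 3: "compose (points (P A a)) \<epsilon> \<mu> = h"
        using M(2-4) unfolding \<mu>(1) E_def Hh over_map_comp by simp_all
      show "good k"
        unfolding good_def
      proof (intro ballI impI)
        fix w w' assume w: "w \<in> points (P A a)" and w': "w' \<in> points (P G g)"
          and eq: "p G g w' = k (p A a w) \<and> q G g w' = q A a w"
        have "w' = \<mu> w"
        proof (rule pullback_space_eqI[OF PG w'])
          show "\<mu> w \<in> points (P G g)" using smooth_map_funcset[OF \<mu>(2)] w by auto
          show "p G g w' = p G g (\<mu> w)" "q G g w' = q G g (\<mu> w)"
            using eq compose_eq_app[OF 1 w] compose_eq_app[OF 2 w] w by (simp_all add: compose_def)
        qed
        then show "\<epsilon> w' = h w" using compose_eq_app[OF 3 w] by simp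
      qed
    next
      assume good: "good k"
      note p_in = smooth_map_funcset[OF pullback_space_fst[OF PA]]
      have eq: "g (compose (points (P A a)) k (p A a) w) = y (q A a w)" if w: "w \<in> points (P A a)" for w
      proof -
        have "p A a w \<in> points A" using p_in w by auto
        then show ?thesis
          using gk pullback_space_square[OF PA w] w by (simp add: compose_def)
      qed
      \<comment> \<open>\<open>\<mu>\<close> is the map of fibre products induced by
        \<open>k\<close>: the first projection followed by \<open>k\<close>, paired with the second
        projection.\<close>
      obtain \<mu> where \<mu>: "smooth_map (P A a) (P G g) \<mu>"
          "compose (points (P A a)) (p G g) \<mu> = compose (points (P A a)) k (p A a)"
          "compose (points (P A a)) (q G g) \<mu> = q A a"
        by (rule pullback_space_map[OF PG Ob_space[OF PO[OF A]]
              smooth_map_compose[OF Ob_space[OF PO[OF A]] pullback_space_fst[OF PA] k]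
              pullback_space_snd[OF PA] eq])
      have \<mu>_in: "\<mu> w \<in> points (P G g)" if "w \<in> points (P A a)" for w
        using smooth_map_funcset[OF \<mu>(1)] that by auto
      have pm: "p G g (\<mu> w) = k (p A a w)" "q G g (\<mu> w) = q A a w" if "w \<in> points (P A a)" for w
        using compose_eq_app[OF \<mu>(2) that] compose_eq_app[OF \<mu>(3) that] that by (simp_all add: compose_def)
      have d\<mu>: "d G g (\<mu> w) = d A a w" if w: "w \<in> points (P A a)" for w
      proof -
        have "p A a w \<in> points A" using p_in w by auto
        then show ?thesis
          using dA(2)[OF G g \<mu>_in[OF w]] dA(2)[OF A a w] pm[OF w] gk by simp
      qed
      have "compose (points (P A a)) \<epsilon> \<mu> = h"
      proof (rule smooth_map_eqI[OF smooth_map_compose[OF Ob_space[OF PO[OF A]] \<mu>(1) \<epsilon>] h])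
        fix w assume w: "w \<in> points (P A a)"
        have "\<epsilon> (\<mu> w) = h w"
          using good pm[OF w] \<mu>_in[OF w] w unfolding good_def by simp
        then show "compose (points (P A a)) \<epsilon> \<mu> w = h w" using w by (simp add: compose_def)
      qed
      moreover have "over_map B (P A a) (d A a) (P G g) (d G g) \<mu> \<in>
          Hom (slice Sm B) (P A a, B, d A a) (P G g, B, d G g)"
        unfolding over_map_Hom
        using PO[OF A] PO[OF G] B dA(1)[OF A a] dA(1)[OF G g] \<mu>(1) d\<mu> by simp
      ultimately show ?L
        using \<mu>(2,3)
        by (intro bexI[of _ "over_map B (P A a) (d A a) (P G g) (d G g) \<mu>"])
           (simp_all add: over_map_comp E_def Hh)
    qed
    from ex1 obtain k where k: "smooth_map A G k" "\<forall>s\<in>points A. g (k s) = a s" "good k"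
      by (elim ex1E conjE)
    show ?thesis
      unfolding Aa Y' Z' eqs[OF A a] eqs[OF G g]
    proof (rule ex1I[of _ "over_map B A a G g k"])
      have "over_map B A a G g k \<in> Hom (slice Sm B) (A, B, a) (G, B, g)"
        unfolding over_map_Hom using A G B a g k by simp
      then show "over_map B A a G g k \<in> Hom (slice Sm B) (A, B, a) (G, B, g) \<and>
        (\<exists>M\<in>Hom (slice Sm B) (P A a, B, d A a) (P G g, B, d G g).
         over_map B (P G g) (d G g) G g (p G g) \<odot>\<^bsub>slice Sm B\<^esub> M =
           over_map B A a G g k \<odot>\<^bsub>slice Sm B\<^esub> over_map B (P A a) (d A a) A a (p A a) \<and>
         over_map B (P G g) (d G g) Y y (q G g) \<odot>\<^bsub>slice Sm B\<^esub> M =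
           over_map B (P A a) (d A a) Y y (q A a) \<and> E \<odot>\<^bsub>slice Sm B\<^esub> M = H)"
        using good_iff[OF k(1,2)] k(3) by (intro conjI) (assumption, rule iffD2)
    next
      fix K assume K: "K \<in> Hom (slice Sm B) (A, B, a) (G, B, g) \<and>
        (\<exists>M\<in>Hom (slice Sm B) (P A a, B, d A a) (P G g, B, d G g).
         over_map B (P G g) (d G g) G g (p G g) \<odot>\<^bsub>slice Sm B\<^esub> M =
           K \<odot>\<^bsub>slice Sm B\<^esub> over_map B (P A a) (d A a) A a (p A a) \<and>
         over_map B (P G g) (d G g) Y y (q G g) \<odot>\<^bsub>slice Sm B\<^esub> M =
           over_map B (P A a) (d A a) Y y (q A a) \<and> E \<odot>\<^bsub>slice Sm B\<^esub> M = H)"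
      obtain k' where k': "K = over_map B A a G g k'" "smooth_map A G k'"
          "\<And>s. s \<in> points A \<Longrightarrow> g (k' s) = a s"
        using conjunct1[OF K] by (elim slice_HomE) (rule that, (assumption | simp)+)
      have gk': "\<forall>s\<in>points A. g (k' s) = a s" using k'(3) by simp
      have "good k'"
        using conjunct2[OF K] unfolding k'(1) good_iff[OF k'(2) gk'] .
      then have "k' = k"
        using ex1 k k'(2) gk' by (elim ex1E) metis
      then show "K = over_map B A a G g k" using k'(1) by simp
    qed
  qed
  then show "\<exists>G \<epsilon>. G \<in> Ob (slice Sm B) \<and> \<epsilon> \<in> Hom (slice Sm B) (slice_product B G Y') Z' \<and>
      (\<forall>A'\<in>Ob (slice Sm B). \<forall>H\<in>Hom (slice Sm B) (slice_product B A' Y') Z'.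
         \<exists>!K. K \<in> Hom (slice Sm B) A' G \<and>
           (\<exists>M\<in>Hom (slice Sm B) (slice_product B A' Y') (slice_product B G Y').
              slice_fst B G Y' \<odot>\<^bsub>slice Sm B\<^esub> M = K \<odot>\<^bsub>slice Sm B\<^esub> slice_fst B A' Y' \<and>
              slice_snd B G Y' \<odot>\<^bsub>slice Sm B\<^esub> M = slice_snd B A' Y' \<and> \<epsilon> \<odot>\<^bsub>slice Sm B\<^esub> M = H))"
    using E G g B by (intro exI[of _ "(G, B, g)"] exI[of _ E]) (simp add: Ob_slice Y' Z' eqs)
qed

end

section \<open>The weak subobject classifier\<close>

context smooth_site
begin

text \<open>The initial structure for the empty family puts no condition on a function from a
  domain; the remaining arguments only settle the types.\<close>

definition codiscrete_space :: "'u set \<Rightarrow> 'u plot_space" where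
  "codiscrete_space P = initial_space P ({} :: nat set) (undefined :: nat \<Rightarrow> 'u plot_space) undefined"

lemma points_codiscrete_space [simp]: "points (codiscrete_space P) = P"
  by (simp add: codiscrete_space_def)

lemma codiscrete_space_Ob:
  assumes "finite P"
  shows "codiscrete_space P \<in> Ob Sm"
proof -
  have "space (codiscrete_space P)"
    unfolding codiscrete_space_def by (rule space_initial_space) auto
  then show ?thesis
    using finite_small[OF assms] by (simp add: Ob_Sm)
qed

lemma smooth_map_codiscrete_space:
  assumes "space A"
  shows "smooth_map A (codiscrete_space P) h \<longleftrightarrow> h \<in> points A \<rightarrow>\<^sub>E P"
proof
  show "h \<in> points A \<rightarrow>\<^sub>E P" if "smooth_map A (codiscrete_space P) h"
    using smooth_map_funcset[OF that] by simp
  show "smooth_map A (codiscrete_space P) h" if "h \<in> points A \<rightarrow>\<^sub>E P"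
    unfolding codiscrete_space_def using assms that by (rule smooth_map_into_initial_space) simp
qed

text \<open>Factoring a strong monomorphism through its image with the subspace structure exhibits it as
  an embedding of a subspace.\<close>

lemma strong_mono_embedding:
  assumes i: "is_strong_mono Sm (A, X, i)"
  shows "inj_on i (points A)"
    and "\<And>n U \<phi>. \<phi> \<in> U \<rightarrow>\<^sub>E points A \<Longrightarrow> compose U i \<phi> \<in> plots X n U \<Longrightarrow> \<phi> \<in> plots A n U"
proof -
  have "(A, X, i) \<in> Ar Sm"
    using i by (simp add: is_strong_mono_def is_mono_def)
  then have A: "A \<in> Ob Sm" and X: "X \<in> Ob Sm" and si: "smooth_map A X i"
    by (simp_all add: Ar_Sm)
  have iA: "i \<in> points A \<rightarrow>\<^sub>E points X" using smooth_map_funcset[OF si] .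
  define P where "P = i ` points A"
  define M where "M = initial_space P {()} (\<lambda>_. X) (\<lambda>_ x. x)"
  have PX: "P \<subseteq> points X" using iA by (auto simp: P_def)
  have "space M"
    unfolding M_def using Ob_space[OF X] PX by (intro space_initial_space) auto
  moreover have ptsM: "points M = P" by (simp add: M_def)
  ultimately have M: "M \<in> Ob Sm"
    using small_image[OF Ob_small[OF A]] by (simp add: Ob_Sm P_def)
  have "compose (points A) (\<lambda>x. x) i = i"
    using iA by (auto simp: compose_def fun_eq_iff PiE_iff extensional_def)
  then have siM: "smooth_map A M i"
    unfolding M_def using Ob_space[OF A] iA si
    by (intro smooth_map_into_initial_space) (auto simp: P_def)
  have incl: "smooth_map M X (\<lambda>x\<in>P. x)"
    unfolding M_def by (rule smooth_map_initial_space) (use PX in auto)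
  \<comment> \<open>The points of \<open>M\<close> are exactly the image of \<open>i\<close>, so
    \<open>i\<close> is surjective onto \<open>M\<close>, and arrows are determined by their values
    on points.\<close>
  have epi: "is_epi Sm (A, M, i)"
    unfolding is_epi_def smooth_category_simps
  proof (intro conjI allI ballI impI)
    show "(A, M, i) \<in> Ar Sm" using A M siM by (simp add: Ar_Sm)
    fix Z F G assume F: "F \<in> Hom Sm M Z" and G: "G \<in> Hom Sm M Z"
      and eq: "F \<odot>\<^bsub>Sm\<^esub> (A, M, i) = G \<odot>\<^bsub>Sm\<^esub> (A, M, i)"
    obtain f where f: "F = (M, Z, f)" "smooth_map M Z f" using F by (elim Hom_SmE) (rule that, (assumption | simp)+)
    obtain g where g: "G = (M, Z, g)" "smooth_map M Z g" using G by (elim Hom_SmE) (rule that, (assumption | simp)+)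
    have eq': "compose (points A) f i = compose (points A) g i"
      using eq by (simp add: f g smooth_category_simps)
    have "f = g"
    proof (rule smooth_map_eqI[OF f(2) g(2)])
      fix x assume "x \<in> points M"
      then obtain s where s: "s \<in> points A" "x = i s" by (auto simp: ptsM P_def)
      show "f x = g x" using compose_eq_app[OF eq' s(1)] s by (simp add: compose_def)
    qed
    then show "F = G" by (simp add: f g)
  qed
  have ident: "(A, A, \<lambda>x\<in>points A. x) \<in> Hom Sm A A"
    using A smooth_map_ident[OF Ob_space[OF A]] by (simp add: Hom_Sm)
  \<comment> \<open>\<open>i\<close> factors through its image \<open>M\<close>. With the identity
    of \<open>A\<close> on top, the diagonal of this square is a smooth map \<open>t\<close> from
    \<open>M\<close> back to \<open>A\<close> that inverts \<open>i\<close>; it transfers plots of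
    the subspace to plots of \<open>A\<close>.\<close>
  have square: "(A, X, i) \<odot>\<^bsub>Sm\<^esub> (A, A, \<lambda>x\<in>points A. x) = (M, X, \<lambda>x\<in>P. x) \<odot>\<^bsub>Sm\<^esub> (A, M, i)"
    unfolding smooth_category_simps by (auto simp: compose_def P_def)
  have "\<exists>!t. t \<in> Hom Sm (Cod Sm (A, M, i)) (Dom Sm (A, X, i)) \<and>
      t \<odot>\<^bsub>Sm\<^esub> (A, M, i) = (A, A, \<lambda>x\<in>points A. x) \<and> (A, X, i) \<odot>\<^bsub>Sm\<^esub> t = (M, X, \<lambda>x\<in>P. x)"
  proof (rule conjunct2[OF i[unfolded is_strong_mono_def], THEN spec, THEN spec, THEN spec, THEN mp], intro conjI)
    show "is_epi Sm (A, M, i)" by (fact epi)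
    show "(A, A, \<lambda>x\<in>points A. x) \<in> Hom Sm (Dom Sm (A, M, i)) (Dom Sm (A, X, i))"
      using ident by (simp add: smooth_category_simps)
    show "(M, X, \<lambda>x\<in>P. x) \<in> Hom Sm (Cod Sm (A, M, i)) (Cod Sm (A, X, i))"
      using M X incl by (simp add: smooth_category_simps Hom_Sm)
  qed (fact square)
  then obtain T where T: "T \<in> Hom Sm M A" "T \<odot>\<^bsub>Sm\<^esub> (A, M, i) = (A, A, \<lambda>x\<in>points A. x)"
    unfolding smooth_category_simps by (elim ex1E conjE)
  obtain t where t: "T = (M, A, t)" "smooth_map M A t" using T(1) by (elim Hom_SmE) (rule that, (assumption | simp)+)
  have comp: "compose (points A) t i = (\<lambda>x\<in>points A. x)"
    using T(2) by (simp add: t smooth_category_simps)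
  have ti: "t (i s) = s" if "s \<in> points A" for s
    using compose_eq_app[OF comp that] that by simp
  show "inj_on i (points A)"
    using ti by (rule inj_on_inverseI)
  fix n U \<phi> assume \<phi>: "\<phi> \<in> U \<rightarrow>\<^sub>E points A" and pl: "compose U i \<phi> \<in> plots X n U"
  have "compose U (\<lambda>x. x) (compose U i \<phi>) = compose U i \<phi>"
    by (auto simp: compose_def)
  then have "compose U i \<phi> \<in> plots M n U"
    using \<phi> pl plot_domain[OF Ob_space[OF X] pl]
    by (auto simp: M_def plots_initial_space P_def compose_def)
  then have "compose U t (compose U i \<phi>) \<in> plots A n U"
    by (rule smooth_map_plot[OF t(2)])
  moreover have "compose U t (compose U i \<phi>) = \<phi>"
    using \<phi> ti by (auto simp: compose_def fun_eq_iff PiE_iff extensional_def)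
  ultimately show "\<phi> \<in> plots A n U" by simp
qed

text \<open>Every function into a codiscrete space is smooth, so a map to \<open>\<Omega>\<close>
  amounts to a subset, with \<open>t0\<close> marking membership. The structure on that subset is no
  further datum, because strong monomorphisms are embeddings.\<close>

lemma weak_subobject_classifier_Sm: "\<exists>\<Omega> tr. is_weak_subobject_classifier Sm \<Omega> tr"
proof -
  obtain t0 :: 'u where "t0 \<in> UNIV" by blast
  \<comment> \<open>Infinity of the universe type provides the second truth value.\<close>
  obtain t1 :: 'u where ne: "t1 \<noteq> t0"
    using infinite_universe ex_new_if_finite[of "{t0}"] by auto
  define one where "one = codiscrete_space {t0}"
  define \<Omega> where "\<Omega> = codiscrete_space {t0, t1}"
  define tr where "tr = (\<lambda>x\<in>{t0}. t0)"
  have one: "one \<in> Ob Sm" and \<Omega>: "\<Omega> \<in> Ob Sm"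
    by (simp_all add: one_def \<Omega>_def codiscrete_space_Ob)
  have pts: "points one = {t0}" "points \<Omega> = {t0, t1}" by (simp_all add: one_def \<Omega>_def)
  have to_one: "smooth_map A one h \<longleftrightarrow> h = (\<lambda>_\<in>points A. t0)" if "A \<in> Ob Sm" for A h
    unfolding one_def smooth_map_codiscrete_space[OF Ob_space[OF that]]
    by (auto simp: PiE_iff extensional_def fun_eq_iff)
  have to_\<Omega>: "smooth_map A \<Omega> h \<longleftrightarrow> h \<in> points A \<rightarrow>\<^sub>E {t0, t1}" if "A \<in> Ob Sm" for A h
    unfolding \<Omega>_def by (rule smooth_map_codiscrete_space[OF Ob_space[OF that]])
  have tr: "smooth_map one \<Omega> tr"
    unfolding to_\<Omega>[OF one] by (auto simp: pts tr_def)
  have one_Hom: "F \<in> Hom Sm A one \<longleftrightarrow> F = (A, one, \<lambda>_\<in>points A. t0)" if "A \<in> Ob Sm" for A F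
    using that one to_one[OF that] by (cases F) (auto simp: Hom_Sm)
  have terminal: "is_terminal Sm one"
    unfolding is_terminal_def using one one_Hom by auto
  \<comment> \<open>The pullback property becomes an equality of subsets of \<open>X\<close>. It
    determines \<open>c\<close>, since \<open>\<Omega>\<close> has only the two values.\<close>
  have pb_iff: "is_pullback Sm (X, \<Omega>, c) (one, \<Omega>, tr) (A, X, i) (A, one, \<lambda>_\<in>points A. t0) \<longleftrightarrow>
      (\<forall>x\<in>points X. c x = t0 \<longleftrightarrow> x \<in> i ` points A)" (is "?L \<longleftrightarrow> ?R")
    if i: "is_strong_mono Sm (A, X, i)" and c: "smooth_map X \<Omega> c" for A X i c
  proof -
    have "(A, X, i) \<in> Ar Sm"
      using i by (simp add: is_strong_mono_def is_mono_def)
    then have A: "A \<in> Ob Sm" and X: "X \<in> Ob Sm" and si: "smooth_map A X i"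
      by (simp_all add: Ar_Sm)
    have iA: "i \<in> points A \<rightarrow>\<^sub>E points X" using smooth_map_funcset[OF si] .
    note emb = strong_mono_embedding[OF i]
    have comm: "(X, \<Omega>, c) \<odot>\<^bsub>Sm\<^esub> (Z, X, a) = (one, \<Omega>, tr) \<odot>\<^bsub>Sm\<^esub> (Z, one, \<lambda>_\<in>points Z. t0) \<longleftrightarrow>
        (\<forall>s\<in>points Z. c (a s) = t0)" for Z a
      unfolding smooth_category_simps by (auto simp: compose_def tr_def fun_eq_iff)
    show ?thesis
    proof
      assume L: ?L
      show ?R
      proof (intro ballI iffI)
        fix x assume "x \<in> i ` points A"
        moreover have "\<forall>s\<in>points A. c (i s) = t0"
          using L unfolding is_pullback_def comm by simp
        ultimately show "c x = t0" by auto
      next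
        fix x assume x: "x \<in> points X" and cx: "c x = t0"
        \<comment> \<open>The point \<open>x\<close> regarded as a map from the terminal space,
          smooth because it turns plots into constant plots. The pullback property lifts it through
          \<open>i\<close>.\<close>
        define a where "a = (\<lambda>_\<in>points one. x)"
        have "smooth_map one X a"
          unfolding smooth_map_def
        proof (intro conjI allI ballI)
          show "a \<in> points one \<rightarrow>\<^sub>E points X" using x by (auto simp: a_def)
          fix n U \<phi> assume \<phi>: "\<phi> \<in> plots one n U"
          have "compose U a \<phi> = (\<lambda>_\<in>U. x)"
            using plot_funcset[OF Ob_space[OF one] \<phi>]
            by (auto simp: compose_def a_def restrict_def fun_eq_iff PiE_iff)
          then show "compose U a \<phi> \<in> plots X n U"
            using plot_const[OF Ob_space[OF X] x] plot_domain[OF Ob_space[OF one] \<phi>] by simp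
        qed
        then have a: "(one, X, a) \<in> Hom Sm one X" using one X by (simp add: Hom_Sm)
        have b: "(one, one, \<lambda>_\<in>points one. t0) \<in> Hom Sm one one" using one_Hom[OF one] by simp
        have "\<forall>s\<in>points one. c (a s) = t0" using cx by (simp add: a_def)
        then have "\<exists>!h. h \<in> Hom Sm one A \<and> (A, X, i) \<odot>\<^bsub>Sm\<^esub> h = (one, X, a) \<and>
            (A, one, \<lambda>_\<in>points A. t0) \<odot>\<^bsub>Sm\<^esub> h = (one, one, \<lambda>_\<in>points one. t0)"
          using L a b unfolding is_pullback_def smooth_category_simps(1,2) comm[symmetric] by blast
        then obtain H where H: "H \<in> Hom Sm one A" "(A, X, i) \<odot>\<^bsub>Sm\<^esub> H = (one, X, a)"
          by (elim ex1E conjE)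
        obtain h where h: "H = (one, A, h)" "smooth_map one A h" using H(1) by (elim Hom_SmE) (rule that, (assumption | simp)+)
        have "compose (points one) i h = a"
          using H(2) by (simp add: h smooth_category_simps)
        then have "i (h t0) = x"
          using compose_eq_app[of "points one" i h a t0] by (simp add: pts a_def)
        moreover have "h t0 \<in> points A"
          using smooth_map_funcset[OF h(2)] by (auto simp: pts)
        ultimately show "x \<in> i ` points A" by blast
      qed
    next
      assume R: ?R
      have Ar: "(X, \<Omega>, c) \<in> Ar Sm" "(one, \<Omega>, tr) \<in> Ar Sm" "(A, X, i) \<in> Ar Sm"
          "(A, one, \<lambda>_\<in>points A. t0) \<in> Ar Sm"
        using X \<Omega> one A c tr si to_one[OF A] by (simp_all add: Ar_Sm)
      show ?L
        unfolding is_pullback_def smooth_category_simps(1,2)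
      proof (intro conjI allI ballI impI Ar refl)
        show "(X, \<Omega>, c) \<odot>\<^bsub>Sm\<^esub> (A, X, i) = (one, \<Omega>, tr) \<odot>\<^bsub>Sm\<^esub> (A, one, \<lambda>_\<in>points A. t0)"
          unfolding comm using R iA by auto
        fix Z F G assume F: "F \<in> Hom Sm Z X" and G: "G \<in> Hom Sm Z one"
          and eq: "(X, \<Omega>, c) \<odot>\<^bsub>Sm\<^esub> F = (one, \<Omega>, tr) \<odot>\<^bsub>Sm\<^esub> G"
        obtain a where a: "F = (Z, X, a)" "Z \<in> Ob Sm" "smooth_map Z X a" using F by (elim Hom_SmE) (rule that, (assumption | simp)+)
        have G': "G = (Z, one, \<lambda>_\<in>points Z. t0)" using G one_Hom[OF a(2)] by simp
        have aX: "a \<in> points Z \<rightarrow>\<^sub>E points X" using smooth_map_funcset[OF a(3)] .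
        have "\<forall>s\<in>points Z. c (a s) = t0" using eq unfolding a(1) G' comm .
        then have a_im: "a s \<in> i ` points A" if "s \<in> points Z" for s
          using R aX that by auto
        \<comment> \<open>The set-theoretic lift of \<open>a\<close> through \<open>i\<close>.
          Composing it with \<open>i\<close> returns the smooth map \<open>a\<close>, so the
          embedding property makes it smooth, and injectivity of \<open>i\<close> makes it
          unique.\<close>
        define h where "h = (\<lambda>s\<in>points Z. inv_into (points A) i (a s))"
        have hA: "h \<in> points Z \<rightarrow>\<^sub>E points A"
          using inv_into_into[OF a_im] by (auto simp: h_def)
        have ih: "i (h s) = a s" if "s \<in> points Z" for s
          using f_inv_into_f[OF a_im[OF that]] that by (simp add: h_def)
        have ih': "compose (points Z) i h = a"
          using ih aX by (auto simp: compose_def fun_eq_iff PiE_iff extensional_def)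
        have h: "smooth_map Z A h"
          unfolding smooth_map_def
        proof (intro conjI allI ballI hA)
          fix n U \<phi> assume \<phi>: "\<phi> \<in> plots Z n U"
          have \<phi>Z: "\<phi> \<in> U \<rightarrow>\<^sub>E points Z" using plot_funcset[OF Ob_space[OF a(2)] \<phi>] .
          then have \<phi>': "\<phi> \<in> U \<rightarrow> points Z" by auto
          show "compose U h \<phi> \<in> plots A n U"
          proof (rule emb(2))
            show "compose U h \<phi> \<in> U \<rightarrow>\<^sub>E points A"
              using \<phi>Z hA by (intro compose_funcset[of _ _ "points Z"]) auto
            show "compose U i (compose U h \<phi>) \<in> plots X n U"
              using smooth_map_plot[OF a(3) \<phi>] unfolding compose_assoc[OF \<phi>'] ih' .
          qed
        qed
        show "\<exists>!h. h \<in> Hom Sm Z A \<and> (A, X, i) \<odot>\<^bsub>Sm\<^esub> h = F \<and>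
            (A, one, \<lambda>_\<in>points A. t0) \<odot>\<^bsub>Sm\<^esub> h = G"
        proof (rule ex1I[of _ "(Z, A, h)"])
          have "compose (points Z) (\<lambda>_\<in>points A. t0) h = (\<lambda>_\<in>points Z. t0)"
            using hA by (auto simp: compose_def restrict_def fun_eq_iff PiE_iff)
          then show "(Z, A, h) \<in> Hom Sm Z A \<and> (A, X, i) \<odot>\<^bsub>Sm\<^esub> (Z, A, h) = F \<and>
              (A, one, \<lambda>_\<in>points A. t0) \<odot>\<^bsub>Sm\<^esub> (Z, A, h) = G"
            using a(2) A h ih' by (simp add: Hom_Sm smooth_category_simps a(1) G')
          fix K assume K: "K \<in> Hom Sm Z A \<and> (A, X, i) \<odot>\<^bsub>Sm\<^esub> K = F \<and>
              (A, one, \<lambda>_\<in>points A. t0) \<odot>\<^bsub>Sm\<^esub> K = G"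
          obtain k where k: "K = (Z, A, k)" "smooth_map Z A k" using conjunct1[OF K] by (elim Hom_SmE) (rule that, (assumption | simp)+)
          have ik: "compose (points Z) i k = a"
            using K by (simp add: k smooth_category_simps a(1))
          have "k = h"
          proof (rule smooth_map_eqI[OF k(2) h])
            fix s assume s: "s \<in> points Z"
            show "k s = h s"
            proof (rule inj_onD[OF emb(1)])
              show "i (k s) = i (h s)" using compose_eq_app[OF ik s] ih[OF s] by simp
              show "k s \<in> points A" "h s \<in> points A"
                using smooth_map_funcset[OF k(2)] hA s by auto
            qed
          qed
          then show "K = (Z, A, h)" using k by simp
        qed
      qed
    qed
  qed
  have "is_weak_subobject_classifier Sm \<Omega> (one, \<Omega>, tr)"
    unfolding is_weak_subobject_classifier_def smooth_category_simps(1,2)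
  proof (intro conjI allI impI \<Omega> terminal refl)
    show "(one, \<Omega>, tr) \<in> Ar Sm" using one \<Omega> tr by (simp add: Ar_Sm)
    fix F assume F: "is_strong_mono Sm F"
    then have "F \<in> Ar Sm" by (simp add: is_strong_mono_def is_mono_def)
    obtain A X i where Fi: "F = (A, X, i)" by (cases F)
    have A: "A \<in> Ob Sm" and X: "X \<in> Ob Sm" using \<open>F \<in> Ar Sm\<close> by (simp_all add: Fi Ar_Sm)
    have i: "is_strong_mono Sm (A, X, i)" using F by (simp add: Fi)
    have the: "(THE u. u \<in> Hom Sm A one) = (A, one, \<lambda>_\<in>points A. t0)"
      using one_Hom[OF A] by simp
    define c where "c = (\<lambda>x\<in>points X. if x \<in> i ` points A then t0 else t1)"
    have c: "smooth_map X \<Omega> c"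
      unfolding to_\<Omega>[OF X] by (auto simp: c_def)
    show "\<exists>!ch. ch \<in> Hom Sm (Cod Sm F) \<Omega> \<and>
        is_pullback Sm ch (one, \<Omega>, tr) F (THE u. u \<in> Hom Sm (Dom Sm F) one)"
      unfolding Fi smooth_category_simps(1,2) the
    proof (rule ex1I[of _ "(X, \<Omega>, c)"])
      show "(X, \<Omega>, c) \<in> Hom Sm X \<Omega> \<and>
          is_pullback Sm (X, \<Omega>, c) (one, \<Omega>, tr) (A, X, i) (A, one, \<lambda>_\<in>points A. t0)"
        unfolding pb_iff[OF i c] using X \<Omega> c ne by (simp add: Hom_Sm) (simp add: c_def)
      fix K assume K: "K \<in> Hom Sm X \<Omega> \<and>
          is_pullback Sm K (one, \<Omega>, tr) (A, X, i) (A, one, \<lambda>_\<in>points A. t0)"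
      obtain k where k: "K = (X, \<Omega>, k)" "smooth_map X \<Omega> k" using conjunct1[OF K] by (elim Hom_SmE) (rule that, (assumption | simp)+)
      have iff: "\<forall>x\<in>points X. k x = t0 \<longleftrightarrow> x \<in> i ` points A"
        using conjunct2[OF K] unfolding k(1) pb_iff[OF i k(2)] .
      have "k = c"
      proof (rule smooth_map_eqI[OF k(2) c])
        fix x assume x: "x \<in> points X"
        have "k x \<in> {t0, t1}" using smooth_map_funcset[OF k(2)] x by (auto simp: pts)
        then show "k x = c x" using iff x by (auto simp: c_def)
      qed
      then show "K = (X, \<Omega>, c)" using k by simp
    qed
  qed
  then show ?thesis by blast
qed

section \<open>The quasitopos axioms and small limits and colimits\<close>

lemma quasitopos_Sm: "quasitopos Sm"
  and small_limits_Sm: "has_small_limits TYPE('u) Sm"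
  and small_colimits_Sm: "has_small_colimits TYPE('u) Sm"
proof -
  have "locally_cartesian_closed Sm"
    unfolding locally_cartesian_closed_def using cartesian_closed_slice by simp
  moreover have "has_finite_limits Sm"
    unfolding has_finite_limits_def by (intro allI impI limits_Sm finite_small) simp_all
  moreover have "has_finite_colimits Sm"
    unfolding has_finite_colimits_def by (intro allI impI colimits_Sm finite_small) simp_all
  ultimately show "quasitopos Sm"
    unfolding quasitopos_def using category_Sm weak_subobject_classifier_Sm by simp
  \<comment> \<open>\<open>small\<close> depends only on the type of its first argument, so the
    locale parameter \<open>u\<close> and \<open>TYPE('u)\<close> give the same notion.\<close>
  have small: "small' A" if "small TYPE('u) A" for A :: "'u set"
    using that by (simp add: small_def)
  show "has_small_limits TYPE('u) Sm"
    unfolding has_small_limits_def by (intro allI impI limits_Sm small) simp_all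
  show "has_small_colimits TYPE('u) Sm"
    unfolding has_small_colimits_def by (intro allI impI colimits_Sm small) simp_all
qed

end

theorem theorem9:
  fixes C :: "('u plot_space, 'u smooth_arrow) category"
  assumes "grothendieck_universe TYPE('u)"
    and "C = Chen \<or> C = Diffeological"
  shows "quasitopos C \<and> has_small_limits TYPE('u) C \<and> has_small_colimits TYPE('u) C"
proof -
  have u: "universe TYPE('u)"
    using assms(1) by unfold_locales
  interpret chen: smooth_site convex_domain "TYPE('u)"
    using plot_site_convex u by (rule smooth_site.intro)
  interpret diffeological: smooth_site open_domain "TYPE('u)"
    using plot_site_open u by (rule smooth_site.intro)
  have "C = chen.Sm \<or> C = diffeological.Sm"
    using assms(2) by (simp add: Chen_def Diffeological_def chen_space_def diffeological_space_def)
  then show ?thesis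
    using chen.quasitopos_Sm chen.small_limits_Sm chen.small_colimits_Sm
      diffeological.quasitopos_Sm diffeological.small_limits_Sm diffeological.small_colimits_Sm
    by (elim disjE) simp_all
qed

end
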